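(* Let $1<p<q<\infty$ and $\alpha\in(0,1)$ such that $\frac{1}{q}=\frac{1}{p}-\alpha$. If $b\in CMO(\mathbb{R})$, then the commutator $[b,I_{\alpha}^{+}]$ is compact from $L^{p}(\mathbb{R})$ to $L^{q}(\mathbb{R})$.
   Context: $I_{\alpha}^{+}f(x)=\int_{x}^{\infty}\frac{f(y)}{(y-x)^{1-\alpha}}dy$ is the one-sided fractional integral. $[b,I_{\alpha}^{+}]f=bI_{\alpha}^{+}f-I_{\alpha}^{+}(bf)$. $CMO(\mathbb{R})$ is the closure of $C_{c}^{\infty}(\mathbb{R})$ in the $BMO$ norm. An operator is compact if the image of the unit ball is relatively compact. *)

theory Defs
  imports "HOL-Analysis.Analysis"
begin

definition in_Lp :: "real \<Rightarrow> (real \<Rightarrow> real) \<Rightarrow> bool" where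
  "in_Lp p f \<longleftrightarrow> f \<in> borel_measurable lborel \<and> integrable lborel (\<lambda>x. \<bar>f x\<bar> powr p)"

definition Lp_norm :: "real \<Rightarrow> (real \<Rightarrow> real) \<Rightarrow> real" where
  "Lp_norm p f = (\<integral>x. \<bar>f x\<bar> powr p \<partial>lborel) powr (1 / p)"

definition avg :: "(real \<Rightarrow> real) \<Rightarrow> real \<Rightarrow> real \<Rightarrow> real" where
  "avg f a b = (1 / (b - a)) * (LINT x:{a..b}|lborel. f x)"

definition mean_osc :: "(real \<Rightarrow> real) \<Rightarrow> real \<Rightarrow> real \<Rightarrow> real" where
  "mean_osc f a b = (1 / (b - a)) * (LINT x:{a..b}|lborel. \<bar>f x - avg f a b\<bar>)"

definition in_BMO :: "(real \<Rightarrow> real) \<Rightarrow> bool" where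
  "in_BMO f \<longleftrightarrow> f \<in> borel_measurable lborel \<and>
     (\<forall>a b. set_integrable lborel {a..b} f) \<and>
     bdd_above {mean_osc f a b | a b. a < b}"

definition BMO_norm :: "(real \<Rightarrow> real) \<Rightarrow> real" where
  "BMO_norm f = Sup {mean_osc f a b | a b. a < b}"

definition smooth_cc :: "(real \<Rightarrow> real) \<Rightarrow> bool" where
  "smooth_cc \<phi> \<longleftrightarrow> (\<forall>n x. (deriv ^^ n) \<phi> differentiable (at x))
     \<and> compact (closure {x. \<phi> x \<noteq> 0})"

definition in_CMO :: "(real \<Rightarrow> real) \<Rightarrow> bool" where
  "in_CMO b \<longleftrightarrow> in_BMO b \<and>
     (\<forall>\<epsilon>>0. \<exists>\<phi>. smooth_cc \<phi> \<and> BMO_norm (\<lambda>x. b x - \<phi> x) < \<epsilon>)"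

definition frac_int_plus :: "real \<Rightarrow> (real \<Rightarrow> real) \<Rightarrow> real \<Rightarrow> real" where
  "frac_int_plus \<alpha> f x = (LINT y:{x<..}|lborel. f y / (y - x) powr (1 - \<alpha>))"

definition commutator :: "(real \<Rightarrow> real) \<Rightarrow> real \<Rightarrow> (real \<Rightarrow> real) \<Rightarrow> real \<Rightarrow> real" where
  "commutator b \<alpha> f x = b x * frac_int_plus \<alpha> f x - frac_int_plus \<alpha> (\<lambda>y. b y * f y) x"

text \<open>T is a compact operator from L^p to L^q: it maps L^p into L^q and the image of the
  unit ball is relatively (equivalently, sequentially) compact in L^q.\<close>
definition compact_op :: "real \<Rightarrow> real \<Rightarrow> ((real \<Rightarrow> real) \<Rightarrow> real \<Rightarrow> real) \<Rightarrow> bool" where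
  "compact_op p q T \<longleftrightarrow> (\<forall>f. in_Lp p f \<longrightarrow> in_Lp q (T f)) \<and>
     (\<forall>F :: nat \<Rightarrow> real \<Rightarrow> real. (\<forall>n. in_Lp p (F n) \<and> Lp_norm p (F n) \<le> 1) \<longrightarrow>
        (\<exists>r g. strict_mono r \<and> in_Lp q g \<and>
           (\<lambda>n. Lp_norm q (\<lambda>x. T (F (r n)) x - g x)) \<longlonglongrightarrow> 0))"

end

theory Submission
  imports Defs "HOL-Complex_Analysis.Great_Picard" "HOL-Library.Diagonal_Subsequence"
begin

text \<open>
  Boundedness. The commutator is dominated by the positive operator with kernel
  \<open>\<bar>b x - b y\<bar> * \<bar>x - y\<bar> powr (\<alpha> - 1)\<close>. Using two adjacent dyadic grids, \<open>\<bar>x - y\<bar> powr (\<alpha> - 1)\<close> is at most a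
  constant times the sum of \<open>side Q powr (\<alpha> - 1)\<close> over the cells \<open>Q\<close> that contain both points, and on each cell
  \<open>\<bar>b x - b y\<bar> \<le> \<bar>b x - b\<^sub>Q\<bar> + \<bar>b y - b\<^sub>Q\<bar>\<close>. Tested against \<open>g\<close> in the dual space, the two resulting forms
  are adjoint to each other, so both are controlled by the John--Nirenberg inequality, Hedberg's pointwise
  estimate and the dyadic maximal inequality; this gives an operator norm of order \<open>BMO_norm b\<close>.

  Compactness. Hence \<open>b\<close> may be replaced by a smooth compactly supported \<open>\<phi>\<close>. The kernel
  \<open>(\<phi> x - \<phi> y) / (y - x) powr (1 - \<alpha>)\<close>, extended by zero to \<open>y \<le> x\<close>, is then continuous, even on the diagonal.
  Restricted to a square it sends bounded sequences to equicontinuous ones, so Arzela--Ascoli applies, and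
  the part outside a large square has small norm.
\<close>

section \<open>Adjacent dyadic grids\<close>

text \<open>A single dyadic grid cannot dominate the kernel: arbitrarily close points on the two
  sides of 0 share no cell of the unshifted grid at any scale. A second obstacle is the factor
  \<open>\<bar>b x - b\<^sub>Q\<bar>\<close>, which sits in the output variable and changes with the
  cell. After pairing with g, Fubini moves it into an inner integral too; there Hoelder's inequality
  on one cell trades it for a constant and turns a mean into an L^u mean. The exponent u must exceed
  1 and stay below both p and q' = q / (q - 1), so that the maximal inequality applies to f^u in
  L^(p/u) and to g^u in L^(q'/u). For the adjoint form 1/q = 1/p - \<alpha> reads 1/p' = 1/q' -
  \<alpha>. Maximal functions and sums over scales are kept finite, with bounds independent of the
  number of scales, and limits are taken only at the end. A non-integrable function has Bochner
  integral 0, so the two integrals in the commutator may be merged only where both converge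
  absolutely; finiteness for the weights 1 and \<open>\<bar>b x - b y\<bar>\<close> gives this
  almost everywhere.\<close>

definition side :: "int \<Rightarrow> real" where
  "side k = 2 powr real_of_int k"

text \<open>The second grid is shifted by a third of the side length. The sign alternates with the
  parity of \<open>k\<close> so that consecutive offsets differ by an integer multiple of the finer
  side; the shifted cells are therefore nested as well.\<close>

definition offset :: "bool \<Rightarrow> int \<Rightarrow> real" where
  "offset s k = (if s then (if even k then side k / 3 else - side k / 3) else 0)"

definition cell_index :: "bool \<Rightarrow> int \<Rightarrow> real \<Rightarrow> int" where
  "cell_index s k x = \<lfloor>(x - offset s k) / side k\<rfloor>"

definition cell :: "bool \<Rightarrow> int \<Rightarrow> int \<Rightarrow> real set" where
  "cell s k m = {offset s k + side k * m ..< offset s k + side k * (m + 1)}"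

lemma side_pos [simp]: "0 < side k" "0 \<le> side k" "side k \<noteq> 0"
  by (auto simp: side_def)

lemma side_Suc: "side (k + 1) = 2 * side k"
  by (simp add: side_def powr_add)

lemma mem_cell_iff: "x \<in> cell s k m \<longleftrightarrow> cell_index s k x = m"
proof -
  have "cell_index s k x = m \<longleftrightarrow> m \<le> (x - offset s k) / side k \<and> (x - offset s k) / side k < m + 1"
    unfolding cell_index_def by (simp add: floor_eq_iff)
  also have "\<dots> \<longleftrightarrow> x \<in> cell s k m"
    using side_pos[of k] by (simp add: cell_def field_simps)
  finally show ?thesis by simp
qed

lemma cell_sets [measurable]: "cell s k m \<in> sets borel"
  by (simp add: cell_def)

lemma cell_index_measurable [measurable]:
  "cell_index s k \<in> measurable borel (count_space UNIV)"
  unfolding cell_index_def by measurable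

lemma emeasure_cell [simp]: "emeasure lborel (cell s k m) = ennreal (side k)"
  by (simp add: cell_def algebra_simps)

lemma measure_cell [simp]: "measure lborel (cell s k m) = side k"
  by (simp add: measure_def)

lemma cell_halves:
  obtains m' where "cell s (k + 1) m = cell s k m' \<union> cell s k (m' + 1)"
    and "cell s k m' \<inter> cell s k (m' + 1) = {}"
proof -
  \<comment> \<open>The change of offset in units of h = \<open>side k\<close>: from h/3 to -2h/3
    for even \<open>k\<close>, from -h/3 to 2h/3 for odd \<open>k\<close>. It determines the index
    \<open>2 * m + d\<close> of the left half.\<close>
  define d :: int where "d = (if s then (if even k then -1 else 1) else 0)"
  have o: "offset s (k+1) = offset s k + side k * d"
    by (auto simp: offset_def d_def side_Suc)
  show ?thesis
  proof (rule that[of "2 * m + d"])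
    have 1: "offset s k + side k * real_of_int (2 * m + d) = offset s (k+1) + side (k+1) * real_of_int m"
      unfolding o side_Suc by (simp add: algebra_simps)
    have 2: "offset s k + side k * real_of_int (2 * m + d + 1 + 1) = offset s (k+1) + side (k+1) * real_of_int (m+1)"
      unfolding o side_Suc by (simp add: algebra_simps)
    have le: "offset s k + side k * real_of_int (2 * m + d) \<le> offset s k + side k * real_of_int (2 * m + d + 1)"
      "offset s k + side k * real_of_int (2 * m + d+1) \<le> offset s k + side k * real_of_int (2 * m + d + 1+1)"
      by auto
    show "cell s (k + 1) m = cell s k (2 * m + d) \<union> cell s k (2 * m + d + 1)"
      unfolding cell_def using ivl_disj_un_two(3)[OF le] unfolding 1 2 by simp
    show "cell s k (2 * m + d) \<inter> cell s k (2 * m + d + 1) = {}"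
      by (auto simp: cell_def)
  qed
qed

text \<open>If both grids separated the points, an endpoint of each would lie between them.
  Endpoints of the two grids differ by \<open>side k / 3\<close> times an integer congruent to 1 or
  -1 modulo 3, hence by at least \<open>side k / 3\<close>.\<close>

lemma common_cell:
  assumes "\<bar>x - y\<bar> < side k / 3"
  shows "\<exists>s. cell_index s k x = cell_index s k y"
proof -
  have *: "\<exists>s. cell_index s k x = cell_index s k y" if "x \<le> y" "y - x < side k / 3" for x y :: real
  proof (rule ccontr)
    assume neg: "\<not> ?thesis"
    have N: "cell_index s k x \<noteq> cell_index s k y" for s using neg by auto
    have "\<exists>m::int. x < offset s k + side k * m \<and> offset s k + side k * m \<le> y" for s
    proof -
      have "cell_index s k x \<le> cell_index s k y"
        unfolding cell_index_def using that by (intro floor_mono divide_right_mono) auto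
      with N[of s] have "cell_index s k x < cell_index s k y" by simp
      then have "(x - offset s k) / side k < cell_index s k y"
        unfolding cell_index_def by linarith
      moreover have "cell_index s k y \<le> (y - offset s k) / side k"
        unfolding cell_index_def by simp
      ultimately show ?thesis
        by (intro exI[of _ "cell_index s k y"]) (auto simp: field_simps)
    qed
    from this[of False] this[of True] obtain m n :: int where
      mn: "x < side k * m" "side k * m \<le> y" "x < offset True k + side k * n"
      "offset True k + side k * n \<le> y" by (auto simp: offset_def)
    then have "\<bar>offset True k + side k * n - side k * m\<bar> < side k / 3"
      using that mn by linarith
    moreover define e :: int where "e = (if even k then 1 else -1)"
    have "offset True k + side k * n - side k * m = side k / 3 * real_of_int (3 * (n - m) + e)"
      by (simp add: offset_def e_def field_simps)
    ultimately have "side k / 3 * \<bar>real_of_int (3 * (n - m) + e)\<bar> < side k / 3 * 1"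
      by (simp add: abs_mult)
    then have "\<bar>real_of_int (3 * (n - m) + e)\<bar> < 1"
      by (subst (asm) mult_less_cancel_left_pos) auto
    then have "3 * (n - m) + e = 0" by linarith
    then show False unfolding e_def by presburger
  qed
  show ?thesis
  proof (cases "x \<le> y")
    case True then show ?thesis using *[of x y] assms by auto
  next
    case False then show ?thesis using *[of y x] assms by (metis abs_minus_commute abs_of_pos diff_gt_0_iff_gt linear not_le)
  qed
qed

lemma nn_integral_cells:
  assumes [measurable]: "h \<in> borel_measurable borel"
  shows "(\<integral>\<^sup>+x. h x \<partial>lborel) = (\<integral>\<^sup>+m. (\<integral>\<^sup>+x\<in>cell s k m. h x \<partial>lborel) \<partial>count_space UNIV)"
proof -
  have "(\<integral>\<^sup>+m. (\<integral>\<^sup>+x\<in>cell s k m. h x \<partial>lborel) \<partial>count_space UNIV)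
      = (\<integral>\<^sup>+x. (\<integral>\<^sup>+m. h x * indicator (cell s k m) x \<partial>count_space UNIV) \<partial>lborel)"
    by (subst nn_integral_count_space_nn_integral) auto
  also have "\<dots> = (\<integral>\<^sup>+x. h x \<partial>lborel)"
  proof (intro nn_integral_cong)
    fix x
    have "(\<integral>\<^sup>+m. h x * indicator (cell s k m) x \<partial>count_space UNIV)
       = (\<integral>\<^sup>+m. h x * indicator {cell_index s k x} m \<partial>count_space UNIV)"
      by (intro nn_integral_cong) (auto simp: indicator_def mem_cell_iff)
    also have "\<dots> = h x" by (simp add: nn_integral_cmult_indicator)
    finally show "(\<integral>\<^sup>+m. h x * indicator (cell s k m) x \<partial>count_space UNIV) = h x" .
  qed
  finally show ?thesis by simp
qed

section \<open>The dyadic maximal function\<close>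

definition loc_integrable :: "(real \<Rightarrow> real) \<Rightarrow> bool" where
  "loc_integrable f \<longleftrightarrow> f \<in> borel_measurable borel \<and> (\<forall>a b. set_integrable lborel {a..b} f)"

abbreviation cell_int :: "bool \<Rightarrow> int \<Rightarrow> int \<Rightarrow> (real \<Rightarrow> real) \<Rightarrow> real" where
  "cell_int s k m f \<equiv> LINT x:cell s k m|lborel. f x"

definition cell_avg :: "bool \<Rightarrow> int \<Rightarrow> (real \<Rightarrow> real) \<Rightarrow> int \<Rightarrow> real" where
  "cell_avg s k f m = (cell_int s k m f) / side k"

definition dyadic_avg :: "bool \<Rightarrow> int \<Rightarrow> (real \<Rightarrow> real) \<Rightarrow> real \<Rightarrow> real" where
  "dyadic_avg s k f x = cell_avg s k f (cell_index s k x)"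

lemma dyadic_avg_measurable [measurable]: "dyadic_avg s k f \<in> borel_measurable borel"
  unfolding dyadic_avg_def by measurable

lemma cell_set_integrable:
  assumes "loc_integrable f" shows "set_integrable lborel (cell s k m) f"
proof (rule set_integrable_subset)
  show "set_integrable lborel {offset s k + side k * m .. offset s k + side k * (m + 1)} f"
    using assms by (auto simp: loc_integrable_def)
qed (auto simp: cell_def)

lemma cell_set_integrable_const: "set_integrable lborel (cell s k m) (\<lambda>_. c :: real)"
  by (simp add: set_integrable_def)

lemma set_integral_cell_const: "cell_int s k m (\<lambda>x. c) = c * side k"
  by (simp add: set_lebesgue_integral_def)

lemma cell_avg_nonneg:
  assumes "\<And>x. 0 \<le> f x" shows "0 \<le> cell_avg s k f m"
  unfolding cell_avg_def set_lebesgue_integral_def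
  using assms by (intro divide_nonneg_nonneg integral_nonneg) auto

lemma integral_cell_halves:
  assumes "loc_integrable f" "cell s (k + 1) m = cell s k m' \<union> cell s k (m' + 1)"
    and "cell s k m' \<inter> cell s k (m' + 1) = {}"
  shows "cell_int s (k + 1) m f =
    (cell_int s k m' f) + (cell_int s k (m' + 1) f)"
  unfolding assms(2) using assms by (intro set_integral_Un cell_set_integrable)

text \<open>Convexity: the graph of s^t lies above its tangent at \<open>m\<close>. The point of
  tangency stays free: at the mean it gives Jensen's inequality, at a running maximum it drives the
  maximal inequality.\<close>

lemma Youngs_inequality_powr:
  fixes t :: real
  assumes "1 < t" "0 \<le> m" "0 \<le> s"
  shows "t * m powr (t - 1) * s \<le> (t - 1) * m powr t + s powr t"
proof -
  have "m powr (t - 1) * s \<le> (m powr (t - 1)) powr (t / (t - 1)) / (t / (t - 1)) + s powr t / t"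
    using assms by (intro Youngs_inequality) (auto simp: field_simps)
  also have "(m powr (t - 1)) powr (t / (t - 1)) = m powr t"
    using assms by (simp add: powr_powr)
  finally show ?thesis using assms by (simp add: field_simps)
qed

lemma cell_Jensen:
  assumes t: "1 < t" and F: "loc_integrable F" "\<And>x. 0 \<le> F x" "loc_integrable (\<lambda>x. F x powr t)"
  shows "cell_avg s k F m powr t \<le> cell_avg s k (\<lambda>x. F x powr t) m"
proof -
  define c where "c = cell_avg s k F m"
  have c0: "0 \<le> c" unfolding c_def using F by (intro cell_avg_nonneg)
  have I: "cell_int s k m F = c * side k" by (simp add: c_def cell_avg_def)
  have "(cell_int s k m (\<lambda>x. t * c powr (t - 1) * F x))
     \<le> (cell_int s k m (\<lambda>x. (t - 1) * c powr t + F x powr t))"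
    using F c0 t by (intro set_integral_mono set_integrable_mult_right set_integral_add
       Youngs_inequality_powr cell_set_integrable cell_set_integrable_const) auto
  also have "\<dots> = (t - 1) * c powr t * side k + (cell_int s k m (\<lambda>x. F x powr t))"
    by (subst set_integral_add)
      (auto intro: cell_set_integrable[OF F(3)] cell_set_integrable_const simp: set_integral_cell_const)
  also have "cell_int s k m (\<lambda>x. t * c powr (t - 1) * F x) = t * c powr (t - 1) * (c * side k)"
    by (simp add: I)
  also have "\<dots> = t * c powr t * side k"
    using c0 by (cases "c = 0") (simp_all add: powr_diff)
  finally have "c powr t * side k \<le> (cell_int s k m (\<lambda>x. F x powr t))"
    by (simp add: algebra_simps)
  then show ?thesis by (simp add: c_def[symmetric] cell_avg_def[of _ _ "\<lambda>x. F x powr t"] field_simps)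
qed

text \<open>Doob's maximal function over the n + 1 scales from k - n to k. Recursion from the
  coarsest scale downwards matches an induction that passes from a cell to its halves.\<close>

fun dyadic_max :: "bool \<Rightarrow> (real \<Rightarrow> real) \<Rightarrow> nat \<Rightarrow> int \<Rightarrow> real \<Rightarrow> real" where
  "dyadic_max s F 0 k x = dyadic_avg s k F x"
| "dyadic_max s F (Suc n) k x = max (dyadic_avg s k F x) (dyadic_max s F n (k - 1) x)"

lemma dyadic_max_measurable [measurable]: "dyadic_max s F n k \<in> borel_measurable borel"
  by (induction n arbitrary: k) (auto simp: fun_eq_iff cong: measurable_cong)

lemma dyadic_avg_le_max:
  assumes "k - int n \<le> j" "j \<le> k"
  shows "dyadic_avg s j F x \<le> dyadic_max s F n k x"
  using assms
proof (induction n arbitrary: k)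
  case (Suc n)
  then show ?case by (cases "j = k") (auto simp: le_max_iff_disj)
qed auto

text \<open>A Bellman-function proof of Doob's inequality that carries the running maximum \<nu> as
  a parameter. \<open>R\<close> dominates \<nu>^t times the length of the cell, is additive over the
  two halves for fixed \<nu>, and does not grow when \<nu> is raised to a larger cell average a,
  because (t - 1) \<nu>^t - t \<nu>^(t - 1) a is least at \<nu> = a.\<close>

lemma dyadic_max_cell_bound:
  fixes s :: bool
  assumes t: "1 < t" and F: "loc_integrable F" "\<And>x. 0 \<le> F x" "loc_integrable (\<lambda>x. F x powr t)"
    and "0 \<le> \<mu>"
  defines "R \<equiv> (\<lambda>k m \<nu>. 2 powr t / (t - 1) * (cell_int s k m (\<lambda>x. F x powr t))
     + 2 / (t - 1) * ((t - 1) * \<nu> powr t * side k - t * \<nu> powr (t - 1) * (cell_int s k m F)))"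
  shows "(\<integral>\<^sup>+x\<in>cell s k m. ennreal (max \<mu> (dyadic_max s F n k x) powr t) \<partial>lborel)
     \<le> ennreal (R k m (max \<mu> (cell_avg s k F m)))"
proof -
  have *: "\<nu> powr t * side k \<le> R k m \<nu>" if "0 \<le> \<nu>" for \<nu> k m
  proof -
    let ?a = "cell_avg s k F m"
    have a0: "0 \<le> ?a" using F by (intro cell_avg_nonneg)
    \<comment> \<open>Taking twice the mean uses up only one of the two copies of (t - 1) \<nu>^t in
      \<open>R\<close>; the other copy remains as the lower bound.\<close>
    have "t * \<nu> powr (t - 1) * (2 * ?a) \<le> (t - 1) * \<nu> powr t + (2 * ?a) powr t"
      using t that a0 by (intro Youngs_inequality_powr) auto
    also have "(2 * ?a) powr t \<le> 2 powr t * cell_avg s k (\<lambda>x. F x powr t) m"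
      using cell_Jensen[OF t F] a0 by (simp add: powr_mult)
    finally have "side k * (t * \<nu> powr (t - 1) * (2 * ?a)) \<le> side k * ((t - 1) * \<nu> powr t
        + 2 powr t * cell_avg s k (\<lambda>x. F x powr t) m)"
      by (intro mult_left_mono) auto
    also have "\<dots> = (t - 1) * \<nu> powr t * side k + 2 powr t * (cell_int s k m (\<lambda>x. F x powr t))"
      by (simp add: cell_avg_def algebra_simps)
    also have "side k * (t * \<nu> powr (t - 1) * (2 * ?a))
         = 2 * (t * \<nu> powr (t - 1) * (cell_int s k m F))"
      by (simp add: cell_avg_def)
    finally have "\<nu> powr t * side k * (t - 1) \<le> 2 powr t * (cell_int s k m (\<lambda>x. F x powr t))
        + 2 * ((t - 1) * \<nu> powr t * side k - t * \<nu> powr (t - 1) * (cell_int s k m F))"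
      by (simp add: algebra_simps)
    moreover have "R k m \<nu> = (2 powr t * (cell_int s k m (\<lambda>x. F x powr t))
        + 2 * ((t - 1) * \<nu> powr t * side k - t * \<nu> powr (t - 1) * (cell_int s k m F))) / (t - 1)"
      unfolding R_def by (simp add: add_divide_distrib)
    ultimately show ?thesis using t by (simp add: pos_le_divide_eq)
  qed
  show ?thesis
    using \<open>0 \<le> \<mu>\<close>
  proof (induction n arbitrary: k m \<mu>)
    case base: 0
    let ?\<nu> = "max \<mu> (cell_avg s k F m)"
    have "(\<integral>\<^sup>+x\<in>cell s k m. ennreal (max \<mu> (dyadic_max s F 0 k x) powr t) \<partial>lborel)
       = (\<integral>\<^sup>+x\<in>cell s k m. ennreal (?\<nu> powr t) \<partial>lborel)"
      by (intro nn_integral_cong) (auto simp: indicator_def dyadic_avg_def mem_cell_iff)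
    also have "\<dots> = ennreal (?\<nu> powr t * side k)"
      by (simp add: nn_integral_cmult_indicator ennreal_mult)
    also have "\<dots> \<le> ennreal (R k m ?\<nu>)"
      using base by (intro ennreal_leI *) auto
    finally show ?case .
  next
    case (Suc n)
    obtain m' where m': "cell s (k - 1 + 1) m = cell s (k - 1) m' \<union> cell s (k - 1) (m' + 1)"
      "cell s (k - 1) m' \<inter> cell s (k - 1) (m' + 1) = {}" using cell_halves by blast
    then have un: "cell s k m = cell s (k - 1) m' \<union> cell s (k - 1) (m' + 1)" by simp
    have sk: "side k = side (k - 1) + side (k - 1)" using side_Suc[of "k - 1"] by simp
    let ?\<nu> = "max \<mu> (cell_avg s k F m)"
    have \<nu>0: "0 \<le> ?\<nu>" using Suc by auto
    have mono: "R (k - 1) i (max ?\<nu> (cell_avg s (k - 1) F i)) \<le> R (k - 1) i ?\<nu>" for i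
    proof (cases "cell_avg s (k - 1) F i \<le> ?\<nu>")
      case False
      let ?a = "cell_avg s (k - 1) F i"
      have a: "?\<nu> \<le> ?a" "0 \<le> ?a" using False \<nu>0 by auto
      have "t * ?\<nu> powr (t - 1) * ?a \<le> (t - 1) * ?\<nu> powr t + ?a powr t"
        using t \<nu>0 a by (intro Youngs_inequality_powr) auto
      moreover have "?a powr (t - 1) * ?a = ?a powr t"
        using a by (cases "?a = 0") (simp_all add: powr_diff)
      ultimately have "(t - 1) * ?a powr t - t * (?a powr (t - 1) * ?a)
         \<le> (t - 1) * ?\<nu> powr t - t * ?\<nu> powr (t - 1) * ?a"
        by (simp add: algebra_simps)
      then have "side (k - 1) * ((t - 1) * ?a powr t - t * (?a powr (t - 1) * ?a))
         \<le> side (k - 1) * ((t - 1) * ?\<nu> powr t - t * ?\<nu> powr (t - 1) * ?a)"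
        by (intro mult_left_mono) auto
      then have "2 / (t - 1) * (side (k - 1) * ((t - 1) * ?a powr t - t * (?a powr (t - 1) * ?a)))
         \<le> 2 / (t - 1) * (side (k - 1) * ((t - 1) * ?\<nu> powr t - t * ?\<nu> powr (t - 1) * ?a))"
        using t by (intro mult_left_mono) auto
      moreover have "cell_int s (k - 1) i F = side (k - 1) * ?a"
        by (simp add: cell_avg_def)
      ultimately show ?thesis unfolding R_def max_absorb2[OF a(1)]
        by (simp add: algebra_simps)
    qed (simp add: max_absorb1)
    have nonneg: "0 \<le> R (k - 1) i ?\<nu>" for i
      using *[OF \<nu>0, of "k - 1" i] by (rule order.trans[rotated]) simp
    have "(\<integral>\<^sup>+x\<in>cell s k m. ennreal (max \<mu> (dyadic_max s F (Suc n) k x) powr t) \<partial>lborel)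
       = (\<integral>\<^sup>+x\<in>cell s k m. ennreal (max ?\<nu> (dyadic_max s F n (k - 1) x) powr t) \<partial>lborel)"
      by (intro nn_integral_cong) (auto simp: indicator_def dyadic_avg_def mem_cell_iff max.assoc)
    also have "\<dots> = (\<integral>\<^sup>+x\<in>cell s (k - 1) m'. ennreal (max ?\<nu> (dyadic_max s F n (k - 1) x) powr t) \<partial>lborel)
       + (\<integral>\<^sup>+x\<in>cell s (k - 1) (m' + 1). ennreal (max ?\<nu> (dyadic_max s F n (k - 1) x) powr t) \<partial>lborel)"
      unfolding un using m'(2) by (intro nn_integral_disjoint_pair) auto
    also have "\<dots> \<le> ennreal (R (k - 1) m' ?\<nu>) + ennreal (R (k - 1) (m' + 1) ?\<nu>)"
      by (intro add_mono order.trans[OF Suc.IH ennreal_leI] mono \<nu>0)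
    also have "\<dots> = ennreal (R (k - 1) m' ?\<nu> + R (k - 1) (m' + 1) ?\<nu>)"
      using nonneg by simp
    also have "R (k - 1) m' ?\<nu> + R (k - 1) (m' + 1) ?\<nu> = R k m ?\<nu>"
      using integral_cell_halves[OF F(1) m'] integral_cell_halves[OF F(3) m'] unfolding R_def sk
      by (simp add: algebra_simps)
    finally show ?case .
  qed
qed

lemma loc_integrable_if_powr_integrable:
  assumes "1 \<le> t" and [measurable]: "F \<in> borel_measurable borel" and "\<And>x. 0 \<le> F x"
    and "integrable lborel (\<lambda>x. F x powr t)"
  shows "loc_integrable F" "loc_integrable (\<lambda>x. F x powr t)"
proof -
  have tint: "set_integrable lborel {a..b} (\<lambda>x. F x powr t)" for a b
    unfolding set_integrable_def using assms(4) by (intro integrable_mult_indicator) auto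
  then show "loc_integrable (\<lambda>x. F x powr t)"
    by (auto simp: loc_integrable_def)
  have *: "F x \<le> 1 + F x powr t" for x
  proof (cases "F x \<le> 1")
    case False
    then have "F x powr 1 \<le> F x powr t" using assms by (intro powr_mono) auto
    then show ?thesis using False by auto
  qed (use powr_ge_zero[of "F x" t] in linarith)
  have "set_integrable lborel {a..b} F" for a b
  proof (rule set_integrable_bound)
    show "set_integrable lborel {a..b} (\<lambda>x. 1 + F x powr t)"
      by (intro set_integral_add tint) (auto simp: set_integrable_def emeasure_lborel_Icc_eq)
    show "AE x in lborel. x \<in> {a..b} \<longrightarrow> norm (F x) \<le> norm (1 + F x powr t)"
      using * assms(3) by (auto intro: order.trans)
  qed (auto simp: set_borel_measurable_def)
  then show "loc_integrable F" by (simp add: loc_integrable_def)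
qed

lemma nn_set_integral_eq_ennreal:
  assumes "set_integrable M A f" "\<And>x. 0 \<le> f x"
  shows "(\<integral>\<^sup>+x\<in>A. ennreal (f x) \<partial>M) = ennreal (LINT x:A|M. f x)"
proof -
  have "(\<integral>\<^sup>+x\<in>A. ennreal (f x) \<partial>M) = (\<integral>\<^sup>+x. ennreal (indicator A x *\<^sub>R f x) \<partial>M)"
    by (intro nn_integral_cong) (auto simp: indicator_def)
  also have "\<dots> = ennreal (LINT x:A|M. f x)"
    unfolding set_lebesgue_integral_def
    using assms by (intro nn_integral_eq_integral) (auto simp: set_integrable_def)
  finally show ?thesis .
qed

lemma dyadic_max_nonneg:
  assumes "\<And>x. 0 \<le> F x" shows "0 \<le> dyadic_max s F n k x"
  using assms cell_avg_nonneg[OF assms] by (induction n arbitrary: k) (auto simp: dyadic_avg_def le_max_iff_disj)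

lemma dyadic_max_bound:
  assumes t: "1 < t" and [measurable]: "F \<in> borel_measurable borel" and F0: "\<And>x. 0 \<le> F x"
    and int: "integrable lborel (\<lambda>x. F x powr t)"
  shows "(\<integral>\<^sup>+x. ennreal (dyadic_max s F n k x powr t) \<partial>lborel)
     \<le> ennreal (2 powr t / (t - 1) * (LINT x|lborel. F x powr t))"
proof -
  note F = loc_integrable_if_powr_integrable[OF less_imp_le[OF t] assms(2,3,4)]
  let ?A = "2 powr t / (t - 1)"
  have A: "0 \<le> ?A" using t by simp
  have cell: "(\<integral>\<^sup>+x\<in>cell s k m. ennreal (dyadic_max s F n k x powr t) \<partial>lborel)
      \<le> ennreal ?A * (\<integral>\<^sup>+x\<in>cell s k m. ennreal (F x powr t) \<partial>lborel)" for m
  proof -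
    let ?a = "cell_avg s k F m"
    have a: "0 \<le> ?a" using F0 by (rule cell_avg_nonneg)
    have I: "cell_int s k m F = ?a * side k" by (simp add: cell_avg_def)
    have aa: "?a powr (t - 1) * (?a * side k) = ?a powr t * side k"
      using a by (cases "?a = 0") (simp_all add: powr_diff)
    have eq: "(t - 1) * ?a powr t * side k - t * ?a powr (t - 1) * (?a * side k) = - (?a powr t * side k)"
      unfolding mult.assoc aa by (simp add: algebra_simps)
    have "(\<integral>\<^sup>+x\<in>cell s k m. ennreal (dyadic_max s F n k x powr t) \<partial>lborel)
       = (\<integral>\<^sup>+x\<in>cell s k m. ennreal (max 0 (dyadic_max s F n k x) powr t) \<partial>lborel)"
      using dyadic_max_nonneg[OF F0] by (intro nn_integral_cong) (simp add: max_absorb2)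
    also have "\<dots> \<le> ennreal (?A * (cell_int s k m (\<lambda>x. F x powr t))
     + 2 / (t - 1) * ((t - 1) * ?a powr t * side k - t * ?a powr (t - 1) * (cell_int s k m F)))"
      using dyadic_max_cell_bound[OF t F(1) F0 F(2), where \<mu> = 0 and k = k and m = m and s = s and n = n]
      unfolding max_absorb2[OF a] by simp
    also have "\<dots> \<le> ennreal (?A * (cell_int s k m (\<lambda>x. F x powr t)))"
      unfolding I eq using t by (intro ennreal_leI) auto
    also have "\<dots> = ennreal ?A * (\<integral>\<^sup>+x\<in>cell s k m. ennreal (F x powr t) \<partial>lborel)"
      unfolding nn_set_integral_eq_ennreal[OF cell_set_integrable[OF F(2)] powr_ge_zero]
      by (intro ennreal_mult A) (auto simp: set_lebesgue_integral_def)
    finally show ?thesis .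
  qed
  have "(\<integral>\<^sup>+x. ennreal (dyadic_max s F n k x powr t) \<partial>lborel)
    \<le> (\<integral>\<^sup>+m. ennreal ?A * (\<integral>\<^sup>+x\<in>cell s k m. ennreal (F x powr t) \<partial>lborel) \<partial>count_space UNIV)"
    by (subst nn_integral_cells[of _ s k]) (auto intro!: nn_integral_mono cell)
  also have "\<dots> = ennreal ?A * (\<integral>\<^sup>+x. ennreal (F x powr t) \<partial>lborel)"
    by (subst nn_integral_cells[of _ s k], simp) (simp add: nn_integral_cmult)
  also have "\<dots> = ennreal (?A * (LINT x|lborel. F x powr t))"
  proof -
    have "(\<integral>\<^sup>+x. ennreal (F x powr t) \<partial>lborel) = ennreal (LINT x|lborel. F x powr t)"
      by (intro nn_integral_eq_integral int) auto
    then show ?thesis using ennreal_mult[OF A, of "LINT x|lborel. F x powr t"] by auto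
  qed
  finally show ?thesis .
qed

section \<open>The John--Nirenberg inequality\<close>

lemma powr_add_le:
  fixes x y r :: real
  assumes "0 \<le> x" "0 \<le> y" "0 \<le> r"
  shows "(x + y) powr r \<le> 2 powr r * (x powr r + y powr r)"
proof -
  have "(x + y) powr r \<le> (2 * max x y) powr r"
    using assms by (intro powr_mono2) auto
  also have "\<dots> = 2 powr r * max x y powr r" using assms by (simp add: powr_mult)
  also have "\<dots> \<le> 2 powr r * (x powr r + y powr r)"
    using assms by (intro mult_left_mono) (auto simp: max_def)
  finally show ?thesis .
qed

text \<open>Young's inequality for u / X and v / Y, multiplied by X Y; \<open>c\<close> and
  \<open>d\<close> are the resulting coefficients. Upper bounds stand in for the norms, so the norms
  never have to be formed as real numbers.\<close>

lemma Holder_bound: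
  assumes "1 < r" "1 < s" "1 / r + 1 / s = 1"
    and [measurable]: "u \<in> borel_measurable M" "v \<in> borel_measurable M"
    and uv: "\<And>x. 0 \<le> u x" "\<And>x. 0 \<le> v x" and XY: "0 < X" "0 < Y"
    and u: "(\<integral>\<^sup>+x. ennreal (u x powr r) \<partial>M) \<le> ennreal (X powr r)"
    and v: "(\<integral>\<^sup>+x. ennreal (v x powr s) \<partial>M) \<le> ennreal (Y powr s)"
  shows "(\<integral>\<^sup>+x. ennreal (u x * v x) \<partial>M) \<le> ennreal (X * Y)"
proof -
  define c d where "c = X * Y / (r * X powr r)" and "d = X * Y / (s * Y powr s)"
  have cd: "0 \<le> c" "0 \<le> d" using assms by (auto simp: c_def d_def)
  have *: "u x * v x \<le> c * u x powr r + d * v x powr s" for x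
  proof -
    have "(u x / X) * (v x / Y) \<le> (u x / X) powr r / r + (v x / Y) powr s / s"
      using assms by (intro Youngs_inequality) auto
    then have "X * Y * ((u x / X) * (v x / Y)) \<le> X * Y * ((u x / X) powr r / r + (v x / Y) powr s / s)"
      using XY by (intro mult_left_mono) auto
    then show ?thesis using XY uv by (simp add: c_def d_def powr_divide field_simps)
  qed
  have "(\<integral>\<^sup>+x. ennreal (u x * v x) \<partial>M)
      \<le> (\<integral>\<^sup>+x. ennreal c * ennreal (u x powr r) + ennreal d * ennreal (v x powr s) \<partial>M)"
    using * cd by (intro nn_integral_mono)
      (simp add: ennreal_mult[symmetric] ennreal_plus[symmetric] ennreal_leI del: ennreal_plus)
  also have "\<dots> = ennreal c * (\<integral>\<^sup>+x. ennreal (u x powr r) \<partial>M) + ennreal d * (\<integral>\<^sup>+x. ennreal (v x powr s) \<partial>M)"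
    by (simp add: nn_integral_add nn_integral_cmult)
  also have "\<dots> \<le> ennreal c * ennreal (X powr r) + ennreal d * ennreal (Y powr s)"
    using u v by (intro add_mono mult_left_mono) auto
  also have "\<dots> = ennreal (c * X powr r + d * Y powr s)"
    using cd by (simp add: ennreal_mult)
  also have "c * X powr r + d * Y powr s = X * Y * (1 / r + 1 / s)"
    using XY by (simp add: c_def d_def field_simps)
  finally show ?thesis using assms by simp
qed

section \<open>Lebesgue differentiation along dyadic cells\<close>

lemma loc_integrable_HK:
  assumes "loc_integrable b"
  shows "b integrable_on {u..v}" "(LINT x:{u..v}|lborel. b x) = integral {u..v} b"
  using assms set_borel_integral_eq_integral[of "{u..v}" b] by (auto simp: loc_integrable_def)

lemma integral_cell:
  assumes "loc_integrable b"
  shows "(cell_int s k m b)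
    = integral {offset s k + side k * m .. offset s k + side k * (m + 1)} b"
proof -
  have "cell_int s k m b = integral (cell s k m) b"
    using set_borel_integral_eq_integral[OF cell_set_integrable[OF assms]] by simp
  also have "\<dots> = integral {offset s k + side k * m .. offset s k + side k * (m + 1)} b"
    unfolding cell_def by (intro integral_spike_set)
      (auto intro!: negligible_subset[OF negligible_finite[of "{offset s k + side k * (m + 1)}"]])
  finally show ?thesis .
qed

text \<open>The interval is one-sided and the error is a multiple of its length, so that the
  estimates to the right and to the left of x add up over a cell in which x may lie
  anywhere.\<close>

lemma Lebesgue_differentiation_right:
  fixes b :: "real \<Rightarrow> real"
  assumes "\<And>u v. b integrable_on {u..v}"
  shows "AE x in lborel. \<forall>e>0. \<exists>d>0. \<forall>h. 0 < h \<and> h < d \<longrightarrow> \<bar>integral {x..x + h} b - h * b x\<bar> \<le> e * h"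
proof -
  obtain N where N: "negligible N" "\<And>x e. \<lbrakk>x \<notin> N; 0 < e\<rbrakk> \<Longrightarrow>
      \<exists>d>0. \<forall>h. 0 < h \<and> h < d \<longrightarrow> norm(integral (cbox x (x + h *\<^sub>R One)) b /\<^sub>R h ^ DIM(real) - b x) < e"
    by (rule integrable_ccontinuous_explicit[of b]) (auto simp: assms)
  have "\<forall>e>0. \<exists>d>0. \<forall>h. 0 < h \<and> h < d \<longrightarrow> \<bar>integral {x..x + h} b - h * b x\<bar> \<le> e * h" if "x \<notin> N" for x
  proof (intro allI impI)
    fix e :: real assume "0 < e"
    from N(2)[OF that this] obtain d where d: "d > 0"
      "\<And>h. 0 < h \<Longrightarrow> h < d \<Longrightarrow> norm(integral (cbox x (x + h *\<^sub>R One)) b /\<^sub>R h ^ DIM(real) - b x) < e" by blast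
    show "\<exists>d>0. \<forall>h. 0 < h \<and> h < d \<longrightarrow> \<bar>integral {x..x + h} b - h * b x\<bar> \<le> e * h"
    proof (intro exI[of _ d] conjI allI impI d(1))
      fix h assume h: "0 < h \<and> h < d"
      have "\<bar>integral {x..x+h} b / h - b x\<bar> < e" using d(2)[of h] h by (simp add: divide_inverse_commute)
      also have "integral {x..x+h} b / h - b x = (integral {x..x+h} b - h * b x) / h"
        using h by (simp add: field_simps)
      finally show "\<bar>integral {x..x + h} b - h * b x\<bar> \<le> e * h" using h by (simp add: field_simps)
    qed
  qed
  moreover have "AE x in lborel. x \<notin> N"
  proof -
    have "AE x in lebesgue. x \<notin> N"
      using N(1) by (intro AE_not_in) (simp add: negligible_iff_null_sets)
    then show ?thesis by (simp add: AE_completion_iff)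
  qed
  ultimately show ?thesis by auto
qed

lemma Lebesgue_differentiation_left:
  fixes b :: "real \<Rightarrow> real"
  assumes "\<And>u v. b integrable_on {u..v}"
  shows "AE x in lborel. \<forall>e>0. \<exists>d>0. \<forall>h. 0 < h \<and> h < d \<longrightarrow> \<bar>integral {x - h..x} b - h * b x\<bar> \<le> e * h"
proof -
  let ?P = "\<lambda>x. \<forall>e>0. \<exists>d>0. \<forall>h. 0 < h \<and> h < d \<longrightarrow> \<bar>integral {x - h..x} b - h * b x\<bar> \<le> e * h"
  have "AE x in lborel. \<forall>e>0. \<exists>d>0. \<forall>h. 0 < h \<and> h < d \<longrightarrow>
     \<bar>integral {x..x + h} (\<lambda>x. b (- x)) - h * b (- x)\<bar> \<le> e * h"
  proof (rule Lebesgue_differentiation_right)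
    show "(\<lambda>x. b (- x)) integrable_on {u..v}" for u v
      using Henstock_Kurzweil_Integration.integrable_reflect_real[where f = b and a = "-v" and b = "-u"] assms[of "-v" "-u"] by simp
  qed
  moreover have "integral {x..x + h} (\<lambda>x. b (- x)) = integral {- x - h..- x} b" for x h
    using Henstock_Kurzweil_Integration.integral_reflect_real[where f = b and b = "-x" and a = "-x - h"] by (simp add: add.commute)
  \<comment> \<open>The right-hand statement for the reflected function concerns \<open>- x\<close>.
    Reflection preserves Lebesgue measure, so pulling back the exceptional null set removes the
    sign.\<close>
  ultimately have "AE x in lborel. ?P (- x)" by simp
  then obtain N where N: "{x. \<not> ?P (- x)} \<subseteq> N" "N \<in> null_sets lborel"
    by (auto simp: eventually_ae_filter)
  have Nb: "N \<in> sets borel" using N(2) by auto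
  show ?thesis
  proof (rule AE_I')
    have "emeasure lborel (uminus -` N :: real set) = emeasure (distr lborel borel uminus) N"
      using Nb by (simp add: emeasure_distr)
    also have "\<dots> = 0" using N(2) by (simp add: lborel_distr_uminus null_setsD1)
    finally show "uminus -` N \<in> null_sets lborel"
      using Nb measurable_sets_borel[of uminus borel N] by (auto simp: null_sets_def)
    show "{x \<in> space lborel. \<not> ?P x} \<subseteq> uminus -` N"
    proof
      fix x assume "x \<in> {x \<in> space lborel. \<not> ?P x}"
      then have "\<not> ?P (- (- x))" by simp
      then show "x \<in> uminus -` N" using N(1) by blast
    qed
  qed
qed

lemma dyadic_avg_tendsto:
  assumes "loc_integrable b"
  shows "AE x in lborel. (\<lambda>n. dyadic_avg s (k - int n) b x) \<longlonglongrightarrow> b x"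
  using Lebesgue_differentiation_right[OF loc_integrable_HK(1)[OF assms]]
    Lebesgue_differentiation_left[OF loc_integrable_HK(1)[OF assms]]
proof eventually_elim
  case (elim x)
  show ?case
  proof (rule LIMSEQ_I)
    fix e :: real assume "0 < e"
    then have e: "0 < e / 2" by simp
    obtain d1 where d1: "d1 > 0" "\<And>h. 0 < h \<Longrightarrow> h < d1 \<Longrightarrow> \<bar>integral {x..x + h} b - h * b x\<bar> \<le> e / 2 * h"
      using elim(1) e by blast
    obtain d2 where d2: "d2 > 0" "\<And>h. 0 < h \<Longrightarrow> h < d2 \<Longrightarrow> \<bar>integral {x - h..x} b - h * b x\<bar> \<le> e / 2 * h"
      using elim(2) e by blast
    have side_eq: "side (k - int n) = side k * (1 / 2) ^ n" for n
      by (simp add: side_def powr_diff powr_realpow power_divide)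
    have "(\<lambda>n. side k * (1 / 2) ^ n) \<longlonglongrightarrow> side k * 0"
      by (intro tendsto_intros LIMSEQ_power_zero) auto
    then have "\<forall>\<^sub>F n in sequentially. side k * (1 / 2) ^ n < min d1 d2"
      using d1(1) d2(1) by (intro order_tendstoD) auto
    then obtain n0 where n0: "\<And>n. n0 \<le> n \<Longrightarrow> side (k - int n) < min d1 d2"
      unfolding side_eq eventually_sequentially by blast
    show "\<exists>n0. \<forall>n\<ge>n0. norm (dyadic_avg s (k - int n) b x - b x) < e"
    proof (intro exI[of _ n0] allI impI)
      fix n assume n: "n0 \<le> n"
      define j m where "j = k - int n" and "m = cell_index s j x"
      define l where "l = offset s j + side j * m"
      have small: "side j < d1" "side j < d2" using n0[OF n] by (auto simp: j_def)
      have "x \<in> cell s j m" by (simp add: mem_cell_iff m_def)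
      moreover have lr: "offset s j + side j * (m + 1) = l + side j" by (simp add: l_def algebra_simps)
      ultimately have x: "l \<le> x" "x < l + side j"
        by (auto simp: cell_def l_def algebra_simps)
      have R: "\<bar>integral {x..l + side j} b - (l + side j - x) * b x\<bar> \<le> e / 2 * (l + side j - x)"
        using d1(2)[of "l + side j - x"] x small by auto
      \<comment> \<open>\<open>d2\<close> speaks of positive lengths only. The left piece
        degenerates when x is the left endpoint of the half-open cell; the right piece never
        does.\<close>
      have L: "\<bar>integral {l..x} b - (x - l) * b x\<bar> \<le> e / 2 * (x - l)"
      proof (cases "l = x")
        case False then show ?thesis using d2(2)[of "x - l"] x small by auto
      qed simp
      have "integral {l..l + side j} b = integral {l..x} b + integral {x..l + side j} b"
        using x loc_integrable_HK(1)[OF assms] by (intro Henstock_Kurzweil_Integration.integral_combine[symmetric]) auto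
      then have "integral {l..l + side j} b - side j * b x
          = (integral {l..x} b - (x - l) * b x) + (integral {x..l + side j} b - (l + side j - x) * b x)"
        by (simp add: algebra_simps)
      also have "\<bar>\<dots>\<bar> \<le> e / 2 * (x - l) + e / 2 * (l + side j - x)"
        using L R by linarith
      also have "\<dots> = e / 2 * side j" by (simp add: field_simps)
      finally have "\<bar>integral {l..l + side j} b - side j * b x\<bar> \<le> e / 2 * side j" .
      moreover have "dyadic_avg s j b x = integral {l..l + side j} b / side j"
        unfolding dyadic_avg_def cell_avg_def m_def[symmetric] integral_cell[OF assms] l_def[symmetric] lr ..
      then have "integral {l..l + side j} b - side j * b x = (dyadic_avg s j b x - b x) * side j"
        by (simp add: field_simps)
      ultimately have "\<bar>dyadic_avg s j b x - b x\<bar> * side j \<le> e / 2 * side j"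
        by (simp only: abs_mult abs_of_pos side_pos)
      then have "\<bar>dyadic_avg s j b x - b x\<bar> \<le> e / 2"
        by (subst (asm) mult_le_cancel_right_pos) simp_all
      then show "norm (dyadic_avg s (k - int n) b x - b x) < e"
        using \<open>0 < e\<close> by (simp add: j_def)
    qed
  qed
qed

lemma loc_integrable_abs_diff:
  assumes "loc_integrable b" shows "loc_integrable (\<lambda>x. \<bar>b x - c\<bar>)"
proof -
  have "set_integrable lborel {u..v} (\<lambda>x. b x - c)" for u v
    using assms by (intro set_integral_diff) (auto simp: loc_integrable_def set_integrable_def emeasure_lborel_Icc_eq)
  then have "set_integrable lborel {u..v} (\<lambda>x. \<bar>b x - c\<bar>)" for u v by (intro set_integrable_abs)
  then show ?thesis using assms by (auto simp: loc_integrable_def)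
qed

lemma cell_avg_diff_le:
  assumes "loc_integrable b"
  shows "\<bar>cell_avg s k b m - c\<bar> * side k \<le> (cell_int s k m (\<lambda>x. \<bar>b x - c\<bar>))"
proof -
  have "cell_int s k m (\<lambda>x. b x - c) = cell_avg s k b m * side k - c * side k"
    by (subst set_integral_diff)
      (auto intro: cell_set_integrable[OF assms] cell_set_integrable_const simp: set_integral_cell_const cell_avg_def)
  then have "\<bar>cell_avg s k b m - c\<bar> * side k = \<bar>LINT x:cell s k m|lborel. b x - c\<bar>"
    by (simp add: abs_mult flip: left_diff_distrib)
  also have "\<dots> \<le> (cell_int s k m (\<lambda>x. \<bar>b x - c\<bar>))"
    using integral_abs_bound[of lborel "\<lambda>x. indicator (cell s k m) x *\<^sub>R (b x - c)"]
    by (simp add: set_lebesgue_integral_def abs_mult)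
  finally show ?thesis .
qed

text \<open>Dyadic stopping-time argument behind the John--Nirenberg inequality, organised as an induction on
  the number of generations. A subcell on which the mean of \<open>\<bar>b - c\<bar>\<close> exceeds the threshold is
  re-centred at its own mean; its contribution is then paid for by the term \<open>D * \<integral>\<bar>b - c\<bar>\<close>.\<close>
lemma John_Nirenberg_generations:
  fixes s :: bool
  assumes r: "1 \<le> r" and B: "0 < B" and b: "loc_integrable b"
    and osc: "\<And>k m. (cell_int s k m (\<lambda>x. \<bar>b x - cell_avg s k b m\<bar>)) \<le> B * side k"
  defines "\<theta> \<equiv> 2 powr r * 2"
  defines "D \<equiv> ((\<theta> * B) powr r + (2 * \<theta> * B) powr r) / B"
  assumes c: "cell_int s k m (\<lambda>x. \<bar>b x - c\<bar>) \<le> \<theta> * B * side k"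
  shows "(\<integral>\<^sup>+x\<in>cell s k m. ennreal (\<bar>dyadic_avg s (k - int n) b x - c\<bar> powr r) \<partial>lborel)
    \<le> ennreal ((\<theta> * B) powr r * side k + D * (cell_int s k m (\<lambda>x. \<bar>b x - c\<bar>)))"
  using c
proof (induction n arbitrary: k m c)
  case 0
  have D: "0 \<le> D" using B by (simp add: D_def)
  have "\<bar>cell_avg s k b m - c\<bar> * side k \<le> \<theta> * B * side k"
    using cell_avg_diff_le[OF b, of s k m c] 0 by linarith
  then have *: "\<bar>cell_avg s k b m - c\<bar> \<le> \<theta> * B" by simp
  have "(\<integral>\<^sup>+x\<in>cell s k m. ennreal (\<bar>dyadic_avg s (k - int 0) b x - c\<bar> powr r) \<partial>lborel)
     = (\<integral>\<^sup>+x\<in>cell s k m. ennreal (\<bar>cell_avg s k b m - c\<bar> powr r) \<partial>lborel)"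
    by (intro nn_integral_cong) (auto simp: indicator_def dyadic_avg_def mem_cell_iff)
  also have "\<dots> = ennreal (\<bar>cell_avg s k b m - c\<bar> powr r * side k)"
    by (simp add: nn_integral_cmult_indicator ennreal_mult)
  also have "\<dots> \<le> ennreal ((\<theta> * B) powr r * side k + D * (cell_int s k m (\<lambda>x. \<bar>b x - c\<bar>)))"
  proof (rule ennreal_leI)
    have "\<bar>cell_avg s k b m - c\<bar> powr r * side k \<le> (\<theta> * B) powr r * side k"
      using * r by (intro mult_right_mono powr_mono2) auto
    moreover have "0 \<le> D * (cell_int s k m (\<lambda>x. \<bar>b x - c\<bar>))"
      using D by (intro mult_nonneg_nonneg) (auto simp: set_lebesgue_integral_def)
    ultimately show "\<bar>cell_avg s k b m - c\<bar> powr r * side k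
      \<le> (\<theta> * B) powr r * side k + D * (cell_int s k m (\<lambda>x. \<bar>b x - c\<bar>))" by linarith
  qed
  finally show ?case .
next
  case (Suc n)
  have D: "0 \<le> D" using B by (simp add: D_def)
  have \<theta>: "1 \<le> \<theta>" using r ge_one_powr_ge_zero[of 2 r] by (simp add: \<theta>_def)
  obtain m' where m': "cell s (k - 1 + 1) m = cell s (k - 1) m' \<union> cell s (k - 1) (m' + 1)"
    "cell s (k - 1) m' \<inter> cell s (k - 1) (m' + 1) = {}" using cell_halves by blast
  then have un: "cell s k m = cell s (k - 1) m' \<union> cell s (k - 1) (m' + 1)" by simp
  let ?\<sigma> = "side (k - 1)"
  have sk: "side k = ?\<sigma> + ?\<sigma>" using side_Suc[of "k - 1"] by simp
  define J where "J i = (cell_int s (k - 1) i (\<lambda>x. \<bar>b x - c\<bar>))" for i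
  have J0: "0 \<le> J i" for i unfolding J_def by (auto simp: set_lebesgue_integral_def)
  have J: "cell_int s k m (\<lambda>x. \<bar>b x - c\<bar>) = J m' + J (m' + 1)"
    using integral_cell_halves[OF loc_integrable_abs_diff[OF b] m'] by (simp add: J_def)
  let ?E = "\<lambda>x. dyadic_avg s (k - 1 - int n) b x"
  have half: "(\<integral>\<^sup>+x\<in>cell s (k - 1) i. ennreal (\<bar>?E x - c\<bar> powr r) \<partial>lborel)
     \<le> ennreal ((\<theta> * B) powr r * ?\<sigma> + D * J i)" if i: "i \<in> {m', m' + 1}" for i
  proof (cases "J i \<le> \<theta> * B * ?\<sigma>")
    case True
    then show ?thesis using Suc.IH[of "k - 1" i c] by (simp add: J_def)
  next
    case False
    let ?a = "cell_avg s (k - 1) b i"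
    \<comment> \<open>The threshold on the parent refers to twice the length of the subcell; hence
      the factor 2 in the bound for the jump of the centre.\<close>
    have "J i \<le> J m' + J (m' + 1)" using i J0[of m'] J0[of "m' + 1"] by auto
    also have "\<dots> \<le> 2 * \<theta> * B * ?\<sigma>" using Suc.prems unfolding J sk by (simp add: algebra_simps)
    finally have "\<bar>?a - c\<bar> * ?\<sigma> \<le> 2 * \<theta> * B * ?\<sigma>"
      using cell_avg_diff_le[OF b, of s "k - 1" i c] unfolding J_def by linarith
    then have ac: "\<bar>?a - c\<bar> \<le> 2 * \<theta> * B" by simp
    \<comment> \<open>Since \<theta> is at least 1, the mean oscillation bound \<open>B\<close>
      meets the threshold, so the induction hypothesis restarts with the new centre at a cost of at
      most D B times the length.\<close>
    have "B * ?\<sigma> \<le> \<theta> * B * ?\<sigma>" using \<theta> B by simp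
    then have "(\<integral>\<^sup>+x\<in>cell s (k - 1) i. ennreal (\<bar>?E x - ?a\<bar> powr r) \<partial>lborel)
        \<le> ennreal ((\<theta> * B) powr r * ?\<sigma> + D * (cell_int s (k - 1) i (\<lambda>x. \<bar>b x - ?a\<bar>)))"
      using osc[of "k - 1" i] by (intro Suc.IH) linarith
    also have "\<dots> \<le> ennreal ((\<theta> * B) powr r * ?\<sigma> + D * (B * ?\<sigma>))"
      using osc[of "k - 1" i] D by (intro ennreal_leI add_left_mono mult_left_mono)
    finally have IH: "(\<integral>\<^sup>+x\<in>cell s (k - 1) i. ennreal (\<bar>?E x - ?a\<bar> powr r) \<partial>lborel)
        \<le> ennreal ((\<theta> * B) powr r * ?\<sigma> + D * (B * ?\<sigma>))" .
    have "(\<integral>\<^sup>+x\<in>cell s (k - 1) i. ennreal (\<bar>?E x - c\<bar> powr r) \<partial>lborel)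
       \<le> (\<integral>\<^sup>+x. ennreal (2 powr r) * (ennreal (\<bar>?E x - ?a\<bar> powr r) * indicator (cell s (k - 1) i) x)
          + ennreal (2 powr r * (2 * \<theta> * B) powr r) * indicator (cell s (k - 1) i) x \<partial>lborel)"
    proof (intro nn_integral_mono)
      fix x
      have "\<bar>?E x - c\<bar> powr r \<le> (\<bar>?E x - ?a\<bar> + \<bar>?a - c\<bar>) powr r"
        using r by (intro powr_mono2) auto
      also have "\<dots> \<le> 2 powr r * (\<bar>?E x - ?a\<bar> powr r + \<bar>?a - c\<bar> powr r)"
        using r by (intro powr_add_le) auto
      also have "\<dots> \<le> 2 powr r * (\<bar>?E x - ?a\<bar> powr r + (2 * \<theta> * B) powr r)"
        using r ac by (intro mult_left_mono add_left_mono powr_mono2) auto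
      finally have "\<bar>?E x - c\<bar> powr r \<le> 2 powr r * \<bar>?E x - ?a\<bar> powr r + 2 powr r * (2 * \<theta> * B) powr r"
        by (simp add: algebra_simps)
      then have "ennreal (\<bar>?E x - c\<bar> powr r) \<le> ennreal (2 powr r) * ennreal (\<bar>?E x - ?a\<bar> powr r)
          + ennreal (2 powr r * (2 * \<theta> * B) powr r)"
        by (simp add: ennreal_mult[symmetric] ennreal_plus[symmetric] ennreal_leI del: ennreal_plus)
      then show "ennreal (\<bar>?E x - c\<bar> powr r) * indicator (cell s (k - 1) i) x
        \<le> ennreal (2 powr r) * (ennreal (\<bar>?E x - ?a\<bar> powr r) * indicator (cell s (k - 1) i) x)
          + ennreal (2 powr r * (2 * \<theta> * B) powr r) * indicator (cell s (k - 1) i) x"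
        by (simp add: indicator_def)
    qed
    also have "\<dots> = ennreal (2 powr r) * (\<integral>\<^sup>+x\<in>cell s (k - 1) i. ennreal (\<bar>?E x - ?a\<bar> powr r) \<partial>lborel)
       + ennreal (2 powr r * (2 * \<theta> * B) powr r) * ennreal ?\<sigma>"
      by (subst nn_integral_add) (auto simp: nn_integral_cmult nn_integral_cmult_indicator)
    also have "\<dots> \<le> ennreal (2 powr r) * ennreal ((\<theta> * B) powr r * ?\<sigma> + D * (B * ?\<sigma>))
       + ennreal (2 powr r * (2 * \<theta> * B) powr r) * ennreal ?\<sigma>"
      by (intro add_right_mono mult_left_mono IH) auto
    also have "\<dots> = ennreal (2 powr r * ((\<theta> * B) powr r * ?\<sigma> + D * (B * ?\<sigma>))
        + 2 powr r * (2 * \<theta> * B) powr r * ?\<sigma>)"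
      using D B by (simp add: ennreal_mult[symmetric] ennreal_plus[symmetric] del: ennreal_plus)
    also have "2 powr r * ((\<theta> * B) powr r * ?\<sigma> + D * (B * ?\<sigma>)) + 2 powr r * (2 * \<theta> * B) powr r * ?\<sigma>
       = 2 powr r * ?\<sigma> * (((\<theta> * B) powr r + (2 * \<theta> * B) powr r) + D * B)"
      by (simp add: algebra_simps)
    \<comment> \<open>\<open>D\<close> is defined so that D B equals the base term plus the jump
      term. The two equal contributions D B and the factor 2^r from splitting the power combine to D
      \<theta> B; on a subcell above the threshold this is less than D times the mean
      deviation.\<close>
    also have "((\<theta> * B) powr r + (2 * \<theta> * B) powr r) = D * B" using B by (simp add: D_def)
    also have "2 powr r * ?\<sigma> * (D * B + D * B) = D * (\<theta> * B * ?\<sigma>)" by (simp add: \<theta>_def)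
    also have "ennreal \<dots> \<le> ennreal ((\<theta> * B) powr r * ?\<sigma> + D * J i)"
      using False D mult_left_mono[of "\<theta> * B * ?\<sigma>" "J i" D] by (intro ennreal_leI add_increasing) auto
    finally show ?thesis .
  qed
  have kn: "k - int (Suc n) = k - 1 - int n" by simp
  have "(\<integral>\<^sup>+x\<in>cell s k m. ennreal (\<bar>dyadic_avg s (k - int (Suc n)) b x - c\<bar> powr r) \<partial>lborel)
     = (\<integral>\<^sup>+x\<in>cell s (k - 1) m'. ennreal (\<bar>?E x - c\<bar> powr r) \<partial>lborel)
     + (\<integral>\<^sup>+x\<in>cell s (k - 1) (m' + 1). ennreal (\<bar>?E x - c\<bar> powr r) \<partial>lborel)"
    unfolding un kn using m'(2) by (intro nn_integral_disjoint_pair) auto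
  also have "\<dots> \<le> ennreal ((\<theta> * B) powr r * ?\<sigma> + D * J m') + ennreal ((\<theta> * B) powr r * ?\<sigma> + D * J (m' + 1))"
    by (intro add_mono half) auto
  also have "\<dots> = ennreal ((\<theta> * B) powr r * side k + D * (cell_int s k m (\<lambda>x. \<bar>b x - c\<bar>)))"
    unfolding J sk using D J0 by (simp add: ennreal_plus[symmetric] algebra_simps del: ennreal_plus)
  finally show ?case .
qed

text \<open>With \<theta> = 2 * 2^r this is 2 \<theta>^r + (2 \<theta>)^r, the value at B = 1 of the
  base term plus D B in the generation estimate.\<close>

definition JN_const :: "real \<Rightarrow> real" where
  "JN_const r = 2 * (2 powr r * 2) powr r + (2 * (2 powr r * 2)) powr r"

text \<open>The generation estimate, centred at the mean of the cell itself, is uniform in the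
  number of generations. The dyadic averages converge to \<open>b\<close> almost everywhere, so
  Fatou's lemma passes to the limit.\<close>

lemma John_Nirenberg:
  assumes r: "1 \<le> r" and B: "0 < B" and b: "loc_integrable b"
    and osc: "\<And>k m. (cell_int s k m (\<lambda>x. \<bar>b x - cell_avg s k b m\<bar>)) \<le> B * side k"
  shows "(\<integral>\<^sup>+x\<in>cell s k m. ennreal (\<bar>b x - cell_avg s k b m\<bar> powr r) \<partial>lborel)
    \<le> ennreal (JN_const r * B powr r * side k)"
proof -
  define \<theta> where "\<theta> = 2 powr r * (2::real)"
  define D where "D = ((\<theta> * B) powr r + (2 * \<theta> * B) powr r) / B"
  have [measurable]: "b \<in> borel_measurable borel" using b by (simp add: loc_integrable_def)
  have \<theta>: "1 \<le> \<theta>" using r ge_one_powr_ge_zero[of 2 r] by (simp add: \<theta>_def)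
  have D: "0 \<le> D" using B by (simp add: D_def)
  let ?c = "cell_avg s k b m"
  let ?u = "\<lambda>n x. ennreal (\<bar>dyadic_avg s (k - int n) b x - ?c\<bar> powr r) * indicator (cell s k m) x"
  have bound: "(\<integral>\<^sup>+x. ?u n x \<partial>lborel) \<le> ennreal (JN_const r * B powr r * side k)" for n
  proof -
    have "B * side k \<le> \<theta> * B * side k" using \<theta> B by simp
    then have "cell_int s k m (\<lambda>x. \<bar>b x - ?c\<bar>) \<le> \<theta> * B * side k" using osc[of k m] by linarith
    then have "(\<integral>\<^sup>+x. ?u n x \<partial>lborel)
       \<le> ennreal ((\<theta> * B) powr r * side k + D * (cell_int s k m (\<lambda>x. \<bar>b x - ?c\<bar>)))"
      using John_Nirenberg_generations[OF r B b osc, where c = ?c and k = k and m = m and n = n]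
      by (simp add: \<theta>_def D_def)
    also have "\<dots> \<le> ennreal ((\<theta> * B) powr r * side k + D * (B * side k))"
      using osc[of k m] D by (intro ennreal_leI add_left_mono mult_left_mono)
    also have "(\<theta> * B) powr r * side k + D * (B * side k) = JN_const r * B powr r * side k"
    proof -
      have "D * (B * side k) = ((\<theta> * B) powr r + (2 * \<theta> * B) powr r) * side k"
        using B by (simp add: D_def)
      moreover have "(\<theta> * B) powr r = \<theta> powr r * B powr r" "(2 * \<theta> * B) powr r = (2 * \<theta>) powr r * B powr r"
        using B \<theta> by (simp_all add: powr_mult)
      moreover have "JN_const r = 2 * \<theta> powr r + (2 * \<theta>) powr r"
        by (simp only: JN_const_def \<theta>_def)
      ultimately show ?thesis by (simp only: algebra_simps)
    qed
    finally show ?thesis .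
  qed
  have "(\<integral>\<^sup>+x\<in>cell s k m. ennreal (\<bar>b x - ?c\<bar> powr r) \<partial>lborel) \<le> (\<integral>\<^sup>+x. liminf (\<lambda>n. ?u n x) \<partial>lborel)"
  proof (intro nn_integral_mono_AE)
    show "AE x in lborel. ennreal (\<bar>b x - ?c\<bar> powr r) * indicator (cell s k m) x \<le> liminf (\<lambda>n. ?u n x)"
      using dyadic_avg_tendsto[OF b, of s k]
    proof eventually_elim
      case (elim x)
      have "(\<lambda>n. ?u n x) \<longlonglongrightarrow> ennreal (\<bar>b x - ?c\<bar> powr r) * indicator (cell s k m) x"
        using elim r by (cases "x \<in> cell s k m")
          (auto intro!: tendsto_ennrealI tendsto_powr' tendsto_rabs tendsto_diff)
      then show ?case by (simp add: lim_imp_Liminf)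
    qed
  qed
  also have "\<dots> \<le> liminf (\<lambda>n. \<integral>\<^sup>+x. ?u n x \<partial>lborel)"
    by (intro nn_integral_liminf) measurable
  also have "\<dots> \<le> ennreal (JN_const r * B powr r * side k)"
    using bound by (intro Liminf_le) auto
  finally show ?thesis .
qed

section \<open>Hedberg's estimate\<close>

lemma side_powr: "side k powr a = 2 powr (real_of_int k * a)"
  by (simp add: side_def powr_powr)

lemma sum_side_powr_le:
  assumes "finite S" "\<And>k. k \<in> S \<Longrightarrow> k \<le> k0" "0 < a"
  shows "(\<Sum>k\<in>S. side k powr a) \<le> side k0 powr a / (1 - 2 powr - a)"
proof -
  let ?\<rho> = "2 powr - a :: real"
  have \<rho>: "0 \<le> ?\<rho>" "?\<rho> < 1" using assms powr_less_one[of 2 "-a"] by auto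
  have inj: "inj_on (\<lambda>k. nat (k0 - k)) S"
    using assms(2) by (auto simp: inj_on_def) (metis add_diff_cancel diff_add_cancel diff_ge_0_iff_ge diff_right_commute eq_nat_nat_iff minus_diff_eq)
  have "(\<Sum>k\<in>S. side k powr a) = (\<Sum>k\<in>S. side k0 powr a * ?\<rho> ^ nat (k0 - k))"
  proof (intro sum.cong refl)
    fix k assume "k \<in> S"
    then have "real (nat (k0 - k)) = real_of_int (k0 - k)" using assms(2) by fastforce
    then show "side k powr a = side k0 powr a * ?\<rho> ^ nat (k0 - k)"
      by (simp add: side_powr powr_powr flip: powr_realpow powr_add) (simp add: algebra_simps)
  qed
  also have "\<dots> = side k0 powr a * (\<Sum>j\<in>(\<lambda>k. nat (k0 - k)) ` S. ?\<rho> ^ j)"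
    by (subst sum.reindex[OF inj]) (simp add: sum_distrib_left)
  also have "\<dots> \<le> side k0 powr a * (\<Sum>j. ?\<rho> ^ j)"
    using assms \<rho> by (intro mult_left_mono sum_le_suminf summable_geometric) auto
  also have "(\<Sum>j. ?\<rho> ^ j) = 1 / (1 - ?\<rho>)" using \<rho> by (intro suminf_geometric) auto
  finally show ?thesis by simp
qed

lemma sum_side_powr_minus_le:
  assumes "finite S" "\<And>k. k \<in> S \<Longrightarrow> k0 \<le> k" "0 < a"
  shows "(\<Sum>k\<in>S. side k powr - a) \<le> side k0 powr - a / (1 - 2 powr - a)"
proof -
  have "(\<Sum>k\<in>S. side k powr - a) = (\<Sum>k\<in>uminus ` S. side k powr a)"
    by (subst sum.reindex) (auto simp: side_powr)
  also have "\<dots> \<le> side (- k0) powr a / (1 - 2 powr - a)"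
    using assms by (intro sum_side_powr_le) auto
  finally show ?thesis by (simp add: side_powr)
qed

text \<open>Hedberg's splitting of the scales at the level \<open>k\<close> with \<open>side k \<approx> M powr - p\<close>.\<close>
lemma Hedberg_sum:
  fixes \<alpha> p q M :: real and a :: "int \<Rightarrow> real"
  assumes "finite S" "0 < \<alpha>" "0 < p" "0 < q" "1 / q = 1 / p - \<alpha>" "0 < M"
    and a: "\<And>k. k \<in> S \<Longrightarrow> a k \<le> M" "\<And>k. k \<in> S \<Longrightarrow> a k \<le> side k powr (- 1 / p)"
  shows "(\<Sum>k\<in>S. side k powr \<alpha> * a k) \<le> (1 / (1 - 2 powr - \<alpha>) + 1 / (1 - 2 powr - (1 / q))) * M powr (p / q)"
proof -
  define k0 where "k0 = \<lfloor>log 2 (M powr - p)\<rfloor>"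
  have "real_of_int k0 \<le> log 2 (M powr - p)" "log 2 (M powr - p) < real_of_int (k0 + 1)"
    by (auto simp: k0_def)
  then have k0: "side k0 \<le> M powr - p" "M powr - p < side (k0 + 1)"
    using \<open>0 < M\<close> unfolding side_def by (simp_all add: le_log_iff log_less_iff)
  \<comment> \<open>This identity and \<alpha> - 1/p = -1/q turn both halves into multiples of
    M^(p/q): the geometric series over small scales is dominated by its top level \<open>k0\<close>,
    the one over large scales by its lowest level \<open>k0 + 1\<close>.\<close>
  have pq: "1 - p * \<alpha> = p / q" using assms by (simp add: field_simps)
  let ?L = "{k\<in>S. k \<le> k0}" and ?H = "{k\<in>S. k0 + 1 \<le> k}"
  have S: "S = ?L \<union> ?H" "?L \<inter> ?H = {}" by auto
  have pos: "0 < 1 - 2 powr - \<alpha>" "0 < 1 - 2 powr - (1 / q)"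
    using \<open>0 < \<alpha>\<close> \<open>0 < q\<close> powr_less_one[of 2 "-\<alpha>"] powr_less_one[of 2 "-(1/q)"] by auto
  have "(\<Sum>k\<in>S. side k powr \<alpha> * a k) = (\<Sum>k\<in>?L. side k powr \<alpha> * a k) + (\<Sum>k\<in>?H. side k powr \<alpha> * a k)"
    by (subst S(1), rule sum.union_disjoint) (use S(2) assms in auto)
  also have "(\<Sum>k\<in>?L. side k powr \<alpha> * a k) \<le> (\<Sum>k\<in>?L. side k powr \<alpha>) * M"
    unfolding sum_distrib_right using a by (intro sum_mono mult_left_mono) auto
  also have "\<dots> \<le> side k0 powr \<alpha> / (1 - 2 powr - \<alpha>) * M"
    using assms by (intro mult_right_mono sum_side_powr_le) auto
  also have "\<dots> \<le> (M powr - p) powr \<alpha> / (1 - 2 powr - \<alpha>) * M"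
    using assms k0 pos by (intro mult_right_mono divide_right_mono powr_mono2) auto
  also have "\<dots> = 1 / (1 - 2 powr - \<alpha>) * M powr (p / q)"
    using \<open>0 < M\<close> by (simp add: powr_powr flip: pq) (simp add: powr_diff powr_minus field_simps)
  also have "(\<Sum>k\<in>?H. side k powr \<alpha> * a k) \<le> (\<Sum>k\<in>?H. side k powr - (1 / q))"
  proof (intro sum_mono)
    fix k assume k: "k \<in> ?H"
    have "side k powr \<alpha> * a k \<le> side k powr \<alpha> * side k powr (- 1 / p)"
      using k a by (intro mult_left_mono) auto
    also have "\<dots> = side k powr - (1 / q)" unfolding assms(5) by (simp flip: powr_add)
    finally show "side k powr \<alpha> * a k \<le> side k powr - (1 / q)" .
  qed
  also have "\<dots> \<le> side (k0 + 1) powr - (1 / q) / (1 - 2 powr - (1 / q))"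
    using assms(1) \<open>0 < q\<close> by (intro sum_side_powr_minus_le) auto
  also have "\<dots> \<le> (M powr - p) powr - (1 / q) / (1 - 2 powr - (1 / q))"
    using k0 \<open>0 < q\<close> \<open>0 < M\<close> pos by (intro divide_right_mono powr_mono2') auto
  also have "\<dots> = 1 / (1 - 2 powr - (1 / q)) * M powr (p / q)"
    by (simp add: powr_powr)
  finally show ?thesis by (simp add: algebra_simps)
qed

text \<open>A truncated dyadic Riesz potential whose cell means are L^u means. The room u > 1 pays,
  through Hoelder's inequality, for the oscillation of \<open>b\<close> on the cell.\<close>

definition dyadic_frac :: "bool \<Rightarrow> real \<Rightarrow> real \<Rightarrow> nat \<Rightarrow> (real \<Rightarrow> real) \<Rightarrow> real \<Rightarrow> real" where
  "dyadic_frac s \<alpha> u N f x =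
    (\<Sum>k\<in>{- int N..int N}. side k powr \<alpha> * dyadic_avg s k (\<lambda>x. f x powr u) x powr (1 / u))"

lemma dyadic_frac_measurable [measurable]: "dyadic_frac s \<alpha> u N f \<in> borel_measurable borel"
  unfolding dyadic_frac_def by measurable

lemma dyadic_frac_nonneg: "0 \<le> dyadic_frac s \<alpha> u N f x"
  unfolding dyadic_frac_def by (intro sum_nonneg) auto

text \<open>Hedberg's splitting with M the (1/u)-th power of the maximal function of f^u, where f^u
  lies in L^(p/u) and p/u > 1. The constant is uniform in the grid, in f and in the truncation
  \<open>N\<close>, which later tends to infinity.\<close>

lemma dyadic_frac_bound:
  fixes \<alpha> p q u :: real
  assumes "1 \<le> u" "u < p" "0 < \<alpha>" "0 < q" "1 / q = 1 / p - \<alpha>"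
  obtains C where "0 \<le> C" and "\<And>s N f. f \<in> borel_measurable borel \<Longrightarrow> (\<And>x. 0 \<le> f x) \<Longrightarrow>
    integrable lborel (\<lambda>x. f x powr p) \<Longrightarrow> (LINT x|lborel. f x powr p) \<le> 1 \<Longrightarrow>
    (\<integral>\<^sup>+x. ennreal (dyadic_frac s \<alpha> u N f x powr q) \<partial>lborel) \<le> ennreal C"
proof -
  define c where "c = 1 / (1 - 2 powr - \<alpha>) + 1 / (1 - 2 powr - (1 / q))"
  have pos: "0 < 1 - 2 powr - \<alpha>" "0 < 1 - 2 powr - (1 / q)"
    using \<open>0 < \<alpha>\<close> \<open>0 < q\<close> powr_less_one[of 2 "-\<alpha>"] powr_less_one[of 2 "-(1/q)"] by auto
  then have c: "0 \<le> c" by (simp add: c_def)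
  define t where "t = p / u"
  have t: "1 < t" using assms by (simp add: t_def)
  have p: "1 < p" using assms by simp
  define A where "A = 2 powr t / (t - 1)"
  have A: "0 \<le> A" using t by (simp add: A_def)
  show thesis
  proof (rule that)
    show "0 \<le> c powr q * A" using A by simp
    fix s N and f :: "real \<Rightarrow> real"
    assume [measurable]: "f \<in> borel_measurable borel" and f0: "\<And>x. 0 \<le> f x"
      and fp: "integrable lborel (\<lambda>x. f x powr p)" "(LINT x|lborel. f x powr p) \<le> 1"
    define F where "F = (\<lambda>x. f x powr u)"
    have [measurable]: "F \<in> borel_measurable borel" by (simp add: F_def)
    have F0: "\<And>x. 0 \<le> F x" by (simp add: F_def)
    have Ft: "(\<lambda>x. F x powr t) = (\<lambda>x. f x powr p)"
      using assms by (simp add: F_def t_def powr_powr)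
    have intF: "integrable lborel (\<lambda>x. F x powr t)" using fp by (simp add: Ft)
    note loc = loc_integrable_if_powr_integrable[OF less_imp_le[OF t] _ F0 intF]
    have avg0: "0 \<le> dyadic_avg s k F x" for k x unfolding dyadic_avg_def by (rule cell_avg_nonneg[OF F0])
    define M where "M = (\<lambda>x. dyadic_max s F (2 * N) (int N) x powr (1 / u))"
    \<comment> \<open>Jensen's inequality with exponent p/u and the normalisation of f bound the
      mean of f^u over a cell of side h by h^(-u/p).\<close>
    have small: "dyadic_avg s k F x powr (1 / u) \<le> side k powr (- 1 / p)" for k x
    proof -
      let ?a = "dyadic_avg s k F x"
      have "?a powr t \<le> cell_avg s k (\<lambda>x. F x powr t) (cell_index s k x)"
        unfolding dyadic_avg_def using loc by (intro cell_Jensen t F0) auto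
      also have "\<dots> \<le> 1 / side k"
      proof -
        have "(LINT y:cell s k (cell_index s k x)|lborel. F y powr t) \<le> (LINT y|lborel. F y powr t)"
          unfolding set_lebesgue_integral_def using intF
          by (intro integral_mono integrable_mult_indicator) (auto simp: indicator_def)
        then show ?thesis using fp by (simp add: cell_avg_def Ft divide_right_mono)
      qed
      finally have "(?a powr t) powr (1 / p) \<le> (1 / side k) powr (1 / p)"
        using p by (intro powr_mono2) auto
      then show ?thesis using assms by (simp add: powr_powr t_def powr_divide powr_minus divide_simps)
    qed
    have pw: "dyadic_frac s \<alpha> u N f x powr q \<le> c powr q * dyadic_max s F (2 * N) (int N) x powr t" for x
    \<comment> \<open>\<open>2 * N\<close> steps down from scale N reach scale -N. A vanishing
      maximal function has no splitting level and is treated apart: then every average in the sum is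
      0.\<close>
    proof (cases "dyadic_max s F (2 * N) (int N) x = 0")
      case True
      have "dyadic_avg s k F x = 0" if "k \<in> {- int N..int N}" for k
        using dyadic_avg_le_max[where k = "int N" and n = "2 * N" and j = k and s = s and F = F and x = x] that True avg0[of k x] by auto
      then show ?thesis by (simp add: dyadic_frac_def F_def[symmetric] True)
    next
      case False
      have d0: "0 < dyadic_max s F (2 * N) (int N) x" using False dyadic_max_nonneg[where F = F and s = s and n = "2 * N" and k = "int N" and x = x, OF F0] by simp
      have "dyadic_frac s \<alpha> u N f x \<le> c * M x powr (p / q)"
        unfolding dyadic_frac_def F_def[symmetric] c_def
      proof (rule Hedberg_sum)
        show "0 < M x" using d0 by (simp add: M_def)
        fix k assume k: "k \<in> {- int N..int N}"
        show "dyadic_avg s k F x powr (1 / u) \<le> M x"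
          unfolding M_def using k assms avg0 by (intro powr_mono2 dyadic_avg_le_max) auto
        show "dyadic_avg s k F x powr (1 / u) \<le> side k powr (- 1 / p)" by (rule small)
      qed (use assms p in auto)
      then have "dyadic_frac s \<alpha> u N f x powr q \<le> (c * M x powr (p / q)) powr q"
        using assms by (intro powr_mono2 dyadic_frac_nonneg) auto
      also have "\<dots> = c powr q * M x powr p"
        using c assms by (simp add: powr_mult powr_powr)
      also have "M x powr p = dyadic_max s F (2 * N) (int N) x powr t"
        by (simp add: M_def powr_powr t_def)
      finally show ?thesis .
    qed
    have "(\<integral>\<^sup>+x. ennreal (dyadic_frac s \<alpha> u N f x powr q) \<partial>lborel)
       \<le> (\<integral>\<^sup>+x. ennreal (c powr q) * ennreal (dyadic_max s F (2 * N) (int N) x powr t) \<partial>lborel)"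
      using pw by (intro nn_integral_mono) (simp add: ennreal_mult[symmetric] ennreal_leI)
    also have "\<dots> = ennreal (c powr q) * (\<integral>\<^sup>+x. ennreal (dyadic_max s F (2 * N) (int N) x powr t) \<partial>lborel)"
      by (simp add: nn_integral_cmult)
    also have "\<dots> \<le> ennreal (c powr q) * ennreal (A * (LINT x|lborel. F x powr t))"
      unfolding A_def by (intro mult_left_mono dyadic_max_bound t F0 intF) auto
    also have "\<dots> \<le> ennreal (c powr q) * ennreal (A * 1)"
      using fp A by (intro mult_left_mono ennreal_leI) (auto simp: Ft)
    also have "\<dots> = ennreal (c powr q * A)" using A by (simp add: ennreal_mult)
    finally show "(\<integral>\<^sup>+x. ennreal (dyadic_frac s \<alpha> u N f x powr q) \<partial>lborel) \<le> ennreal (c powr q * A)" .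
  qed
qed

section \<open>Bilinear estimate and duality\<close>

text \<open>Admits Y = 0, which occurs when the mean of f^u over a cell vanishes.\<close>

lemma Holder_bound_nonneg:
  assumes "1 < r" "1 < s" "1 / r + 1 / s = 1"
    and [measurable]: "u \<in> borel_measurable M" "v \<in> borel_measurable M"
    and uv: "\<And>x. 0 \<le> u x" "\<And>x. 0 \<le> v x" and XY: "0 < X" "0 \<le> Y"
    and u: "(\<integral>\<^sup>+x. ennreal (u x powr r) \<partial>M) \<le> ennreal (X powr r)"
    and v: "(\<integral>\<^sup>+x. ennreal (v x powr s) \<partial>M) \<le> ennreal (Y powr s)"
  shows "(\<integral>\<^sup>+x. ennreal (u x * v x) \<partial>M) \<le> ennreal (X * Y)"
proof (cases "Y = 0")
  case True
  then have "(\<integral>\<^sup>+x. ennreal (v x powr s) \<partial>M) = 0" using v by simp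
  then have "AE x in M. ennreal (v x powr s) = 0" by (subst (asm) nn_integral_0_iff_AE) auto
  then have "AE x in M. ennreal (u x * v x) = 0" by eventually_elim (auto simp: ennreal_eq_0_iff)
  then have "(\<integral>\<^sup>+x. ennreal (u x * v x) \<partial>M) = 0" by (subst nn_integral_0_iff_AE) auto
  then show ?thesis by simp
next
  case False
  then show ?thesis using assms by (intro Holder_bound) auto
qed

text \<open>Hoelder's inequality on one cell with exponents u / (u - 1) and u. The powers h^(1 -
  1/u) and h^(1/u) of the side recombine to h, so the weight costs only the constant
  \<omega>.\<close>

lemma cell_weight_bound:
  assumes u: "1 < u" and [measurable]: "f \<in> borel_measurable borel" "w \<in> borel_measurable borel"
    and f0: "\<And>x. 0 \<le> f x" and w0: "\<And>x. 0 \<le> w x"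
    and fu: "loc_integrable (\<lambda>x. f x powr u)" and \<omega>: "0 < \<omega>"
    and w: "(\<integral>\<^sup>+x\<in>cell s k m. ennreal (w x powr (u / (u - 1))) \<partial>lborel) \<le> ennreal (\<omega> powr (u / (u - 1)) * side k)"
  shows "(\<integral>\<^sup>+x\<in>cell s k m. ennreal (w x * f x) \<partial>lborel)
    \<le> ennreal (\<omega> * side k * cell_avg s k (\<lambda>x. f x powr u) m powr (1 / u))"
proof -
  define r where "r = u / (u - 1)"
  have r: "1 < r" "1 / r + 1 / u = 1" using u by (auto simp: r_def field_simps)
  let ?a = "cell_avg s k (\<lambda>x. f x powr u) m" and ?I = "indicator (cell s k m) :: real \<Rightarrow> real"
  have a0: "0 \<le> ?a" by (intro cell_avg_nonneg) auto
  have "(\<integral>\<^sup>+x\<in>cell s k m. ennreal (w x * f x) \<partial>lborel) = (\<integral>\<^sup>+x. ennreal ((w x * ?I x) * (f x * ?I x)) \<partial>lborel)"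
    by (intro nn_integral_cong) (auto simp: indicator_def)
  also have "\<dots> \<le> ennreal ((\<omega> * side k powr (1 / r)) * (side k * ?a) powr (1 / u))"
  proof (rule Holder_bound_nonneg[of r u])
    have "(\<integral>\<^sup>+x. ennreal ((w x * ?I x) powr r) \<partial>lborel) = (\<integral>\<^sup>+x\<in>cell s k m. ennreal (w x powr r) \<partial>lborel)"
      by (intro nn_integral_cong) (auto simp: indicator_def)
    also have "\<dots> \<le> ennreal (\<omega> powr r * side k)" using w by (simp add: r_def)
    also have "\<omega> powr r * side k = (\<omega> * side k powr (1 / r)) powr r"
      using \<omega> r by (simp add: powr_mult powr_powr)
    finally show "(\<integral>\<^sup>+x. ennreal ((w x * ?I x) powr r) \<partial>lborel) \<le> ennreal ((\<omega> * side k powr (1 / r)) powr r)" .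
    have "(\<integral>\<^sup>+x. ennreal ((f x * ?I x) powr u) \<partial>lborel) = (\<integral>\<^sup>+x\<in>cell s k m. ennreal (f x powr u) \<partial>lborel)"
      by (intro nn_integral_cong) (auto simp: indicator_def)
    also have "\<dots> = ennreal (cell_int s k m (\<lambda>x. f x powr u))"
      by (intro nn_set_integral_eq_ennreal cell_set_integrable fu) auto
    also have "cell_int s k m (\<lambda>x. f x powr u) = ((side k * ?a) powr (1 / u)) powr u"
      using u a0 by (simp add: powr_powr) (simp add: cell_avg_def)
    finally show "(\<integral>\<^sup>+x. ennreal ((f x * ?I x) powr u) \<partial>lborel) \<le> ennreal (((side k * ?a) powr (1 / u)) powr u)"
      by simp
  qed (use r u \<omega> f0 w0 in auto)
  also have "(\<omega> * side k powr (1 / r)) * (side k * ?a) powr (1 / u) = \<omega> * (side k powr (1 / r + 1 / u)) * ?a powr (1 / u)"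
    using a0 by (simp add: powr_mult powr_add)
  also have "side k powr (1 / r + 1 / u) = side k" using r by simp
  finally show ?thesis .
qed

lemma loc_integrable_powr_smaller:
  assumes "0 < u" "u \<le> p" and [measurable]: "f \<in> borel_measurable borel" and "\<And>x. 0 \<le> f x"
    and "integrable lborel (\<lambda>x. f x powr p)"
  shows "loc_integrable (\<lambda>x. f x powr u)"
proof -
  have "(\<lambda>x. (f x powr u) powr (p / u)) = (\<lambda>x. f x powr p)" using assms by (simp add: powr_powr)
  then show ?thesis using assms
    by (intro loc_integrable_if_powr_integrable(1)[of "p / u"]) auto
qed

text \<open>The part with \<open>w m y\<close> is integrated in y first, the part with
  \<open>w m x\<close> in x first. Either way the inner integral pairs the weight with one function
  over one cell and becomes an L^u mean; the two parts differ only by exchanging f and g.\<close>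

lemma scale_bilinear_bound:
  fixes W :: "real \<Rightarrow> real \<Rightarrow> real" and w :: "int \<Rightarrow> real \<Rightarrow> real"
  assumes u: "1 < u"
    and [measurable]: "f \<in> borel_measurable borel" "g \<in> borel_measurable borel"
    and f0: "\<And>x. 0 \<le> f x" and g0: "\<And>x. 0 \<le> g x"
    and fu: "loc_integrable (\<lambda>x. f x powr u)" and gu: "loc_integrable (\<lambda>x. g x powr u)"
    and W: "\<And>m x y. x \<in> cell s k m \<Longrightarrow> y \<in> cell s k m \<Longrightarrow> W x y \<le> w m x + w m y"
    and w_meas [measurable]: "\<And>m. w m \<in> borel_measurable borel" and w0: "\<And>m x. 0 \<le> w m x" and \<omega>: "0 < \<omega>"
    and w: "\<And>m. (\<integral>\<^sup>+x\<in>cell s k m. ennreal (w m x powr (u / (u - 1))) \<partial>lborel) \<le> ennreal (\<omega> powr (u / (u - 1)) * side k)"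
  shows "(\<integral>\<^sup>+x. \<integral>\<^sup>+y. ennreal (side k powr (\<alpha> - 1) * of_bool (cell_index s k x = cell_index s k y) * W x y * f y * g x) \<partial>lborel \<partial>lborel)
    \<le> (\<integral>\<^sup>+x. ennreal (\<omega> * (g x * (side k powr \<alpha> * dyadic_avg s k (\<lambda>x. f x powr u) x powr (1 / u)))) \<partial>lborel)
    + (\<integral>\<^sup>+x. ennreal (\<omega> * (f x * (side k powr \<alpha> * dyadic_avg s k (\<lambda>x. g x powr u) x powr (1 / u)))) \<partial>lborel)"
proof -
  let ?i = "cell_index s k" and ?c = "side k powr (\<alpha> - 1)"
  \<comment> \<open>The weight depends on one point through its cell index. As there are countably
    many indices, it is jointly measurable.\<close>
  have [measurable]: "(\<lambda>z. w (?i (fst z)) (snd z)) \<in> borel_measurable (borel \<Otimes>\<^sub>M borel)"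
    "(\<lambda>z. w (?i (snd z)) (fst z)) \<in> borel_measurable (borel \<Otimes>\<^sub>M borel)"
    by (rule measurable_compose_countable[where g = "\<lambda>z. ?i (fst z)"]; measurable)
       (rule measurable_compose_countable[where g = "\<lambda>z. ?i (snd z)"]; measurable)
  define A where "A x y = ennreal (?c * g x) * (ennreal (w (?i x) y * f y) * indicator (cell s k (?i x)) y)" for x y
  define B where "B x y = ennreal (?c * f y) * (ennreal (w (?i y) x * g x) * indicator (cell s k (?i y)) x)" for x y
  have ind: "indicator (cell s k (?i x)) y = (of_bool (?i y = ?i x) :: ennreal)" for x y
    by (simp add: indicator_def mem_cell_iff)
  have Am [measurable]: "case_prod A \<in> borel_measurable (borel \<Otimes>\<^sub>M borel)"
    unfolding A_def ind split_beta' by measurable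
  have Bm [measurable]: "case_prod B \<in> borel_measurable (borel \<Otimes>\<^sub>M borel)"
    unfolding B_def ind split_beta' by measurable
  have half: "(\<integral>\<^sup>+y. ennreal (?c * g x) * (ennreal (w (?i x) y * f y) * indicator (cell s k (?i x)) y) \<partial>lborel)
     \<le> ennreal (\<omega> * (g x * (side k powr \<alpha> * dyadic_avg s k (\<lambda>x. f x powr u) x powr (1 / u))))"
    if [measurable]: "f \<in> borel_measurable borel" "g \<in> borel_measurable borel"
      and f0: "\<And>x. 0 \<le> f x" and g0: "\<And>x. 0 \<le> g x" and fu: "loc_integrable (\<lambda>x. f x powr u)" for f g x
  proof -
    have "(\<integral>\<^sup>+y. ennreal (?c * g x) * (ennreal (w (?i x) y * f y) * indicator (cell s k (?i x)) y) \<partial>lborel)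
      = ennreal (?c * g x) * (\<integral>\<^sup>+y\<in>cell s k (?i x). ennreal (w (?i x) y * f y) \<partial>lborel)"
      by (simp add: nn_integral_cmult)
    also have "\<dots> \<le> ennreal (?c * g x) * ennreal (\<omega> * side k * cell_avg s k (\<lambda>x. f x powr u) (?i x) powr (1 / u))"
      by (intro mult_left_mono cell_weight_bound u f0 fu \<omega> w w0) auto
    also have "\<dots> = ennreal (\<omega> * (g x * (?c * side k * dyadic_avg s k (\<lambda>x. f x powr u) x powr (1 / u))))"
      using g0 \<omega> by (simp add: ennreal_mult[symmetric] dyadic_avg_def mult_ac)
    also have "?c * side k = side k powr \<alpha>" by (simp add: powr_diff)
    finally show ?thesis .
  qed
  have "(\<integral>\<^sup>+x. \<integral>\<^sup>+y. ennreal (?c * of_bool (?i x = ?i y) * W x y * f y * g x) \<partial>lborel \<partial>lborel)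
     \<le> (\<integral>\<^sup>+x. \<integral>\<^sup>+y. A x y + B x y \<partial>lborel \<partial>lborel)"
  proof (intro nn_integral_mono)
    fix x y
    show "ennreal (?c * of_bool (?i x = ?i y) * W x y * f y * g x) \<le> A x y + B x y"
    proof (cases "?i x = ?i y")
      case True
      have "W x y \<le> w (?i x) x + w (?i x) y" using True by (intro W) (auto simp: mem_cell_iff)
      then have "?c * (f y * g x) * W x y \<le> ?c * (f y * g x) * (w (?i x) x + w (?i x) y)"
        using f0 g0 by (intro mult_left_mono) auto
      then have "?c * W x y * f y * g x \<le> ?c * g x * (w (?i x) y * f y) + ?c * f y * (w (?i x) x * g x)"
        by (simp add: algebra_simps)
      then have "ennreal (?c * W x y * f y * g x) \<le> ennreal (?c * g x * (w (?i x) y * f y)) + ennreal (?c * f y * (w (?i x) x * g x))"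
        using f0 g0 w0 by (simp add: ennreal_plus[symmetric] ennreal_leI del: ennreal_plus)
      then show ?thesis using True f0 g0 w0 by (simp add: A_def B_def ind ennreal_mult)
    qed simp
  qed
  also have "\<dots> = (\<integral>\<^sup>+x. (\<integral>\<^sup>+y. A x y \<partial>lborel) + (\<integral>\<^sup>+y. B x y \<partial>lborel) \<partial>lborel)"
    by (intro nn_integral_cong nn_integral_add) measurable
  also have "\<dots> = (\<integral>\<^sup>+x. \<integral>\<^sup>+y. A x y \<partial>lborel \<partial>lborel) + (\<integral>\<^sup>+x. \<integral>\<^sup>+y. B x y \<partial>lborel \<partial>lborel)"
    by (intro nn_integral_add) measurable
  also have "(\<integral>\<^sup>+x. \<integral>\<^sup>+y. B x y \<partial>lborel \<partial>lborel) = (\<integral>\<^sup>+y. \<integral>\<^sup>+x. B x y \<partial>lborel \<partial>lborel)"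
    by (rule lborel_pair.Fubini'[symmetric]) measurable
  also have "(\<integral>\<^sup>+x. \<integral>\<^sup>+y. A x y \<partial>lborel \<partial>lborel)
     \<le> (\<integral>\<^sup>+x. ennreal (\<omega> * (g x * (side k powr \<alpha> * dyadic_avg s k (\<lambda>x. f x powr u) x powr (1 / u)))) \<partial>lborel)"
    unfolding A_def by (intro nn_integral_mono half f0 g0 fu) auto
  also have "(\<integral>\<^sup>+y. \<integral>\<^sup>+x. B x y \<partial>lborel \<partial>lborel)
     \<le> (\<integral>\<^sup>+x. ennreal (\<omega> * (f x * (side k powr \<alpha> * dyadic_avg s k (\<lambda>x. g x powr u) x powr (1 / u)))) \<partial>lborel)"
    unfolding B_def by (intro nn_integral_mono half f0 g0 gu) auto
  finally show ?thesis by (simp add: add_mono)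
qed

text \<open>\<open>k\<close> is the least scale with \<open>3 * \<bar>x - y\<bar> < side k\<close>.
  The third-shift then supplies a common cell, and minimality gives
  \<open>side k \<le> 6 * \<bar>x - y\<bar>\<close>, the origin of the constant.\<close>

lemma kernel_cell_bound:
  fixes x y \<alpha> :: real
  assumes "x \<noteq> y" "\<alpha> < 1"
  obtains s k where "cell_index s k x = cell_index s k y"
    and "\<bar>x - y\<bar> powr (\<alpha> - 1) \<le> 6 powr (1 - \<alpha>) * side k powr (\<alpha> - 1)"
proof -
  define k where "k = \<lfloor>log 2 (3 * \<bar>x - y\<bar>)\<rfloor> + 1"
  have pos: "0 < 3 * \<bar>x - y\<bar>" using assms by simp
  have "real_of_int (k - 1) \<le> log 2 (3 * \<bar>x - y\<bar>)" "log 2 (3 * \<bar>x - y\<bar>) < real_of_int k"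
    unfolding k_def by (auto simp del: of_int_add) linarith
  then have "side (k - 1) \<le> 3 * \<bar>x - y\<bar>" "3 * \<bar>x - y\<bar> < side k"
    using pos unfolding side_def by (simp_all add: le_log_iff log_less_iff)
  then have k: "side k / 6 \<le> \<bar>x - y\<bar>" "\<bar>x - y\<bar> < side k / 3"
    using side_Suc[of "k - 1"] by auto
  obtain s where "cell_index s k x = cell_index s k y" using common_cell[OF k(2)] by blast
  moreover have "\<bar>x - y\<bar> powr (\<alpha> - 1) \<le> (side k / 6) powr (\<alpha> - 1)"
    using k(1) assms by (intro powr_mono2') auto
  moreover have "(side k / 6) powr (\<alpha> - 1) = 6 powr (1 - \<alpha>) * side k powr (\<alpha> - 1)"
    by (simp add: powr_divide powr_diff)
  ultimately show thesis using that by metis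
qed

text \<open>A crude substitute for Hoelder's inequality: both integrals on the right are bounded
  after normalisation, and any finite constant will do.\<close>

lemma nn_integral_mult_Young:
  assumes "1 < r" "1 < t" "1 / r + 1 / t = 1"
    and [measurable]: "g \<in> borel_measurable M" "U \<in> borel_measurable M"
    and "\<And>x. 0 \<le> g x" "\<And>x. 0 \<le> U x"
  shows "(\<integral>\<^sup>+x. ennreal (g x * U x) \<partial>M) \<le> (\<integral>\<^sup>+x. ennreal (g x powr r) \<partial>M) + (\<integral>\<^sup>+x. ennreal (U x powr t) \<partial>M)"
proof -
  have "(\<integral>\<^sup>+x. ennreal (g x * U x) \<partial>M) \<le> (\<integral>\<^sup>+x. ennreal (g x powr r) + ennreal (U x powr t) \<partial>M)"
  proof (intro nn_integral_mono)
    fix x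
    have "g x * U x \<le> g x powr r / r + U x powr t / t" using assms by (intro Youngs_inequality) auto
    also have "\<dots> \<le> g x powr r / 1 + U x powr t / 1"
      using assms by (intro add_mono divide_left_mono) auto
    finally show "ennreal (g x * U x) \<le> ennreal (g x powr r) + ennreal (U x powr t)"
      by (simp add: ennreal_plus[symmetric] ennreal_leI del: ennreal_plus)
  qed
  also have "\<dots> = (\<integral>\<^sup>+x. ennreal (g x powr r) \<partial>M) + (\<integral>\<^sup>+x. ennreal (U x powr t) \<partial>M)"
    by (intro nn_integral_add) auto
  finally show ?thesis .
qed

text \<open>The hypotheses on \<open>w\<close> abstract from \<open>w s k m x = \<bar>b x - b\<^sub>Q\<bar>\<close>, \<open>Q = cell s k m\<close>; the choice \<open>w = 1\<close>
  gives the Hardy--Littlewood--Sobolev inequality.\<close>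
definition osc_weight :: "real \<Rightarrow> real \<Rightarrow> (real \<Rightarrow> real \<Rightarrow> real) \<Rightarrow> (bool \<Rightarrow> int \<Rightarrow> int \<Rightarrow> real \<Rightarrow> real) \<Rightarrow> bool" where
  "osc_weight r \<omega> W w \<longleftrightarrow> 0 < \<omega> \<and> (\<forall>x y. 0 \<le> W x y) \<and> case_prod W \<in> borel_measurable (borel \<Otimes>\<^sub>M borel)
    \<and> (\<forall>s k m. w s k m \<in> borel_measurable borel \<and> (\<forall>x. 0 \<le> w s k m x)
      \<and> (\<forall>x\<in>cell s k m. \<forall>y\<in>cell s k m. W x y \<le> w s k m x + w s k m y)
      \<and> (\<integral>\<^sup>+x\<in>cell s k m. ennreal (w s k m x powr r) \<partial>lborel) \<le> ennreal (\<omega> powr r * side k))"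

text \<open>\<open>C\<close> is chosen before the weight and both functions, so the bound is linear
  in \<omega> and hence in the size of \<open>b\<close>. The kernel is dominated by a sum over both
  grids and all scales; truncated sums are estimated uniformly and increase to the full one.\<close>

lemma bilinear_bound:
  fixes p q \<alpha> u :: real
  assumes "1 < p" "p < q" "0 < \<alpha>" "\<alpha> < 1" "1 / q = 1 / p - \<alpha>" "1 < u" "u < p" "u < q / (q - 1)"
  obtains C where "0 \<le> C" and "\<And>W w \<omega> f g. osc_weight (u / (u - 1)) \<omega> W w \<Longrightarrow>
    f \<in> borel_measurable borel \<Longrightarrow> (\<And>x. 0 \<le> f x) \<Longrightarrow> integrable lborel (\<lambda>x. f x powr p) \<Longrightarrow>
    (LINT x|lborel. f x powr p) \<le> 1 \<Longrightarrow>
    g \<in> borel_measurable borel \<Longrightarrow> (\<And>x. 0 \<le> g x) \<Longrightarrow> integrable lborel (\<lambda>x. g x powr (q / (q - 1))) \<Longrightarrow>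
    (LINT x|lborel. g x powr (q / (q - 1))) \<le> 1 \<Longrightarrow>
    (\<integral>\<^sup>+x. \<integral>\<^sup>+y. ennreal (W x y * \<bar>x - y\<bar> powr (\<alpha> - 1) * f y * g x) \<partial>lborel \<partial>lborel) \<le> ennreal (C * \<omega>)"
proof -
  define q' p' where "q' = q / (q - 1)" and "p' = p / (p - 1)"
  have q': "1 < q'" "1 / q' + 1 / q = 1" "1 < q" using assms by (auto simp: q'_def field_simps)
  have p': "1 < p'" "1 / p + 1 / p' = 1" using assms by (auto simp: p'_def field_simps)
  \<comment> \<open>The adjoint form maps L^q' to L^p' with the same order \<alpha>, so the
    potential estimate applies to g as it does to f, with u < q' in place of u < p.\<close>
  have dual: "1 / p' = 1 / q' - \<alpha>" using assms(5) q'(2) p'(2) by linarith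
  obtain C1 where C1: "0 \<le> C1" "\<And>s N f. f \<in> borel_measurable borel \<Longrightarrow> (\<And>x. 0 \<le> f x) \<Longrightarrow>
    integrable lborel (\<lambda>x. f x powr p) \<Longrightarrow> (LINT x|lborel. f x powr p) \<le> 1 \<Longrightarrow>
    (\<integral>\<^sup>+x. ennreal (dyadic_frac s \<alpha> u N f x powr q) \<partial>lborel) \<le> ennreal C1"
    by (rule dyadic_frac_bound[of u p \<alpha> q]) (use assms in auto)
  obtain C2 where C2: "0 \<le> C2" "\<And>s N f. f \<in> borel_measurable borel \<Longrightarrow> (\<And>x. 0 \<le> f x) \<Longrightarrow>
    integrable lborel (\<lambda>x. f x powr q') \<Longrightarrow> (LINT x|lborel. f x powr q') \<le> 1 \<Longrightarrow>
    (\<integral>\<^sup>+x. ennreal (dyadic_frac s \<alpha> u N f x powr p') \<partial>lborel) \<le> ennreal C2"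
    by (rule dyadic_frac_bound[of u q' \<alpha> p']) (use assms dual q' p' in \<open>auto simp: q'_def[symmetric]\<close>)
  \<comment> \<open>The two 1s bound the powers of g and f in Young's inequality, \<open>C1\<close>
    and \<open>C2\<close> those of their potentials. The factor 2 in \<open>2 * C\<close> counts the
    grids.\<close>
  define C where "C = (1 + C1) + (1 + C2)"
  have C: "0 \<le> C" using C1 C2 by (simp add: C_def)
  show thesis
  proof (rule that)
    show "0 \<le> 6 powr (1 - \<alpha>) * (2 * C)" using C by simp
    fix W w \<omega> and f g :: "real \<Rightarrow> real"
    assume osc: "osc_weight (u / (u - 1)) \<omega> W w"
      and fm [measurable]: "f \<in> borel_measurable borel" and f0: "\<And>x. 0 \<le> f x"
      and fp: "integrable lborel (\<lambda>x. f x powr p)" "(LINT x|lborel. f x powr p) \<le> 1"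
      and gm [measurable]: "g \<in> borel_measurable borel" and g0: "\<And>x. 0 \<le> g x"
      and gq: "integrable lborel (\<lambda>x. g x powr (q / (q - 1)))" "(LINT x|lborel. g x powr (q / (q - 1))) \<le> 1"
    have \<omega>: "0 < \<omega>" and W0: "\<And>x y. 0 \<le> W x y"
      and Wm [measurable]: "case_prod W \<in> borel_measurable (borel \<Otimes>\<^sub>M borel)"
      using osc by (auto simp: osc_weight_def)
    have Wm' [measurable]: "(\<lambda>z. W (fst z) (snd z)) \<in> borel_measurable (borel \<Otimes>\<^sub>M borel)"
      using Wm by (simp add: split_beta')
    note gq = gq[folded q'_def]
    have fu: "loc_integrable (\<lambda>x. f x powr u)"
      using assms fp f0 by (intro loc_integrable_powr_smaller[of u p]) auto
    have gu: "loc_integrable (\<lambda>x. g x powr u)"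
      using assms gq g0 by (intro loc_integrable_powr_smaller[of u q']) (auto simp: q'_def)
    have nf: "(\<integral>\<^sup>+x. ennreal (f x powr p) \<partial>lborel) \<le> ennreal 1"
      by (subst nn_integral_eq_integral) (use fp in \<open>auto intro: ennreal_leI\<close>)
    have ng: "(\<integral>\<^sup>+x. ennreal (g x powr q') \<partial>lborel) \<le> ennreal 1"
      by (subst nn_integral_eq_integral) (use gq in \<open>auto intro: ennreal_leI\<close>)
    let ?a = "\<lambda>s k f x. side k powr \<alpha> * dyadic_avg s k (\<lambda>x. f x powr u) x powr (1 / u)"
    define d where "d s k x y = ennreal (side k powr (\<alpha> - 1) * of_bool (cell_index s k x = cell_index s k y) * W x y * f y * g x)"
      for s k x y
    have dm [measurable]: "(\<lambda>z. d s k (fst z) (snd z)) \<in> borel_measurable (borel \<Otimes>\<^sub>M borel)" for s k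
      unfolding d_def by measurable
    have dm2 [measurable]: "d s k x \<in> borel_measurable borel" for s k x
      unfolding d_def using measurable_Pair2[OF Wm, of x] by measurable
    have dm3 [measurable]: "(\<lambda>x. \<integral>\<^sup>+y. d s k x y \<partial>lborel) \<in> borel_measurable borel" for s k
      using lborel.borel_measurable_nn_integral_fst[of "\<lambda>z. d s k (fst z) (snd z)" borel] by simp
    have dk: "(\<integral>\<^sup>+x. \<integral>\<^sup>+y. d s k x y \<partial>lborel \<partial>lborel)
      \<le> (\<integral>\<^sup>+x. ennreal (\<omega> * (g x * ?a s k f x)) \<partial>lborel) + (\<integral>\<^sup>+x. ennreal (\<omega> * (f x * ?a s k g x)) \<partial>lborel)" for s k
      unfolding d_def using osc f0 g0 fu gu assms
      by (intro scale_bilinear_bound[where w = "w s k"]) (auto simp: osc_weight_def)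
    define D where "D N x y = (\<Sum>s\<in>UNIV. \<Sum>k\<in>{- int N..int N}. d s k x y)" for N x y
    have sumU: "(\<Sum>k\<in>{- int N..int N}. \<integral>\<^sup>+x. ennreal (\<omega> * (g x * ?a s k f x)) \<partial>lborel)
        = ennreal \<omega> * (\<integral>\<^sup>+x. ennreal (g x * dyadic_frac s \<alpha> u N f x) \<partial>lborel)"
      if [measurable]: "f \<in> borel_measurable borel" "g \<in> borel_measurable borel" and g0: "\<And>x. 0 \<le> g x" for f g s N
    proof -
      have "(\<Sum>k\<in>{- int N..int N}. \<integral>\<^sup>+x. ennreal (\<omega> * (g x * ?a s k f x)) \<partial>lborel)
        = (\<integral>\<^sup>+x. (\<Sum>k\<in>{- int N..int N}. ennreal (\<omega> * (g x * ?a s k f x))) \<partial>lborel)"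
        by (intro nn_integral_sum[symmetric]) measurable
      also have "\<dots> = (\<integral>\<^sup>+x. ennreal \<omega> * ennreal (g x * dyadic_frac s \<alpha> u N f x) \<partial>lborel)"
      proof (intro nn_integral_cong)
        fix x
        have "(\<Sum>k\<in>{- int N..int N}. ennreal (\<omega> * (g x * ?a s k f x))) = ennreal (\<Sum>k\<in>{- int N..int N}. \<omega> * (g x * ?a s k f x))"
          using \<omega> g0 by (intro sum_ennreal) auto
        also have "(\<Sum>k\<in>{- int N..int N}. \<omega> * (g x * ?a s k f x)) = \<omega> * (g x * dyadic_frac s \<alpha> u N f x)"
          by (simp add: dyadic_frac_def sum_distrib_left)
        finally show "(\<Sum>k\<in>{- int N..int N}. ennreal (\<omega> * (g x * ?a s k f x))) = ennreal \<omega> * ennreal (g x * dyadic_frac s \<alpha> u N f x)"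
          using \<omega> g0 dyadic_frac_nonneg by (simp add: ennreal_mult)
      qed
      finally show ?thesis by (simp add: nn_integral_cmult)
    qed
    have DN: "(\<integral>\<^sup>+x. \<integral>\<^sup>+y. D N x y \<partial>lborel \<partial>lborel) \<le> ennreal (2 * C * \<omega>)" for N
    proof -
      have "(\<integral>\<^sup>+x. \<integral>\<^sup>+y. D N x y \<partial>lborel \<partial>lborel)
         = (\<Sum>s\<in>UNIV. \<Sum>k\<in>{- int N..int N}. (\<integral>\<^sup>+x. \<integral>\<^sup>+y. d s k x y \<partial>lborel \<partial>lborel))"
        unfolding D_def by (subst nn_integral_sum, simp)+ (simp add: nn_integral_sum)
      also have "\<dots> \<le> (\<Sum>s\<in>(UNIV :: bool set). \<Sum>k\<in>{- int N..int N}.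
          (\<integral>\<^sup>+x. ennreal (\<omega> * (g x * ?a s k f x)) \<partial>lborel) + (\<integral>\<^sup>+x. ennreal (\<omega> * (f x * ?a s k g x)) \<partial>lborel))"
        by (intro sum_mono dk)
      also have "\<dots> = (\<Sum>s\<in>(UNIV :: bool set). ennreal \<omega> * ((\<integral>\<^sup>+x. ennreal (g x * dyadic_frac s \<alpha> u N f x) \<partial>lborel)
          + (\<integral>\<^sup>+x. ennreal (f x * dyadic_frac s \<alpha> u N g x) \<partial>lborel)))"
        by (simp only: sum.distrib sumU[OF fm gm g0] sumU[OF gm fm f0] distrib_left)
      also have "\<dots> \<le> (\<Sum>s\<in>(UNIV :: bool set). ennreal \<omega> * ((ennreal 1 + ennreal C1) + (ennreal 1 + ennreal C2)))"
      proof (intro sum_mono mult_left_mono add_mono)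
        fix s
        have "(\<integral>\<^sup>+x. ennreal (g x * dyadic_frac s \<alpha> u N f x) \<partial>lborel)
          \<le> (\<integral>\<^sup>+x. ennreal (g x powr q') \<partial>lborel) + (\<integral>\<^sup>+x. ennreal (dyadic_frac s \<alpha> u N f x powr q) \<partial>lborel)"
          using q' g0 dyadic_frac_nonneg by (intro nn_integral_mult_Young) auto
        also have "\<dots> \<le> ennreal 1 + ennreal C1" by (intro add_mono ng C1(2) fp f0) auto
        finally show "(\<integral>\<^sup>+x. ennreal (g x * dyadic_frac s \<alpha> u N f x) \<partial>lborel) \<le> ennreal 1 + ennreal C1" .
        have "(\<integral>\<^sup>+x. ennreal (f x * dyadic_frac s \<alpha> u N g x) \<partial>lborel)
          \<le> (\<integral>\<^sup>+x. ennreal (f x powr p) \<partial>lborel) + (\<integral>\<^sup>+x. ennreal (dyadic_frac s \<alpha> u N g x powr p') \<partial>lborel)"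
          using p' assms f0 dyadic_frac_nonneg by (intro nn_integral_mult_Young) auto
        also have "\<dots> \<le> ennreal 1 + ennreal C2" by (intro add_mono nf C2(2) gq g0) auto
        finally show "(\<integral>\<^sup>+x. ennreal (f x * dyadic_frac s \<alpha> u N g x) \<partial>lborel) \<le> ennreal 1 + ennreal C2" .
      qed auto
      also have "\<dots> = (\<Sum>s\<in>(UNIV :: bool set). ennreal (C * \<omega>))"
        using C1(1) C2(1) \<omega> C by (simp add: C_def mult.commute flip: ennreal_plus ennreal_mult ennreal_1)
      also have "\<dots> = ennreal (2 * C * \<omega>)"
        using C \<omega> ennreal_mult[of 2 "C * \<omega>"] by (simp add: mult.assoc)
      finally show ?thesis .
    qed
    have inc: "D N x y \<le> D N' x y" if "N \<le> N'" for N N' x y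
      unfolding D_def using that by (intro sum_mono sum_mono2) auto
    have Dm [measurable]: "D N x \<in> borel_measurable borel" for N x unfolding D_def by measurable
    have Dm2 [measurable]: "(\<lambda>x. \<integral>\<^sup>+y. D N x y \<partial>lborel) \<in> borel_measurable borel" for N
      unfolding D_def by (simp add: nn_integral_sum)
    have K: "ennreal (W x y * \<bar>x - y\<bar> powr (\<alpha> - 1) * f y * g x) \<le> ennreal (6 powr (1 - \<alpha>)) * (SUP N. D N x y)" for x y
    \<comment> \<open>On the diagonal the left-hand side is 0, because
      \<open>0 powr (\<alpha> - 1)\<close> is 0.\<close>
    proof (cases "x = y")
      case False
      obtain s k where sk: "cell_index s k x = cell_index s k y"
        "\<bar>x - y\<bar> powr (\<alpha> - 1) \<le> 6 powr (1 - \<alpha>) * side k powr (\<alpha> - 1)"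
        using kernel_cell_bound[OF False \<open>\<alpha> < 1\<close>] by blast
      have "(W x y * f y * g x) * \<bar>x - y\<bar> powr (\<alpha> - 1) \<le> (W x y * f y * g x) * (6 powr (1 - \<alpha>) * side k powr (\<alpha> - 1))"
        using W0 f0 g0 sk(2) by (intro mult_left_mono) auto
      then have "ennreal (W x y * \<bar>x - y\<bar> powr (\<alpha> - 1) * f y * g x)
        \<le> ennreal (6 powr (1 - \<alpha>) * (side k powr (\<alpha> - 1) * of_bool (cell_index s k x = cell_index s k y) * W x y * f y * g x))"
        by (intro ennreal_leI) (simp add: sk(1) mult_ac)
      also have "\<dots> = ennreal (6 powr (1 - \<alpha>)) * d s k x y"
        using W0 f0 g0 by (subst ennreal_mult) (auto simp: d_def)
      also have "d s k x y \<le> D (nat \<bar>k\<bar>) x y"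
      proof -
        have "d s k x y \<le> (\<Sum>k\<in>{- int (nat \<bar>k\<bar>)..int (nat \<bar>k\<bar>)}. d s k x y)"
          by (intro member_le_sum) auto
        also have "\<dots> \<le> D (nat \<bar>k\<bar>) x y" unfolding D_def
          by (intro member_le_sum[of s UNIV "\<lambda>s. \<Sum>k\<in>{- int (nat \<bar>k\<bar>)..int (nat \<bar>k\<bar>)}. d s k x y"]) auto
        finally show ?thesis .
      qed
      also have "D (nat \<bar>k\<bar>) x y \<le> (SUP N. D N x y)" by (intro SUP_upper) auto
      finally show ?thesis by (simp add: mult_left_mono)
    qed simp
    have "(\<integral>\<^sup>+x. \<integral>\<^sup>+y. ennreal (W x y * \<bar>x - y\<bar> powr (\<alpha> - 1) * f y * g x) \<partial>lborel \<partial>lborel)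
      \<le> (\<integral>\<^sup>+x. \<integral>\<^sup>+y. ennreal (6 powr (1 - \<alpha>)) * (SUP N. D N x y) \<partial>lborel \<partial>lborel)"
      by (intro nn_integral_mono K)
    also have "\<dots> = (\<integral>\<^sup>+x. ennreal (6 powr (1 - \<alpha>)) * (SUP N. \<integral>\<^sup>+y. D N x y \<partial>lborel) \<partial>lborel)"
      by (intro nn_integral_cong, subst nn_integral_cmult, simp,
          subst nn_integral_monotone_convergence_SUP) (auto simp: incseq_def le_fun_def inc)
    also have "\<dots> = ennreal (6 powr (1 - \<alpha>)) * (SUP N. \<integral>\<^sup>+x. \<integral>\<^sup>+y. D N x y \<partial>lborel \<partial>lborel)"
      by (subst nn_integral_cmult, simp, subst nn_integral_monotone_convergence_SUP)
         (auto simp: incseq_def le_fun_def intro!: nn_integral_mono inc)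
    also have "\<dots> \<le> ennreal (6 powr (1 - \<alpha>)) * ennreal (2 * C * \<omega>)"
      by (intro mult_left_mono SUP_least DN) auto
    also have "\<dots> = ennreal (6 powr (1 - \<alpha>) * (2 * C) * \<omega>)"
      using C \<omega> by (simp add: mult_ac flip: ennreal_mult)
    finally show "(\<integral>\<^sup>+x. \<integral>\<^sup>+y. ennreal (W x y * \<bar>x - y\<bar> powr (\<alpha> - 1) * f y * g x) \<partial>lborel \<partial>lborel)
      \<le> ennreal (6 powr (1 - \<alpha>) * (2 * C) * \<omega>)" .
  qed
qed

text \<open>\<open>h\<close> is an integral not yet known to be finite, so it takes values in
  \<open>ennreal\<close>. Each truncation is bounded with bounded support, so its norm is finite
  before it is estimated by its extremal test function. Finiteness almost everywhere is a separate
  conclusion, since \<open>enn2real\<close> sends infinity to 0 and would hide a divergence.\<close>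

lemma Lq_bound_by_duality:
  fixes h :: "real \<Rightarrow> ennreal" and q C :: real
  assumes q: "1 < q" and C: "0 \<le> C" and [measurable]: "h \<in> borel_measurable borel"
    and dual: "\<And>g. g \<in> borel_measurable borel \<Longrightarrow> (\<And>x. 0 \<le> g x) \<Longrightarrow> integrable lborel (\<lambda>x. g x powr (q / (q - 1))) \<Longrightarrow>
      (LINT x|lborel. g x powr (q / (q - 1))) \<le> 1 \<Longrightarrow> (\<integral>\<^sup>+x. h x * ennreal (g x) \<partial>lborel) \<le> ennreal C"
  shows "AE x in lborel. h x < \<infinity>"
    and "(\<integral>\<^sup>+x. ennreal (enn2real (h x) powr q) \<partial>lborel) \<le> ennreal (C powr q)"
proof -
  define q' where "q' = q / (q - 1)"
  have q': "1 < q'" "(q - 1) * q' = q" "1 / q' = 1 - 1 / q" using q by (auto simp: q'_def field_simps)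
  define H where "H n x = enn2real (min (h x) (ennreal (real n))) * indicator {- real n..real n} x" for n x
  have [measurable]: "H n \<in> borel_measurable borel" for n unfolding H_def by measurable
  have H0: "0 \<le> H n x" for n x by (simp add: H_def)
  have min_fin: "min (h x) (ennreal (real n)) < \<infinity>" for n x by (simp add: min_less_iff_disj)
  have Hh: "ennreal (H n x) \<le> h x" for n x
    unfolding H_def using min_fin[of x n]
    by (auto simp: indicator_def ennreal_enn2real)
  have Hn: "H n x \<le> real n * indicator {- real n..real n} x" for n x
  proof -
    have "enn2real (min (h x) (ennreal (real n))) \<le> enn2real (ennreal (real n))"
      by (intro enn2real_mono) auto
    then show ?thesis by (auto simp: H_def indicator_def)
  qed
  have int: "integrable lborel (\<lambda>x. H n x powr q)" for n
  proof (rule Bochner_Integration.integrable_bound[where f = "\<lambda>x. real n powr q * indicator {- real n..real n} x"])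
    show "integrable lborel (\<lambda>x. real n powr q * indicator {- real n..real n} x)" by simp
    show "AE x in lborel. norm (H n x powr q) \<le> norm (real n powr q * indicator {- real n..real n} x)"
    proof (rule AE_I2)
      fix x
      have "H n x powr q \<le> (real n * indicator {- real n..real n} x) powr q"
        using Hn H0 q by (intro powr_mono2) auto
      then show "norm (H n x powr q) \<le> norm (real n powr q * indicator {- real n..real n} x)"
        by (cases "x \<in> {- real n..real n}") (simp_all del: atLeastAtMost_iff)
    qed
  qed auto
  define Z where "Z n = (LINT x|lborel. H n x powr q)" for n
  have nnZ: "(\<integral>\<^sup>+x. ennreal (H n x powr q) \<partial>lborel) = ennreal (Z n)" for n
    unfolding Z_def by (intro nn_integral_eq_integral int) auto
  have Z: "Z n \<le> C powr q" for n
  proof (cases "Z n \<le> 0")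
    case True then show ?thesis by (rule order.trans) simp
  next
    case False
    then have Z0: "0 < Z n" by simp
    \<comment> \<open>The extremal function of Hoelder's inequality, normalised in L^q' by means of
      (q - 1) q' = q.\<close>
    define g where "g x = H n x powr (q - 1) / Z n powr (1 / q')" for x
    have g: "g x powr q' = H n x powr q / Z n" for x
      using Z0 q'(1,2) q by (simp add: g_def powr_divide powr_powr)
    have "(\<integral>\<^sup>+x. h x * ennreal (g x) \<partial>lborel) \<le> ennreal C"
    proof (rule dual)
      show "g \<in> borel_measurable borel" unfolding g_def by measurable
      show "0 \<le> g x" for x by (simp add: g_def)
      show "integrable lborel (\<lambda>x. g x powr (q / (q - 1)))"
        unfolding q'_def[symmetric] g using int by simp
      show "(LINT x|lborel. g x powr (q / (q - 1))) \<le> 1"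
        unfolding q'_def[symmetric] g using Z0 by (simp add: Z_def[symmetric])
    qed
    moreover have "ennreal (Z n powr (1 / q)) \<le> (\<integral>\<^sup>+x. h x * ennreal (g x) \<partial>lborel)"
    proof -
      have "Z n powr (1 / q) = Z n powr (- (1 / q')) * Z n" using Z0 by (simp add: q'(3) powr_diff powr_minus field_simps)
      then have "ennreal (Z n powr (1 / q)) = ennreal (Z n powr (- (1 / q'))) * (\<integral>\<^sup>+x. ennreal (H n x powr q) \<partial>lborel)"
        using Z0 by (simp add: nnZ ennreal_mult)
      also have "\<dots> = (\<integral>\<^sup>+x. ennreal (Z n powr (- (1 / q'))) * ennreal (H n x powr q) \<partial>lborel)"
        by (simp add: nn_integral_cmult)
      also have "\<dots> = (\<integral>\<^sup>+x. ennreal (H n x) * ennreal (g x) \<partial>lborel)"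
      proof (intro nn_integral_cong)
        fix x
        have "Z n powr (- (1 / q')) * H n x powr q = H n x * g x"
          using H0[of n x] by (cases "H n x = 0") (simp_all add: g_def powr_diff powr_minus divide_inverse)
        then show "ennreal (Z n powr (- (1 / q'))) * ennreal (H n x powr q) = ennreal (H n x) * ennreal (g x)"
          using H0 by (simp flip: ennreal_mult add: g_def)
      qed
      also have "\<dots> \<le> (\<integral>\<^sup>+x. h x * ennreal (g x) \<partial>lborel)"
        by (intro nn_integral_mono mult_right_mono Hh) auto
      finally show ?thesis .
    qed
    ultimately have "Z n powr (1 / q) \<le> C" using C by (metis ennreal_le_iff order.trans)
    then have "(Z n powr (1 / q)) powr q \<le> C powr q" using q by (intro powr_mono2) auto
    then show ?thesis using Z0 q by (simp add: powr_powr)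
  qed
  have mono: "H n x \<le> H m x" if "n \<le> m" for n m x
  proof -
    have "enn2real (min (h x) (ennreal (real n))) \<le> enn2real (min (h x) (ennreal (real m)))"
      using that min_fin by (intro enn2real_mono min.mono ennreal_leI) auto
    then show ?thesis using that unfolding H_def by (auto simp: indicator_def)
  qed
  let ?S = "\<lambda>x. SUP n. ennreal (H n x powr q)"
  have "(\<integral>\<^sup>+x. ?S x \<partial>lborel) = (SUP n. \<integral>\<^sup>+x. ennreal (H n x powr q) \<partial>lborel)"
    using q by (intro nn_integral_monotone_convergence_SUP)
      (auto simp: incseq_def le_fun_def intro!: ennreal_leI powr_mono2 mono H0)
  also have "\<dots> \<le> ennreal (C powr q)" using Z by (intro SUP_least) (simp add: nnZ ennreal_leI)
  finally have S: "(\<integral>\<^sup>+x. ?S x \<partial>lborel) \<le> ennreal (C powr q)" .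
  have "AE x in lborel. ?S x \<noteq> \<infinity>"
    using S by (intro nn_integral_PInf_AE) (auto simp: top_unique)
  \<comment> \<open>Where \<open>h\<close> is infinite, the truncation equals n as soon as its
    window contains x. The finite integral of the supremum thus confines such points to a null
    set.\<close>
  moreover have top: "?S x = \<infinity>" if "h x = \<infinity>" for x
    unfolding infinity_ennreal_def
  proof (rule ennreal_SUP_eq_top)
    fix m :: nat
    define n where "n = Suc m + nat \<lceil>\<bar>x\<bar>\<rceil>"
    have n: "\<bar>x\<bar> \<le> real n" "real m \<le> real n" "1 \<le> real n" unfolding n_def by linarith+
    then have "H n x = real n" using that by (simp add: H_def indicator_def min_absorb2 abs_le_iff)
    moreover have "real n powr 1 \<le> real n powr q" using n q by (intro powr_mono) auto
    ultimately have "real m \<le> H n x powr q" using n by simp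
    then show "\<exists>i\<in>UNIV. of_nat m \<le> ennreal (H i x powr q)"
      by (intro bexI[of _ n]) (auto simp: ennreal_of_nat_eq_real_of_nat ennreal_leI)
  qed
  ultimately show fin: "AE x in lborel. h x < \<infinity>"
    by (auto simp: less_top[symmetric] elim!: eventually_mono)
  have "(\<integral>\<^sup>+x. ennreal (enn2real (h x) powr q) \<partial>lborel) \<le> (\<integral>\<^sup>+x. ?S x \<partial>lborel)"
  proof (intro nn_integral_mono_AE)
    show "AE x in lborel. ennreal (enn2real (h x) powr q) \<le> ?S x"
      using fin
    proof eventually_elim
      case (elim x)
      then obtain v where v: "h x = ennreal v" "0 \<le> v" by (cases "h x") auto
      define n where "n = nat \<lceil>v\<rceil> + nat \<lceil>\<bar>x\<bar>\<rceil>"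
      have n: "\<bar>x\<bar> \<le> real n" "v \<le> real n" unfolding n_def by linarith+
      then have "H n x = v" using v by (simp add: H_def indicator_def min_absorb1 ennreal_leI abs_le_iff)
      then have "ennreal (enn2real (h x) powr q) = ennreal (H n x powr q)" using v by simp
      also have "\<dots> \<le> ?S x" by (intro SUP_upper) auto
      finally show ?case .
    qed
  qed
  with S show "(\<integral>\<^sup>+x. ennreal (enn2real (h x) powr q) \<partial>lborel) \<le> ennreal (C powr q)" by simp
qed

section \<open>Boundedness of the commutator\<close>

abbreviation osc_le :: "(real \<Rightarrow> real) \<Rightarrow> real \<Rightarrow> bool" where
  "osc_le b B \<equiv> \<forall>u v. u < v \<longrightarrow> mean_osc b u v \<le> B"

abbreviation powr_integral :: "real \<Rightarrow> (real \<Rightarrow> real) \<Rightarrow> real" where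
  "powr_integral p f \<equiv> LINT x|lborel. \<bar>f x\<bar> powr p"

abbreviation powr_nn_integral :: "real \<Rightarrow> (real \<Rightarrow> real) \<Rightarrow> ennreal" where
  "powr_nn_integral q f \<equiv> \<integral>\<^sup>+x. ennreal (\<bar>f x\<bar> powr q) \<partial>lborel"

text \<open>A Riesz potential with an additional weight. It is two-sided, unlike the operator that
  it dominates, and \<open>ennreal\<close>-valued so that it makes sense before convergence is
  known.\<close>

abbreviation abs_frac :: "(real \<Rightarrow> real \<Rightarrow> real) \<Rightarrow> real \<Rightarrow> (real \<Rightarrow> real) \<Rightarrow> real \<Rightarrow> ennreal" where
  "abs_frac W \<alpha> f x \<equiv> \<integral>\<^sup>+y. ennreal (W x y * \<bar>x - y\<bar> powr (\<alpha> - 1) * \<bar>f y\<bar>) \<partial>lborel"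

abbreviation frac_integrable :: "real \<Rightarrow> (real \<Rightarrow> real) \<Rightarrow> real \<Rightarrow> bool" where
  "frac_integrable \<alpha> f x \<equiv> set_integrable lborel {x<..} (\<lambda>y. f y / (y - x) powr (1 - \<alpha>))"

lemma in_BMO_loc_integrable: "in_BMO b \<Longrightarrow> loc_integrable b"
  by (auto simp: in_BMO_def loc_integrable_def)

text \<open>A half-open cell and its closure differ by one point, so oscillation over closed
  intervals controls oscillation over cells.\<close>

lemma mean_osc_cell:
  assumes b: "loc_integrable b" and osc: "osc_le b B"
  shows "cell_int s k m (\<lambda>x. \<bar>b x - cell_avg s k b m\<bar>) \<le> B * side k"
proof -
  define l r where "l = offset s k + side k * m" and "r = offset s k + side k * (m + 1)"
  have lr: "r - l = side k" "l < r" using side_pos[of k] by (auto simp: l_def r_def algebra_simps)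
  have I: "cell_int s k m g = (LINT x:{l..r}|lborel. g x)" if "loc_integrable g" for g
    using integral_cell[OF that, of s k m] loc_integrable_HK(2)[OF that, of l r] by (simp add: l_def r_def)
  have "cell_avg s k b m = avg b l r" by (simp add: cell_avg_def I[OF b] avg_def lr)
  moreover have "mean_osc b l r \<le> B" using lr osc by blast
  ultimately show ?thesis
    unfolding I[OF loc_integrable_abs_diff[OF b]] mean_osc_def lr by (simp add: field_simps)
qed

lemma JN_const_pos: "0 < JN_const r"
  unfolding JN_const_def by (intro add_pos_pos mult_pos_pos) auto

lemma BMO_osc_weight:
  assumes b: "loc_integrable b" and B: "0 < B" and r: "1 \<le> r" and osc: "osc_le b B"
  shows "osc_weight r (JN_const r powr (1 / r) * B) (\<lambda>x y. \<bar>b x - b y\<bar>) (\<lambda>s k m x. \<bar>b x - cell_avg s k b m\<bar>)"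
proof -
  have [measurable]: "b \<in> borel_measurable borel" using b by (simp add: loc_integrable_def)
  have eq: "(JN_const r powr (1 / r) * B) powr r = JN_const r * B powr r"
    using r B JN_const_pos[of r] by (simp add: powr_mult powr_powr)
  show ?thesis
    unfolding osc_weight_def eq
    using B JN_const_pos[of r] John_Nirenberg[OF r B b mean_osc_cell[OF b osc]] by (auto simp: split_beta')
qed

lemma one_osc_weight: "osc_weight r 1 (\<lambda>x y. 1) (\<lambda>s k m x. 1)"
  by (auto simp: osc_weight_def)

lemma frac_int_plus_measurable [measurable]:
  assumes [measurable]: "f \<in> borel_measurable borel"
  shows "frac_int_plus \<alpha> f \<in> borel_measurable borel"
proof -
  \<comment> \<open>The moving half-line becomes the factor \<open>of_bool (x < y)\<close>, which
    leaves a parameter integral over a fixed space with a jointly measurable integrand.\<close>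
  have "(\<lambda>x. LINT y|lborel. of_bool (x < y) *\<^sub>R (f y / (y - x) powr (1 - \<alpha>))) \<in> borel_measurable borel"
    by (rule lborel.borel_measurable_lebesgue_integral) measurable
  moreover have "frac_int_plus \<alpha> f = (\<lambda>x. LINT y|lborel. of_bool (x < y) *\<^sub>R (f y / (y - x) powr (1 - \<alpha>)))"
    by (simp add: fun_eq_iff frac_int_plus_def set_lebesgue_integral_def indicator_def)
  ultimately show ?thesis by simp
qed

lemma commutator_measurable:
  assumes [measurable]: "f \<in> borel_measurable borel" "b \<in> borel_measurable borel"
  shows "commutator b \<alpha> f \<in> borel_measurable borel"
  unfolding commutator_def by measurable

lemma weighted_frac_bound:
  fixes p q \<alpha> u :: real
  assumes "1 < p" "p < q" "0 < \<alpha>" "\<alpha> < 1" "1 / q = 1 / p - \<alpha>" "1 < u" "u < p" "u < q / (q - 1)"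
  obtains C where "0 \<le> C"
    and "\<And>W w \<omega> f. osc_weight (u / (u - 1)) \<omega> W w \<Longrightarrow> in_Lp p f \<Longrightarrow> powr_integral p f \<le> 1 \<Longrightarrow>
      AE x in lborel. (abs_frac W \<alpha> f x) < \<infinity>"
    and "\<And>W w \<omega> f. osc_weight (u / (u - 1)) \<omega> W w \<Longrightarrow> in_Lp p f \<Longrightarrow> powr_integral p f \<le> 1 \<Longrightarrow>
      (\<integral>\<^sup>+x. ennreal (enn2real (abs_frac W \<alpha> f x) powr q) \<partial>lborel)
        \<le> ennreal ((C * \<omega>) powr q)"
proof -
  obtain C where C: "0 \<le> C" "\<And>W w \<omega> f g. osc_weight (u / (u - 1)) \<omega> W w \<Longrightarrow>
    f \<in> borel_measurable borel \<Longrightarrow> (\<And>x. 0 \<le> f x) \<Longrightarrow> integrable lborel (\<lambda>x. f x powr p) \<Longrightarrow>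
    (LINT x|lborel. f x powr p) \<le> 1 \<Longrightarrow>
    g \<in> borel_measurable borel \<Longrightarrow> (\<And>x. 0 \<le> g x) \<Longrightarrow> integrable lborel (\<lambda>x. g x powr (q / (q - 1))) \<Longrightarrow>
    (LINT x|lborel. g x powr (q / (q - 1))) \<le> 1 \<Longrightarrow>
    (\<integral>\<^sup>+x. \<integral>\<^sup>+y. ennreal (W x y * \<bar>x - y\<bar> powr (\<alpha> - 1) * f y * g x) \<partial>lborel \<partial>lborel) \<le> ennreal (C * \<omega>)"
    using bilinear_bound[OF assms] by blast
  have *: "(AE x in lborel. (abs_frac W \<alpha> f x) < \<infinity>) \<and>
    (\<integral>\<^sup>+x. ennreal (enn2real (abs_frac W \<alpha> f x) powr q) \<partial>lborel)
        \<le> ennreal ((C * \<omega>) powr q)"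
    if osc: "osc_weight (u / (u - 1)) \<omega> W w" and f: "in_Lp p f" "powr_integral p f \<le> 1" for W w \<omega> f
  proof -
    let ?h = "\<lambda>x. abs_frac W \<alpha> f x"
    have [measurable]: "f \<in> borel_measurable borel" using f by (simp add: in_Lp_def)
    have \<omega>: "0 < \<omega>" and W0: "\<And>x y. 0 \<le> W x y"
      and Wm [measurable]: "case_prod W \<in> borel_measurable (borel \<Otimes>\<^sub>M borel)"
      using osc by (auto simp: osc_weight_def)
    have [measurable]: "(\<lambda>z. W (fst z) (snd z)) \<in> borel_measurable (borel \<Otimes>\<^sub>M borel)"
      using Wm by (simp add: split_beta')
    have Wx [measurable]: "W x \<in> borel_measurable borel" for x
      using measurable_Pair2[OF Wm, of x] by simp
    have hm: "?h \<in> borel_measurable borel"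
      using lborel.borel_measurable_nn_integral_fst[of "\<lambda>z. ennreal (W (fst z) (snd z) * \<bar>fst z - snd z\<bar> powr (\<alpha> - 1) * \<bar>f (snd z)\<bar>)" borel]
      by simp
    have dual: "(\<integral>\<^sup>+x. ?h x * ennreal (g x) \<partial>lborel) \<le> ennreal (C * \<omega>)"
      if g: "g \<in> borel_measurable borel" "\<And>x. 0 \<le> g x" "integrable lborel (\<lambda>x. g x powr (q / (q - 1)))"
        "(LINT x|lborel. g x powr (q / (q - 1))) \<le> 1" for g
    proof -
      have "(\<integral>\<^sup>+x. ?h x * ennreal (g x) \<partial>lborel)
         = (\<integral>\<^sup>+x. \<integral>\<^sup>+y. ennreal (W x y * \<bar>x - y\<bar> powr (\<alpha> - 1) * \<bar>f y\<bar> * g x) \<partial>lborel \<partial>lborel)"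
        using g(2) W0 by (intro nn_integral_cong) (simp add: nn_integral_multc ennreal_mult)
      also have "\<dots> \<le> ennreal (C * \<omega>)"
        using f g by (intro C(2)[OF osc]) (auto simp: in_Lp_def)
      finally show ?thesis .
    qed
    have "1 < q" "0 \<le> C * \<omega>" using assms C \<omega> by auto
    from Lq_bound_by_duality[OF this hm dual] show ?thesis by blast
  qed
  show thesis
    by (rule that[OF C(1)]; (rule *[THEN conjunct1] | rule *[THEN conjunct2]); assumption)
qed

lemma in_Lp_normalize:
  assumes "1 \<le> p" "in_Lp p f"
  obtains c where "0 < c" "in_Lp p (\<lambda>x. c * f x)" "powr_integral p (\<lambda>x. c * f x) \<le> 1"
proof -
  define n where "n = powr_integral p f"
  have n: "0 \<le> n" by (simp add: n_def)
  \<comment> \<open>\<open>n + 1\<close> instead of \<open>n\<close> keeps the factor well-behaved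
    when f vanishes almost everywhere.\<close>
  define c where "c = (n + 1) powr (- 1 / p)"
  have c: "0 < c" using n by (simp add: c_def)
  have cp: "\<bar>c * f x\<bar> powr p = \<bar>f x\<bar> powr p / (n + 1)" for x
  proof -
    have "c powr p = 1 / (n + 1)"
    proof -
      have e: "- 1 / p * p = - 1" using assms by simp
      show ?thesis unfolding c_def powr_powr e using n by (simp add: powr_minus_divide)
    qed
    then show ?thesis using c by (simp add: abs_mult powr_mult)
  qed
  show thesis
  proof (rule that[OF c])
    show "in_Lp p (\<lambda>x. c * f x)" using assms unfolding in_Lp_def cp by auto
    show "powr_integral p (\<lambda>x. c * f x) \<le> 1"
      unfolding cp using n by (simp add: n_def[symmetric])
  qed
qed

lemma commutator_scale: "commutator b \<alpha> (\<lambda>x. c * f x) x = c * commutator b \<alpha> f x"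
proof -
  have "frac_int_plus \<alpha> (\<lambda>y. c * g y) x = c * frac_int_plus \<alpha> g x" for g
    by (simp only: frac_int_plus_def times_divide_eq_right[symmetric] set_integral_mult_right)
  from this[of f] this[of "\<lambda>y. b y * f y"] show ?thesis
    unfolding commutator_def by (simp add: algebra_simps)
qed

text \<open>The norm estimate concerns normalised f; convergence of the two one-sided integrals is
  stated for every f in L^p, and it later allows commutators with different symbols to be
  subtracted.\<close>

lemma commutator_bound:
  fixes p q \<alpha> :: real
  assumes "1 < p" "p < q" "0 < \<alpha>" "\<alpha> < 1" "1 / q = 1 / p - \<alpha>"
  obtains C where "0 < C"
    and "\<And>b B f. loc_integrable b \<Longrightarrow> 0 < B \<Longrightarrow> osc_le b B \<Longrightarrow>
      in_Lp p f \<Longrightarrow> powr_integral p f \<le> 1 \<Longrightarrow>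
      (powr_nn_integral q (commutator b \<alpha> f)) \<le> ennreal ((C * B) powr q)"
    and "\<And>b B f. loc_integrable b \<Longrightarrow> 0 < B \<Longrightarrow> osc_le b B \<Longrightarrow> in_Lp p f \<Longrightarrow>
      AE x in lborel. frac_integrable \<alpha> f x \<and>
        frac_integrable \<alpha> (\<lambda>y. b y * f y) x"
proof -
  \<comment> \<open>The Hoelder exponent u must lie below p and below the dual exponent of q; its
    conjugate r = u / (u - 1) is the power at which the John--Nirenberg inequality enters.\<close>
  have "1 < min p (q / (q - 1))" using assms by (simp add: field_simps)
  from dense[OF this] obtain u where "1 < u" "u < min p (q / (q - 1))" by blast
  then have u: "1 < u" "u < p" "u < q / (q - 1)" by simp_all
  define r where "r = u / (u - 1)"
  have r: "1 \<le> r" using u by (simp add: r_def field_simps)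
  obtain C where C: "0 \<le> C"
     "\<And>W w \<omega> f. osc_weight r \<omega> W w \<Longrightarrow> in_Lp p f \<Longrightarrow> powr_integral p f \<le> 1 \<Longrightarrow>
      AE x in lborel. (abs_frac W \<alpha> f x) < \<infinity>"
     "\<And>W w \<omega> f. osc_weight r \<omega> W w \<Longrightarrow> in_Lp p f \<Longrightarrow> powr_integral p f \<le> 1 \<Longrightarrow>
      (\<integral>\<^sup>+x. ennreal (enn2real (abs_frac W \<alpha> f x) powr q) \<partial>lborel)
        \<le> ennreal ((C * \<omega>) powr q)"
    by (rule weighted_frac_bound[OF assms u, folded r_def]) (rule that; assumption)
  have key: "AE x in lborel. frac_integrable \<alpha> f x \<and>
        frac_integrable \<alpha> (\<lambda>y. b y * f y) x \<and>
        \<bar>commutator b \<alpha> f x\<bar> \<le> enn2real (abs_frac (\<lambda>x y. \<bar>b x - b y\<bar>) \<alpha> f x)"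
    if b: "loc_integrable b" and B: "0 < B" and osc: "osc_le b B"
      and f: "in_Lp p f" "powr_integral p f \<le> 1" for b B f
    using C(2)[OF BMO_osc_weight[OF b B r osc] f] C(2)[OF one_osc_weight f]
  proof eventually_elim
    case (elim x)
    have [measurable]: "f \<in> borel_measurable borel" "b \<in> borel_measurable borel"
      using f b by (auto simp: in_Lp_def loc_integrable_def)
    define k where "k y = \<bar>x - y\<bar> powr (\<alpha> - 1) * \<bar>f y\<bar>" for y
    define g where "g y = f y / (y - x) powr (1 - \<alpha>)" for y
    have [measurable]: "k \<in> borel_measurable borel" "g \<in> borel_measurable borel"
      unfolding k_def g_def by measurable
    have k0 [simp]: "0 \<le> k y" for y by (simp add: k_def)
    have gk: "\<bar>g y\<bar> = k y" if "x < y" for y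
    proof -
      have "\<bar>x - y\<bar> = y - x" using that by simp
      then show ?thesis using that by (simp add: powr_diff abs_mult mult.commute k_def g_def)
    qed
    have i1: "integrable lborel k"
      using elim(2) by (intro integrableI_bounded) (auto simp: k_def abs_mult)
    have i2: "integrable lborel (\<lambda>y. \<bar>b x - b y\<bar> * k y)"
      using elim(1) by (intro integrableI_bounded) (auto simp: k_def abs_mult mult.assoc)
    have s1: "set_integrable lborel {x<..} g"
      unfolding set_integrable_def
      by (rule Bochner_Integration.integrable_bound[OF i1]) (auto simp: indicator_def gk)
    have s2: "set_integrable lborel {x<..} (\<lambda>y. (b x - b y) * g y)"
      unfolding set_integrable_def
      by (rule Bochner_Integration.integrable_bound[OF i2]) (auto simp: indicator_def gk abs_mult)
    \<comment> \<open>The product with \<open>b y\<close> is reached as a difference of two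
      integrable functions, one controlled by the weight 1 and one by the weight
      \<open>\<bar>b x - b y\<bar>\<close>. Only then can the two Bochner integrals be
      merged.\<close>
    have "set_integrable lborel {x<..} (\<lambda>y. b x * g y - (b x - b y) * g y)"
      using s1 s2 by (intro set_integral_diff set_integrable_mult_right) auto
    also have "(\<lambda>y. b x * g y - (b x - b y) * g y) = (\<lambda>y. b y * g y)"
      by (simp add: algebra_simps)
    finally have s3: "set_integrable lborel {x<..} (\<lambda>y. b y * g y)" .
    have "commutator b \<alpha> f x = (LINT y:{x<..}|lborel. b x * g y) - (LINT y:{x<..}|lborel. b y * g y)"
      by (simp only: commutator_def frac_int_plus_def g_def set_integral_mult_right times_divide_eq_right[symmetric])
    also have "\<dots> = (LINT y:{x<..}|lborel. b x * g y - b y * g y)"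
      using s1 s3 by (intro set_integral_diff(2)[symmetric] set_integrable_mult_right) auto
    also have "\<dots> = (LINT y:{x<..}|lborel. (b x - b y) * g y)"
      by (simp add: algebra_simps)
    finally have "\<bar>commutator b \<alpha> f x\<bar> = \<bar>LINT y:{x<..}|lborel. (b x - b y) * g y\<bar>" by simp
    also have "\<dots> \<le> (LINT y|lborel. \<bar>indicator {x<..} y *\<^sub>R ((b x - b y) * g y)\<bar>)"
      unfolding set_lebesgue_integral_def by (rule integral_abs_bound)
    also have "\<dots> \<le> (LINT y|lborel. \<bar>b x - b y\<bar> * k y)"
    proof (intro integral_mono)
      show "\<bar>indicator {x<..} y *\<^sub>R ((b x - b y) * g y)\<bar> \<le> \<bar>b x - b y\<bar> * k y" for y
        by (cases "x < y") (simp_all add: abs_mult gk)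
    qed (use i2 s2 in \<open>auto simp: set_integrable_def intro!: integrable_abs\<close>)
    also have "\<dots> = enn2real (abs_frac (\<lambda>x y. \<bar>b x - b y\<bar>) \<alpha> f x)"
      by (subst integral_eq_nn_integral) (auto simp: k_def mult.assoc)
    finally show ?case using s1 s3 by (simp add: g_def[abs_def])
  qed
  \<comment> \<open>\<open>C + 1\<close> makes the constant positive, so that the accuracy of the
    approximation can later be chosen by dividing by it.\<close>
  define C' where "C' = (C + 1) * JN_const r powr (1 / r)"
  show thesis
  proof (rule that)
    show "0 < C'" using C(1) JN_const_pos[of r] by (simp add: C'_def)
  next
    fix b f :: "real \<Rightarrow> real" and B :: real
    assume b: "loc_integrable b" and B: "0 < B" and osc: "osc_le b B"
      and f: "in_Lp p f" "powr_integral p f \<le> 1"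
    have "(powr_nn_integral q (commutator b \<alpha> f))
      \<le> (\<integral>\<^sup>+x. ennreal (enn2real (abs_frac (\<lambda>x y. \<bar>b x - b y\<bar>) \<alpha> f x) powr q) \<partial>lborel)"
    proof (intro nn_integral_mono_AE)
      show "AE x in lborel. ennreal (\<bar>commutator b \<alpha> f x\<bar> powr q)
        \<le> ennreal (enn2real (abs_frac (\<lambda>x y. \<bar>b x - b y\<bar>) \<alpha> f x) powr q)"
        using key[OF b B osc f]
        by eventually_elim (use assms in \<open>auto intro!: ennreal_leI powr_mono2\<close>)
    qed
    also have "\<dots> \<le> ennreal ((C * (JN_const r powr (1 / r) * B)) powr q)"
      by (rule C(3)[OF BMO_osc_weight[OF b B r osc] f])
    also have "\<dots> \<le> ennreal ((C' * B) powr q)"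
      using C(1) B assms by (intro ennreal_leI powr_mono2) (auto simp: C'_def algebra_simps)
    finally show "powr_nn_integral q (commutator b \<alpha> f) \<le> ennreal ((C' * B) powr q)" .
  next
    fix b f :: "real \<Rightarrow> real" and B :: real
    assume b: "loc_integrable b" and B: "0 < B" and osc: "osc_le b B"
      and f: "in_Lp p f"
    obtain c where c: "0 < c" "in_Lp p (\<lambda>x. c * f x)" "powr_integral p (\<lambda>x. c * f x) \<le> 1"
      using in_Lp_normalize[of p f] f assms by auto
    show "AE x in lborel. frac_integrable \<alpha> f x \<and>
        frac_integrable \<alpha> (\<lambda>y. b y * f y) x"
      using key[OF b B osc c(2,3)]
    proof eventually_elim
      case (elim x)
      have "set_integrable lborel {x<..} (\<lambda>y. (1 / c) * (c * f y / (y - x) powr (1 - \<alpha>)))"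
        "set_integrable lborel {x<..} (\<lambda>y. (1 / c) * (b y * (c * f y) / (y - x) powr (1 - \<alpha>)))"
        using elim by - (rule set_integrable_mult_right, blast)+
      then show ?case using c(1) by (simp add: mult_ac)
    qed
  qed
qed

section \<open>Completeness of the Lebesgue spaces\<close>

lemma mean_osc_diff_le:
  assumes f: "loc_integrable f" and g: "loc_integrable g" and "a < c"
  shows "mean_osc (\<lambda>x. f x - g x) a c \<le> mean_osc f a c + mean_osc g a c"
proof -
  have I: "set_integrable lborel {a..c} f" "set_integrable lborel {a..c} g"
    using f g by (auto simp: loc_integrable_def)
  have J: "set_integrable lborel {a..c} (\<lambda>x. \<bar>h x - d\<bar>)" if "loc_integrable h" for h d
    using loc_integrable_abs_diff[OF that] by (auto simp: loc_integrable_def)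
  have K: "set_integrable lborel {a..c} (\<lambda>x. f x - g x)" using I by auto
  have lfg: "loc_integrable (\<lambda>x. f x - g x)"
    using f g by (auto simp: loc_integrable_def)
  have avg: "avg (\<lambda>x. f x - g x) a c = avg f a c - avg g a c"
    using I by (simp add: avg_def algebra_simps diff_divide_distrib)
  have "(LINT x:{a..c}|lborel. \<bar>f x - g x - avg (\<lambda>x. f x - g x) a c\<bar>)
     \<le> (LINT x:{a..c}|lborel. \<bar>f x - avg f a c\<bar> + \<bar>g x - avg g a c\<bar>)"
    using J[OF lfg] J[OF f] J[OF g] unfolding avg by (intro set_integral_mono set_integral_add) auto
  also have "\<dots> = (LINT x:{a..c}|lborel. \<bar>f x - avg f a c\<bar>) + (LINT x:{a..c}|lborel. \<bar>g x - avg g a c\<bar>)"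
    using J[OF f] J[OF g] by (intro set_integral_add) auto
  finally show ?thesis using \<open>a < c\<close> unfolding mean_osc_def
    by (simp add: add_divide_distrib[symmetric] divide_right_mono)
qed

lemma mean_osc_bounded:
  assumes g: "loc_integrable g" and M: "\<And>x. \<bar>g x\<bar> \<le> M" and "a < c"
  shows "mean_osc g a c \<le> 2 * M"
proof -
  have I: "set_integrable lborel {a..c} g" using g by (auto simp: loc_integrable_def)
  have cst: "set_integrable lborel {a..c} (\<lambda>x. d :: real)" for d
    by (simp add: set_integrable_def emeasure_lborel_Icc_eq)
  have cI: "(LINT x:{a..c}|lborel. d) = d * (c - a)" for d :: real
    using \<open>a < c\<close> by (simp add: set_lebesgue_integral_def)
  have "\<bar>LINT x:{a..c}|lborel. g x\<bar> \<le> (LINT x:{a..c}|lborel. \<bar>g x\<bar>)"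
    using integral_abs_bound[of lborel "\<lambda>x. indicator {a..c} x *\<^sub>R g x"]
    by (simp add: set_lebesgue_integral_def abs_mult)
  also have "\<dots> \<le> (LINT x:{a..c}|lborel. M)"
    using M I cst by (intro set_integral_mono set_integrable_abs) auto
  finally have "\<bar>avg g a c\<bar> \<le> M"
    using \<open>a < c\<close> by (simp add: avg_def cI abs_mult field_simps)
  then have "\<bar>g x - avg g a c\<bar> \<le> 2 * M" for x using M[of x] by linarith
  then have "(LINT x:{a..c}|lborel. \<bar>g x - avg g a c\<bar>) \<le> (LINT x:{a..c}|lborel. 2 * M)"
    using loc_integrable_abs_diff[OF g] cst[of "2 * M"] by (intro set_integral_mono) (auto simp: loc_integrable_def)
  then show ?thesis using \<open>a < c\<close> by (simp add: mean_osc_def cI field_simps)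
qed

section \<open>Completeness from rapidly convergent subsequences\<close>

lemma powr_diff_le:
  fixes x y q :: real
  assumes "0 \<le> q"
  shows "\<bar>x - y\<bar> powr q \<le> 2 powr q * (\<bar>x\<bar> powr q + \<bar>y\<bar> powr q)"
proof -
  have "\<bar>x - y\<bar> powr q \<le> (\<bar>x\<bar> + \<bar>y\<bar>) powr q" using assms by (intro powr_mono2) auto
  also have "\<dots> \<le> 2 powr q * (\<bar>x\<bar> powr q + \<bar>y\<bar> powr q)" using assms by (intro powr_add_le) auto
  finally show ?thesis .
qed

lemma in_Lp_iff_nn_integral:
  "in_Lp q f \<longleftrightarrow> f \<in> borel_measurable borel \<and> (powr_nn_integral q f) < \<infinity>"
  by (auto simp: in_Lp_def integrable_iff_bounded)

text \<open>Weighted by 2^(q j), the q-th powers of the increments still have summable integrals.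
  Almost everywhere the weighted series is therefore finite, which bounds the j-th increment by a
  multiple of 2^(-j).\<close>

lemma Lq_Cauchy_AE_convergent:
  fixes v :: "nat \<Rightarrow> real \<Rightarrow> real"
  assumes q: "0 < q" and [measurable]: "\<And>n. v n \<in> borel_measurable borel"
    and fast: "\<And>j. (powr_nn_integral q (\<lambda>x. v (Suc j) x - v j x)) \<le> ennreal ((1 / 4 powr q) ^ j)"
  shows "AE x in lborel. convergent (\<lambda>j. v j x)"
proof -
  define t where "t j x = ennreal ((2 powr q) ^ j * \<bar>v (Suc j) x - v j x\<bar> powr q)" for j x
  have [measurable]: "t j \<in> borel_measurable borel" for j unfolding t_def by measurable
  have "(\<integral>\<^sup>+x. (\<Sum>j. t j x) \<partial>lborel) = (\<Sum>j. \<integral>\<^sup>+x. t j x \<partial>lborel)"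
    by (intro nn_integral_suminf) measurable
  also have "\<dots> \<le> (\<Sum>j. ennreal ((1 / 2 powr q) ^ j))"
  proof (intro suminf_le)
    fix j
    have "(\<integral>\<^sup>+x. t j x \<partial>lborel) = ennreal ((2 powr q) ^ j) * (powr_nn_integral q (\<lambda>x. v (Suc j) x - v j x))"
      by (simp add: t_def ennreal_mult nn_integral_cmult)
    also have "\<dots> \<le> ennreal ((2 powr q) ^ j) * ennreal ((1 / 4 powr q) ^ j)"
      by (intro mult_left_mono fast) auto
    also have "\<dots> = ennreal ((2 powr q) ^ j * (1 / 4 powr q) ^ j)" by (simp add: ennreal_mult)
    also have "(2 powr q) ^ j * (1 / 4 powr q) ^ j = (1 / 2 powr q) ^ j"
      using powr_mult[of 2 2 q] by (simp add: power_mult_distrib[symmetric])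
    finally show "(\<integral>\<^sup>+x. t j x \<partial>lborel) \<le> ennreal ((1 / 2 powr q) ^ j)" .
  qed auto
  also have "\<dots> < \<infinity>"
  proof -
    have "1 < 2 powr q" using q by simp
    then have "summable (\<lambda>j. (1 / 2 powr q) ^ j)" by (intro summable_geometric) (simp add: field_simps)
    then show ?thesis by (subst suminf_ennreal2) auto
  qed
  finally have "AE x in lborel. (\<Sum>j. t j x) \<noteq> \<infinity>"
    by (intro nn_integral_PInf_AE) auto
  then show ?thesis
  proof eventually_elim
    case (elim x)
    then obtain K where K: "(\<Sum>j. t j x) = ennreal K" "0 \<le> K" by (cases "\<Sum>j. t j x") auto
    have bound: "\<bar>v (Suc j) x - v j x\<bar> \<le> K powr (1 / q) * (1 / 2) ^ j" for j
    proof -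
      have "t j x \<le> (\<Sum>j. t j x)" using sum_le_suminf[of "\<lambda>j. t j x" "{j}"] by simp
      then have "(2 powr q) ^ j * \<bar>v (Suc j) x - v j x\<bar> powr q \<le> K"
        using K by (simp add: t_def ennreal_le_iff)
      then have "\<bar>v (Suc j) x - v j x\<bar> powr q \<le> K / (2 powr q) ^ j" by (simp add: field_simps)
      then have "(\<bar>v (Suc j) x - v j x\<bar> powr q) powr (1 / q) \<le> (K / (2 powr q) ^ j) powr (1 / q)"
        using q by (intro powr_mono2) auto
      also have "(2 powr q) ^ j = 2 powr (q * real j)" by (simp add: powr_powr flip: powr_realpow)
      also have "(K / 2 powr (q * real j)) powr (1 / q) = K powr (1 / q) * (1 / 2) ^ j"
        using K q by (simp add: powr_divide powr_powr powr_realpow power_divide)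
      finally show ?thesis using q by (simp add: powr_powr)
    qed
    have "summable (\<lambda>j. v (Suc j) x - v j x)"
    proof (rule summable_comparison_test')
      show "summable (\<lambda>j. K powr (1 / q) * (1 / 2) ^ j)" by (intro summable_mult summable_geometric) auto
      show "norm (v (Suc j) x - v j x) \<le> K powr (1 / q) * (1 / 2) ^ j" if "0 \<le> j" for j using bound[of j] by simp
    qed
    then have "convergent (\<lambda>n. v n x - v 0 x)"
      using sum_lessThan_telescope[of "\<lambda>n. v n x"] by (simp add: summable_iff_convergent)
    then show ?case by (simp add: convergent_diff_const_right_iff)
  qed
qed

lemma Lq_complete:
  fixes v :: "nat \<Rightarrow> real \<Rightarrow> real"
  assumes q: "0 < q" and v: "\<And>n. in_Lp q (v n)"
    and Cauchy: "\<And>\<epsilon>. 0 < \<epsilon> \<Longrightarrow> \<exists>N. \<forall>m\<ge>N. \<forall>n\<ge>N. (powr_nn_integral q (\<lambda>x. v m x - v n x)) \<le> ennreal \<epsilon>"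
  shows "\<exists>g. in_Lp q g \<and> (\<lambda>n. Lp_norm q (\<lambda>x. v n x - g x)) \<longlonglongrightarrow> 0"
proof -
  have [measurable]: "v n \<in> borel_measurable borel" for n using v by (auto simp: in_Lp_def)
  have "\<forall>j. \<exists>N. \<forall>m\<ge>N. \<forall>n\<ge>N. (powr_nn_integral q (\<lambda>x. v m x - v n x)) \<le> ennreal ((1 / 4 powr q) ^ j)"
    by (intro allI Cauchy) simp
  then obtain N where N: "\<And>j m n. N j \<le> m \<Longrightarrow> N j \<le> n \<Longrightarrow>
      (powr_nn_integral q (\<lambda>x. v m x - v n x)) \<le> ennreal ((1 / 4 powr q) ^ j)" by metis
  \<comment> \<open>The partial sums push \<open>s j\<close> past \<open>N j\<close>, and the
    summand \<open>j\<close> makes \<open>s\<close> strictly increasing.\<close>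
  define s where "s j = (\<Sum>i\<le>j. N i) + j" for j
  have s: "N j \<le> s j" "s j < s (Suc j)" "j \<le> s j" for j
    using member_le_sum[of j "{..j}" N] by (auto simp: s_def)
  have conv: "AE x in lborel. convergent (\<lambda>j. v (s j) x)"
  proof (rule Lq_Cauchy_AE_convergent[OF q])
    fix j
    show "(powr_nn_integral q (\<lambda>x. v (s (Suc j)) x - v (s j) x)) \<le> ennreal ((1 / 4 powr q) ^ j)"
      using s[of j] by (intro N) auto
  qed measurable
  define g where "g x = lim (\<lambda>j. v (s j) x)" for x
  have [measurable]: "g \<in> borel_measurable borel" unfolding g_def by measurable
  \<comment> \<open>Fatou's lemma along the subsequence turns a Cauchy bound into a bound against
    the limit. It serves twice: for membership of \<open>g\<close> in L^q and for
    convergence.\<close>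
  have lim: "powr_nn_integral q (\<lambda>x. v n x - g x) \<le> ennreal \<epsilon>"
    if \<epsilon>: "\<forall>m\<ge>K. (powr_nn_integral q (\<lambda>x. v n x - v m x)) \<le> ennreal \<epsilon>" for n \<epsilon> K
  proof -
    have "(powr_nn_integral q (\<lambda>x. v n x - g x))
      \<le> (\<integral>\<^sup>+x. liminf (\<lambda>j. ennreal (\<bar>v n x - v (s j) x\<bar> powr q)) \<partial>lborel)"
    proof (intro nn_integral_mono_AE)
      show "AE x in lborel. ennreal (\<bar>v n x - g x\<bar> powr q) \<le> liminf (\<lambda>j. ennreal (\<bar>v n x - v (s j) x\<bar> powr q))"
        using conv
      proof eventually_elim
        case (elim x)
        then have "(\<lambda>j. v (s j) x) \<longlonglongrightarrow> g x" by (simp add: g_def convergent_LIMSEQ_iff)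
        then have "(\<lambda>j. ennreal (\<bar>v n x - v (s j) x\<bar> powr q)) \<longlonglongrightarrow> ennreal (\<bar>v n x - g x\<bar> powr q)"
          using q by (auto intro!: tendsto_ennrealI tendsto_powr' tendsto_rabs tendsto_diff)
        then have "liminf (\<lambda>j. ennreal (\<bar>v n x - v (s j) x\<bar> powr q)) = ennreal (\<bar>v n x - g x\<bar> powr q)"
          by (intro lim_imp_Liminf) auto
        then show ?case by simp
      qed
    qed
    also have "\<dots> \<le> liminf (\<lambda>j. \<integral>\<^sup>+x. ennreal (\<bar>v n x - v (s j) x\<bar> powr q) \<partial>lborel)"
      by (intro nn_integral_liminf) measurable
    also have "\<dots> \<le> liminf (\<lambda>j. ennreal \<epsilon>)"
    proof (intro Liminf_mono eventually_sequentiallyI[of K])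
      fix j assume "K \<le> j"
      then have "K \<le> s j" using s(3)[of j] by linarith
      then show "powr_nn_integral q (\<lambda>x. v n x - v (s j) x) \<le> ennreal \<epsilon>" using \<epsilon> by simp
    qed
    also have "\<dots> = ennreal \<epsilon>" by (simp add: Liminf_const)
    finally show ?thesis .
  qed
  have fin: "powr_nn_integral q (\<lambda>x. v (N 0) x - g x) \<le> ennreal 1"
    by (rule lim[of "N 0"]) (use N[of 0] in auto)
  have "in_Lp q g"
    unfolding in_Lp_iff_nn_integral
  proof
    have "(powr_nn_integral q g)
      \<le> (\<integral>\<^sup>+x. ennreal (2 powr q) * (ennreal (\<bar>v (N 0) x\<bar> powr q) + ennreal (\<bar>v (N 0) x - g x\<bar> powr q)) \<partial>lborel)"
    proof (intro nn_integral_mono)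
      fix x
      have "\<bar>g x\<bar> powr q \<le> 2 powr q * (\<bar>v (N 0) x\<bar> powr q + \<bar>v (N 0) x - g x\<bar> powr q)"
        using powr_diff_le[of q "v (N 0) x" "v (N 0) x - g x"] q by simp
      then show "ennreal (\<bar>g x\<bar> powr q) \<le> ennreal (2 powr q) * (ennreal (\<bar>v (N 0) x\<bar> powr q) + ennreal (\<bar>v (N 0) x - g x\<bar> powr q))"
        by (simp add: ennreal_leI flip: ennreal_plus ennreal_mult)
    qed
    also have "\<dots> = ennreal (2 powr q) * ((powr_nn_integral q (v (N 0))) + (powr_nn_integral q (\<lambda>x. v (N 0) x - g x)))"
      by (simp add: nn_integral_cmult nn_integral_add)
    also have "\<dots> < \<infinity>"
      using v[of "N 0"] order.strict_trans1[OF fin ennreal_less_top]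
      by (simp add: in_Lp_iff_nn_integral ennreal_mult_less_top)
    finally show "powr_nn_integral q g < \<infinity>" .
  qed measurable
  moreover have "(\<lambda>n. LINT x|lborel. \<bar>v n x - g x\<bar> powr q) \<longlonglongrightarrow> 0"
  proof (rule LIMSEQ_I)
    fix e :: real assume e: "0 < e"
    then obtain K where K: "\<forall>m\<ge>K. \<forall>n\<ge>K. (powr_nn_integral q (\<lambda>x. v m x - v n x)) \<le> ennreal (e / 2)"
      using Cauchy[of "e / 2"] by auto
    show "\<exists>K. \<forall>n\<ge>K. norm ((LINT x|lborel. \<bar>v n x - g x\<bar> powr q) - 0) < e"
    proof (intro exI[of _ K] allI impI)
      fix n assume "K \<le> n"
      then have "powr_nn_integral q (\<lambda>x. v n x - g x) \<le> ennreal (e / 2)" using K by (intro lim[of K]) auto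
      then have "enn2real (powr_nn_integral q (\<lambda>x. v n x - g x)) \<le> e / 2"
        using e enn2real_mono[of _ "ennreal (e / 2)"] by fastforce
      then show "norm ((LINT x|lborel. \<bar>v n x - g x\<bar> powr q) - 0) < e"
        using e by (simp add: integral_eq_nn_integral)
    qed
  qed
  then have "(\<lambda>n. Lp_norm q (\<lambda>x. v n x - g x)) \<longlonglongrightarrow> 0 powr (1 / q)"
    unfolding Lp_norm_def using q by (intro tendsto_powr' tendsto_const) auto
  ultimately show ?thesis by auto
qed

section \<open>Compactness\<close>

definition comm_kernel :: "(real \<Rightarrow> real) \<Rightarrow> real \<Rightarrow> real \<Rightarrow> real \<Rightarrow> real" where
  "comm_kernel \<phi> \<alpha> x y = (if x < y then (\<phi> x - \<phi> y) / (y - x) powr (1 - \<alpha>) else 0)"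

abbreviation comm_integral :: "(real \<Rightarrow> real) \<Rightarrow> real \<Rightarrow> real \<Rightarrow> (real \<Rightarrow> real) \<Rightarrow> real \<Rightarrow> real" where
  "comm_integral \<phi> \<alpha> R f x \<equiv> LINT y:{- R..R}|lborel. comm_kernel \<phi> \<alpha> x y * f y"

text \<open>On the diagonal the Lipschitz bound beats the singularity: the kernel is at most
  \<open>L * \<bar>x - y\<bar> powr \<alpha>\<close>, which tends to 0, the value taken for y \<le>
  x.\<close>

lemma comm_kernel_continuous:
  assumes \<alpha>: "0 < \<alpha>" and cont: "\<And>x. isCont \<phi> x"
    and Lip: "\<And>x y. x \<in> I \<Longrightarrow> y \<in> I \<Longrightarrow> \<bar>\<phi> x - \<phi> y\<bar> \<le> L * \<bar>x - y\<bar>"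
  shows "continuous_on (I \<times> I) (\<lambda>z. comm_kernel \<phi> \<alpha> (fst z) (snd z))"
  unfolding continuous_on_def
proof
  fix z0 :: "real \<times> real" assume z0: "z0 \<in> I \<times> I"
  let ?F = "at z0 within (I \<times> I)"
  let ?\<kappa> = "\<lambda>z. comm_kernel \<phi> \<alpha> (fst z) (snd z)"
  have f: "(fst \<longlongrightarrow> fst z0) ?F" and s: "(snd \<longlongrightarrow> snd z0) ?F" by (auto intro!: tendsto_intros)
  have d: "((\<lambda>z. snd z - fst z) \<longlongrightarrow> snd z0 - fst z0) ?F" by (intro tendsto_diff f s)
  have \<phi>: "((\<lambda>z. \<phi> (fst z) - \<phi> (snd z)) \<longlongrightarrow> \<phi> (fst z0) - \<phi> (snd z0)) ?F"
    by (intro tendsto_diff isCont_tendsto_compose[OF cont] f s)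
  consider "fst z0 < snd z0" | "snd z0 < fst z0" | "fst z0 = snd z0" by linarith
  then show "(?\<kappa> \<longlongrightarrow> ?\<kappa> z0) ?F"
  proof cases
    case 1
    have "((\<lambda>z. (\<phi> (fst z) - \<phi> (snd z)) / (snd z - fst z) powr (1 - \<alpha>)) \<longlongrightarrow>
      (\<phi> (fst z0) - \<phi> (snd z0)) / (snd z0 - fst z0) powr (1 - \<alpha>)) ?F"
      using 1 by (intro tendsto_divide \<phi> tendsto_powr d tendsto_const) auto
    moreover have "\<forall>\<^sub>F z in ?F. 0 < snd z - fst z" using order_tendstoD(1)[OF d, of 0] 1 by simp
    ultimately show ?thesis using 1
      by (auto simp: comm_kernel_def elim!: Lim_transform_eventually eventually_mono)
  next
    case 2
    have "\<forall>\<^sub>F z in ?F. snd z - fst z < 0" using order_tendstoD(2)[OF d, of 0] 2 by simp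
    then have "\<forall>\<^sub>F z in ?F. 0 = ?\<kappa> z" by eventually_elim (auto simp: comm_kernel_def)
    from Lim_transform_eventually[OF tendsto_const this] show ?thesis using 2 by (simp add: comm_kernel_def)
  next
    case 3
    have "((\<lambda>z. L * \<bar>snd z - fst z\<bar> powr \<alpha>) \<longlongrightarrow> L * \<bar>snd z0 - fst z0\<bar> powr \<alpha>) ?F"
      using \<alpha> by (intro tendsto_mult tendsto_const tendsto_powr' tendsto_rabs d) auto
    then have lim0: "((\<lambda>z. L * \<bar>snd z - fst z\<bar> powr \<alpha>) \<longlongrightarrow> 0) ?F" using 3 \<alpha> by simp
    have "\<bar>?\<kappa> z\<bar> \<le> L * \<bar>snd z - fst z\<bar> powr \<alpha>" if z: "z \<in> I \<times> I" for z
    proof (cases "fst z < snd z")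
      case True
      have "\<bar>?\<kappa> z\<bar> = \<bar>\<phi> (fst z) - \<phi> (snd z)\<bar> / (snd z - fst z) powr (1 - \<alpha>)"
        using True by (simp add: comm_kernel_def)
      also have "\<dots> \<le> (L * \<bar>fst z - snd z\<bar>) / (snd z - fst z) powr (1 - \<alpha>)"
        using z by (intro divide_right_mono Lip) auto
      also have "\<dots> = L * \<bar>snd z - fst z\<bar> powr \<alpha>"
        using True by (simp add: powr_diff)
      finally show ?thesis .
    next
      case False
      \<comment> \<open>The sign of \<open>L\<close> is read off the Lipschitz bound at two distinct
        points; at equal points both sides are 0.\<close>
      have "0 \<le> L * \<bar>fst z - snd z\<bar>" using Lip[of "fst z" "snd z"] z by auto
      then have "fst z = snd z \<or> 0 \<le> L" by (auto simp: zero_le_mult_iff)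
      then show ?thesis using False by (auto simp: comm_kernel_def)
    qed
    then have "\<forall>\<^sub>F z in ?F. norm (?\<kappa> z) \<le> L * \<bar>snd z - fst z\<bar> powr \<alpha>"
      by (auto simp: eventually_at_filter)
    from Lim_null_comparison[OF this lim0] show ?thesis using 3 by (simp add: comm_kernel_def)
  qed
qed

lemma nn_integral_powr_tail:
  fixes e a :: real
  assumes "e < - 1" "0 < a"
  shows "(\<integral>\<^sup>+y\<in>{a..}. ennreal (y powr e) \<partial>lborel) = ennreal (- (a powr (e + 1)) / (e + 1))"
proof -
  have "(\<integral>\<^sup>+y\<in>{a..}. ennreal (y powr e) \<partial>lborel) = (\<integral>\<^sup>+y. ennreal (if y \<in> {a..} then y powr e else 0) \<partial>lborel)"
    by (intro nn_integral_cong) (auto simp: indicator_def)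
  also have "\<dots> = ennreal (- (a powr (e + 1)) / (e + 1))"
    using has_integral_powr_to_inf[OF assms]
    by (intro nn_integral_has_integral_lborel) (auto simp only: has_integral_restrict_UNIV, auto)
  finally show ?thesis .
qed

text \<open>Follows from \<open>\<bar>f x\<bar> \<le> 1 + \<bar>f x\<bar> powr p\<close>. The bound
  is crude but uniform over the unit ball, which is what equicontinuity requires.\<close>

lemma integral_Lp_interval_le:
  assumes p: "1 \<le> p" and f: "in_Lp p f" "powr_integral p f \<le> 1" and R: "0 \<le> R"
  shows "set_integrable lborel {- R..R} f" "(LINT x:{- R..R}|lborel. \<bar>f x\<bar>) \<le> 2 * R + 1"
proof -
  have [measurable]: "f \<in> borel_measurable borel" using f by (simp add: in_Lp_def)
  have int: "integrable lborel (\<lambda>x. \<bar>f x\<bar> powr p)" using f by (simp add: in_Lp_def)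
  have *: "\<bar>f x\<bar> \<le> 1 + \<bar>f x\<bar> powr p" for x
  proof (cases "\<bar>f x\<bar> \<le> 1")
    case False
    then have "\<bar>f x\<bar> powr 1 \<le> \<bar>f x\<bar> powr p" using p by (intro powr_mono) auto
    then show ?thesis using False by auto
  qed (use powr_ge_zero[of "\<bar>f x\<bar>" p] in linarith)
  have "loc_integrable (\<lambda>x. \<bar>f x\<bar>)"
    by (rule loc_integrable_if_powr_integrable(1)[of p]) (use p int in auto)
  then have abs: "set_integrable lborel {- R..R} (\<lambda>x. \<bar>f x\<bar>)" by (simp add: loc_integrable_def)
  then show "set_integrable lborel {- R..R} f"
    by (subst (asm) set_integrable_abs_iff) (auto simp: set_borel_measurable_def)
  have t: "set_integrable lborel {- R..R} (\<lambda>x. \<bar>f x\<bar> powr p)"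
    unfolding set_integrable_def using int by (intro integrable_mult_indicator) auto
  have c: "set_integrable lborel {- R..R} (\<lambda>x. 1 :: real)"
    by (simp add: set_integrable_def emeasure_lborel_Icc_eq)
  have "(LINT x:{- R..R}|lborel. \<bar>f x\<bar>) \<le> (LINT x:{- R..R}|lborel. 1 + \<bar>f x\<bar> powr p)"
    using abs t c * by (intro set_integral_mono set_integral_add) auto
  also have "\<dots> = (LINT x:{- R..R}|lborel. 1) + (LINT x:{- R..R}|lborel. \<bar>f x\<bar> powr p)"
    using t c by (intro set_integral_add) auto
  also have "(LINT x:{- R..R}|lborel. 1) = 2 * R" using R by (simp add: set_lebesgue_integral_def)
  also have "(LINT x:{- R..R}|lborel. \<bar>f x\<bar> powr p) \<le> powr_integral p f"
    unfolding set_lebesgue_integral_def using int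
    by (intro integral_mono integrable_mult_indicator) (auto simp: indicator_def)
  finally show "(LINT x:{- R..R}|lborel. \<bar>f x\<bar>) \<le> 2 * R + 1" using f by simp
qed

text \<open>Uniform continuity of the kernel on the compact square and the uniform L^1 bound make
  the images equibounded and equicontinuous. The conclusion is in uniform Cauchy form, ready to be
  combined with the other error terms.\<close>

lemma truncated_kernel_compact:
  fixes F :: "nat \<Rightarrow> real \<Rightarrow> real" and \<kappa> :: "real \<Rightarrow> real \<Rightarrow> real"
  assumes p: "1 \<le> p" and R: "0 \<le> R"
    and cont: "continuous_on ({- R..R} \<times> {- R..R}) (\<lambda>z. \<kappa> (fst z) (snd z))"
    and F: "\<And>n. in_Lp p (F n)" "\<And>n. powr_integral p (F n) \<le> 1"
  obtains r where "strict_mono (r :: nat \<Rightarrow> nat)"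
    and "\<And>e. 0 < e \<Longrightarrow> \<exists>N. \<forall>m\<ge>N. \<forall>n\<ge>N. \<forall>x\<in>{- R..R}.
      \<bar>(LINT y:{- R..R}|lborel. \<kappa> x y * F (r m) y) - (LINT y:{- R..R}|lborel. \<kappa> x y * F (r n) y)\<bar> < e"
proof -
  define G where "G n x = (LINT y:{- R..R}|lborel. \<kappa> x y * F n y)" for n x
  have comp: "compact ({- R..R} \<times> {- R..R})" by (intro compact_Times) auto
  have uc: "uniformly_continuous_on ({- R..R} \<times> {- R..R}) (\<lambda>z. \<kappa> (fst z) (snd z))"
    by (rule compact_uniformly_continuous[OF cont comp])
  obtain M where M: "\<And>x y. x \<in> {- R..R} \<Longrightarrow> y \<in> {- R..R} \<Longrightarrow> \<bar>\<kappa> x y\<bar> \<le> M" "0 \<le> M"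
  proof -
    have "bounded ((\<lambda>z. \<kappa> (fst z) (snd z)) ` ({- R..R} \<times> {- R..R}))"
      by (intro compact_imp_bounded compact_continuous_image cont comp)
    then obtain M where M: "\<forall>z\<in>{- R..R} \<times> {- R..R}. norm (\<kappa> (fst z) (snd z)) \<le> M"
      by (auto simp: bounded_iff)
    show thesis
    proof (rule that[of "max M 0"])
      show "\<bar>\<kappa> x y\<bar> \<le> max M 0" if "x \<in> {- R..R}" "y \<in> {- R..R}" for x y
        using bspec[OF M, of "(x, y)"] that by (simp add: le_max_iff_disj)
    qed simp
  qed
  have m: "\<kappa> x \<in> borel_measurable (restrict_space borel {- R..R})" if "x \<in> {- R..R}" for x
  proof -
    have "continuous_on {- R..R} (\<lambda>y. \<kappa> (fst (x, y)) (snd (x, y)))"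
      by (rule continuous_on_compose2[OF cont]) (use that in \<open>auto intro!: continuous_intros\<close>)
    then show ?thesis by (intro borel_measurable_continuous_on_restrict) simp
  qed
  have fi: "set_integrable lborel {- R..R} (F n)" "(LINT x:{- R..R}|lborel. \<bar>F n x\<bar>) \<le> 2 * R + 1" for n
    using integral_Lp_interval_le[OF p F R] by auto
  \<comment> \<open>Applied to a section of the kernel for the uniform bound and to a difference of
    two sections for equicontinuity. Measurability is asked on the interval only, where continuity
    of the kernel provides it.\<close>
  have prod: "set_integrable lborel {- R..R} (\<lambda>y. h y * F n y) \<and> \<bar>LINT y:{- R..R}|lborel. h y * F n y\<bar> \<le> e * (2 * R + 1)"
    if h: "h \<in> borel_measurable (restrict_space borel {- R..R})" and e: "0 \<le> e" "\<And>y. y \<in> {- R..R} \<Longrightarrow> \<bar>h y\<bar> \<le> e" for h e n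
  proof -
    have hm: "(\<lambda>y. indicator {- R..R} y *\<^sub>R h y) \<in> borel_measurable borel"
      using h by (subst (asm) borel_measurable_restrict_space_iff) auto
    have fm: "F n \<in> borel_measurable borel" using F by (simp add: in_Lp_def)
    have "(\<lambda>y. (indicator {- R..R} y *\<^sub>R h y) * F n y) \<in> borel_measurable borel"
      using hm fm by measurable
    then have hfm: "set_borel_measurable lborel {- R..R} (\<lambda>y. h y * F n y)"
      by (simp add: set_borel_measurable_def mult.assoc)
    have ef: "set_integrable lborel {- R..R} (\<lambda>y. e * \<bar>F n y\<bar>)"
      using fi by (intro set_integrable_mult_right set_integrable_abs) auto
    have le: "\<bar>h y * F n y\<bar> \<le> e * \<bar>F n y\<bar>" if "y \<in> {- R..R}" for y
      using e(2)[OF that] by (simp add: abs_mult mult_right_mono)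
    have I: "set_integrable lborel {- R..R} (\<lambda>y. h y * F n y)"
    proof (rule set_integrable_bound[OF ef hfm])
      show "AE x in lborel. x \<in> {- R..R} \<longrightarrow> norm (h x * F n x) \<le> norm (e * \<bar>F n x\<bar>)"
        using le e by (intro AE_I2) (auto simp: abs_mult)
    qed
    have "\<bar>LINT y:{- R..R}|lborel. h y * F n y\<bar> \<le> (LINT y:{- R..R}|lborel. \<bar>h y * F n y\<bar>)"
      using integral_abs_bound[of lborel "\<lambda>y. indicator {- R..R} y *\<^sub>R (h y * F n y)"]
      by (simp add: set_lebesgue_integral_def abs_mult)
    also have "\<dots> \<le> (LINT y:{- R..R}|lborel. e * \<bar>F n y\<bar>)"
      using I ef le by (intro set_integral_mono set_integrable_abs) auto
    also have "\<dots> \<le> e * (2 * R + 1)" using fi(2)[of n] e by (simp add: mult_left_mono)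
    finally show ?thesis using I by blast
  qed
  obtain g r where r: "strict_mono (r :: nat \<Rightarrow> nat)"
    and conv: "\<And>e. 0 < e \<Longrightarrow> \<exists>N. \<forall>n x. n \<ge> N \<and> x \<in> {- R..R} \<longrightarrow> norm (G (r n) x - g x) < e"
  proof (rule Arzela_Ascoli[of "{- R..R}" G "M * (2 * R + 1)"])
    show "norm (G n x) \<le> M * (2 * R + 1)" if "x \<in> {- R..R}" for n x
      using prod[OF m[OF that], of M n] M that by (simp add: G_def)
    show "\<exists>d>0. \<forall>n y. y \<in> {- R..R} \<and> norm (x - y) < d \<longrightarrow> norm (G n x - G n y) < e"
      if x: "x \<in> {- R..R}" and e: "0 < e" for x e
    proof -
      define e' where "e' = e / (2 * (2 * R + 1))"
      have "e / (2 * c) * c = e / 2" if "c \<noteq> 0" for c :: real using that by simp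
      from this[of "2 * R + 1"] have e': "0 < e'" "e' * (2 * R + 1) = e / 2"
        using e R by (auto simp: e'_def)
      obtain d where d: "0 < d" "\<And>z z'. z \<in> {- R..R} \<times> {- R..R} \<Longrightarrow> z' \<in> {- R..R} \<times> {- R..R} \<Longrightarrow>
          dist z' z < d \<Longrightarrow> dist (\<kappa> (fst z') (snd z')) (\<kappa> (fst z) (snd z)) < e'"
        using uc e'(1) unfolding uniformly_continuous_on_def by metis
      show ?thesis
      proof (intro exI[of _ d] conjI allI impI d(1))
        fix n y assume y: "y \<in> {- R..R} \<and> norm (x - y) < d"
        have close: "\<bar>\<kappa> x t - \<kappa> y t\<bar> \<le> e'" if "t \<in> {- R..R}" for t
          using d(2)[of "(y, t)" "(x, t)"] that x y by (simp add: dist_Pair_Pair dist_real_def)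
        have "G n x - G n y = (LINT t:{- R..R}|lborel. \<kappa> x t * F n t - \<kappa> y t * F n t)"
          unfolding G_def using prod[OF m[OF x], of M n] prod[OF m, of y M n] M x y
          by (intro set_integral_diff(2)[symmetric]) auto
        also have "\<dots> = (LINT t:{- R..R}|lborel. (\<kappa> x t - \<kappa> y t) * F n t)" by (simp add: algebra_simps)
        finally have "\<bar>G n x - G n y\<bar> \<le> e' * (2 * R + 1)"
          using prod[of "\<lambda>t. \<kappa> x t - \<kappa> y t" e' n] e'(1) close m[OF x] m[of y] y by simp
        then show "norm (G n x - G n y) < e" using e' e by simp
      qed
    qed
  qed auto
  show thesis
  proof (rule that[OF r])
    fix e :: real assume "0 < e"
    then obtain N where N: "\<And>n x. N \<le> n \<Longrightarrow> x \<in> {- R..R} \<Longrightarrow> \<bar>G (r n) x - g x\<bar> < e / 2"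
      using conv[of "e / 2"] by auto
    have "\<bar>G (r m) x - G (r n) x\<bar> < e" if "N \<le> m" "N \<le> n" "x \<in> {- R..R}" for m n x
      using N[OF that(1,3)] N[OF that(2,3)] by linarith
    then show "\<exists>N. \<forall>m\<ge>N. \<forall>n\<ge>N. \<forall>x\<in>{- R..R}.
      \<bar>(LINT y:{- R..R}|lborel. \<kappa> x y * F (r m) y) - (LINT y:{- R..R}|lborel. \<kappa> x y * F (r n) y)\<bar> < e"
      unfolding G_def by blast
  qed
qed

section \<open>Truncation of the commutator to a large square\<close>

lemma commutator_eq_kernel_integral:
  assumes "frac_integrable \<alpha> f x"
    and "frac_integrable \<alpha> (\<lambda>y. \<phi> y * f y) x"
  shows "integrable lborel (\<lambda>y. comm_kernel \<phi> \<alpha> x y * f y)"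
    and "commutator \<phi> \<alpha> f x = (LINT y|lborel. comm_kernel \<phi> \<alpha> x y * f y)"
proof -
  let ?g = "\<lambda>y. f y / (y - x) powr (1 - \<alpha>)" and ?h = "\<lambda>y. \<phi> y * f y / (y - x) powr (1 - \<alpha>)"
  have s: "set_integrable lborel {x<..} (\<lambda>y. \<phi> x * ?g y)"
    using assms(1) by (intro set_integrable_mult_right) auto
  have eq: "(\<lambda>y. indicator {x<..} y *\<^sub>R (\<phi> x * ?g y - ?h y)) = (\<lambda>y. comm_kernel \<phi> \<alpha> x y * f y)"
    by (auto simp: fun_eq_iff comm_kernel_def indicator_def algebra_simps diff_divide_distrib)
  from set_integral_diff(1)[OF s assms(2)] show "integrable lborel (\<lambda>y. comm_kernel \<phi> \<alpha> x y * f y)"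
    unfolding set_integrable_def eq .
  have "commutator \<phi> \<alpha> f x = (LINT y:{x<..}|lborel. \<phi> x * ?g y) - (LINT y:{x<..}|lborel. ?h y)"
    unfolding commutator_def frac_int_plus_def set_integral_mult_right ..
  also have "\<dots> = (LINT y:{x<..}|lborel. \<phi> x * ?g y - ?h y)"
    by (rule set_integral_diff(2)[OF s assms(2), symmetric])
  also have "\<dots> = (LINT y|lborel. comm_kernel \<phi> \<alpha> x y * f y)"
    unfolding set_lebesgue_integral_def eq ..
  finally show "commutator \<phi> \<alpha> f x = (LINT y|lborel. comm_kernel \<phi> \<alpha> x y * f y)" .
qed

text \<open>Only two regions outside the square contribute. For \<open>\<bar>x\<bar> \<le> A\<close>
  the remaining y exceed R, so \<phi> y = 0 and y - x \<ge> y/2; Hoelder's inequality then meets the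
  L^p' norm of y^(\<alpha> - 1) beyond R, finite because \<alpha> < 1/p. For x < -R only
  \<open>\<bar>y\<bar> \<le> A\<close> matters, y - x \<ge> -x/2, and f has L^1 norm at most 2 A + 1
  there. Elsewhere outside the square, \<phi> x = \<phi> y = 0 or y \<le> x.\<close>

lemma tail_pointwise:
  fixes p \<alpha> A M R :: real
  defines "p' \<equiv> p / (p - 1)"
  defines "e \<equiv> (\<alpha> - 1) * p'"
  assumes p: "1 < p" and \<alpha>: "\<alpha> < 1" "\<alpha> < 1 / p" and A: "0 < A" "2 * A \<le> R"
    and M: "0 \<le> M" "\<And>x. \<bar>\<phi> x\<bar> \<le> M" "\<And>x. A < \<bar>x\<bar> \<Longrightarrow> \<phi> x = 0"
    and f: "in_Lp p f" "powr_integral p f \<le> 1"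
    and int: "integrable lborel (\<lambda>y. comm_kernel \<phi> \<alpha> x y * f y)"
  shows "\<bar>(LINT y|lborel. comm_kernel \<phi> \<alpha> x y * f y)
      - indicator {- R..R} x * comm_integral \<phi> \<alpha> R f x\<bar>
    \<le> M * 2 powr (1 - \<alpha>) * ((R powr (e + 1) * (- 1 / (e + 1))) powr (1 / p')) * indicator {- A..A} x
      + M * 2 powr (1 - \<alpha>) * (2 * A + 1) * ((- x) powr (\<alpha> - 1) * indicator {..< - R} x)"
    (is "?E \<le> ?T1 * indicator {- A..A} x + ?T2")
proof -
  have [measurable]: "f \<in> borel_measurable borel" using f by (simp add: in_Lp_def)
  define j where "j y = comm_kernel \<phi> \<alpha> x y * f y" for y
  have j: "integrable lborel j" using int by (simp add: j_def[abs_def])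
  have T: "0 \<le> ?T1" "0 \<le> ?T2" using M A by auto
  have p': "1 < p'" "1 / p' + 1 / p = 1" using p by (auto simp: p'_def field_simps)
  have "(1 - \<alpha>) * p' > 1"
  proof -
    have "1 / p' < 1 - \<alpha>" using p'(2) \<alpha> by linarith
    then show ?thesis using p'(1) by (simp add: field_simps)
  qed
  then have e: "e < - 1" by (simp add: e_def algebra_simps)
  have R: "0 < R" using A by linarith
  have kpow: "(y - x) powr (\<alpha> - 1) \<le> 2 powr (1 - \<alpha>) * d powr (\<alpha> - 1)" if "0 < d" "d / 2 \<le> y - x" for y d
  proof -
    have "(y - x) powr (\<alpha> - 1) \<le> (d / 2) powr (\<alpha> - 1)" using that \<alpha> by (intro powr_mono2') auto
    also have "\<dots> = 2 powr (1 - \<alpha>) * d powr (\<alpha> - 1)" using that by (simp add: powr_divide powr_diff)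
    finally show ?thesis .
  qed
  have kabs: "\<bar>j y\<bar> = \<bar>\<phi> x - \<phi> y\<bar> * (y - x) powr (\<alpha> - 1) * \<bar>f y\<bar>" if "x < y" for y
    using that by (simp add: j_def comm_kernel_def abs_mult powr_diff)
  have j0: "j y = 0" if "y \<le> x" for y using that by (simp add: j_def comm_kernel_def)
  consider "x \<in> {- R..R}" "\<bar>x\<bar> \<le> A" | "x \<in> {- R..R}" "A < \<bar>x\<bar>" | "R < x" | "x < - R" by force
  then show ?thesis
  proof cases
    case 1
    let ?h = "\<lambda>y. indicator {R..} y * y powr (\<alpha> - 1)"
    have "(LINT y|lborel. j y) - (LINT y:{- R..R}|lborel. j y) = (LINT y|lborel. indicator (- {- R..R}) y *\<^sub>R j y)"
    proof -
      have "set_integrable lborel {- R..R} j" unfolding set_integrable_def using j by (intro integrable_mult_indicator) auto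
      then have "(LINT y|lborel. j y) - (LINT y:{- R..R}|lborel. j y) = (LINT y|lborel. j y - indicator {- R..R} y *\<^sub>R j y)"
        using j unfolding set_integrable_def set_lebesgue_integral_def
        by (intro Bochner_Integration.integral_diff[symmetric])
      also have "\<dots> = (LINT y|lborel. indicator (- {- R..R}) y *\<^sub>R j y)"
        by (intro Bochner_Integration.integral_cong) (auto simp: indicator_def)
      finally show ?thesis .
    qed
    then have "ennreal ?E = ennreal (norm (LINT y|lborel. indicator (- {- R..R}) y *\<^sub>R j y))"
      using 1 by (simp add: j_def[abs_def])
    also have "\<dots> \<le> (\<integral>\<^sup>+y. ennreal (norm (indicator (- {- R..R}) y *\<^sub>R j y)) \<partial>lborel)"
      using j by (intro integral_norm_bound_ennreal integrable_mult_indicator) auto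
    also have "\<dots> \<le> (\<integral>\<^sup>+y. ennreal (M * 2 powr (1 - \<alpha>)) * ennreal (?h y * \<bar>f y\<bar>) \<partial>lborel)"
    proof (intro nn_integral_mono)
      fix y
      show "ennreal (norm (indicator (- {- R..R}) y *\<^sub>R j y)) \<le> ennreal (M * 2 powr (1 - \<alpha>)) * ennreal (?h y * \<bar>f y\<bar>)"
      proof (cases "R < y")
        case True
        have y: "x < y" "\<phi> y = 0" "y / 2 \<le> y - x" "0 < y" using True 1 A R M(3)[of y] by auto
        have "\<bar>j y\<bar> = \<bar>\<phi> x\<bar> * (y - x) powr (\<alpha> - 1) * \<bar>f y\<bar>" using kabs[OF y(1)] y by simp
        also have "\<dots> \<le> M * (2 powr (1 - \<alpha>) * y powr (\<alpha> - 1)) * \<bar>f y\<bar>"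
          using y M by (intro mult_right_mono mult_mono kpow) auto
        finally have "\<bar>j y\<bar> \<le> (M * 2 powr (1 - \<alpha>)) * (?h y * \<bar>f y\<bar>)" using True by (simp add: mult_ac)
        then show ?thesis using M True by (simp add: ennreal_leI flip: ennreal_mult)
      next
        case False
        then have "y \<in> {- R..R} \<or> j y = 0" using 1 j0[of y] by (cases "y \<le> x") auto
        then have "indicator (- {- R..R}) y *\<^sub>R j y = 0" by (auto simp: indicator_def)
        then show ?thesis by (simp only: norm_zero ennreal_0 zero_le)
      qed
    qed
    also have "\<dots> = ennreal (M * 2 powr (1 - \<alpha>)) * (\<integral>\<^sup>+y. ennreal (?h y * \<bar>f y\<bar>) \<partial>lborel)"
      by (simp add: nn_integral_cmult)
    also have "\<dots> \<le> ennreal (M * 2 powr (1 - \<alpha>)) * ennreal (((R powr (e + 1) * (- 1 / (e + 1))) powr (1 / p')) * 1)"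
    proof (intro mult_left_mono Holder_bound[of p' p])
      have "(\<integral>\<^sup>+y. ennreal (?h y powr p') \<partial>lborel) = (\<integral>\<^sup>+y\<in>{R..}. ennreal (y powr e) \<partial>lborel)"
        by (intro nn_integral_cong) (auto simp: indicator_def powr_powr e_def)
      also have "\<dots> = ennreal (- (R powr (e + 1)) / (e + 1))" by (rule nn_integral_powr_tail[OF e R])
      also have "- (R powr (e + 1)) / (e + 1) = ((R powr (e + 1) * (- 1 / (e + 1))) powr (1 / p')) powr p'"
      proof -
        have Y: "- (R powr (e + 1)) / (e + 1) = R powr (e + 1) * (- 1 / (e + 1))" by simp
        have Y0: "0 \<le> R powr (e + 1) * (- 1 / (e + 1))"
          using e by (intro mult_nonneg_nonneg divide_nonpos_nonpos) auto
        have "1 / p' * p' = 1" using p' by simp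
        then show ?thesis unfolding Y powr_powr by (simp only: powr_one[OF Y0])
      qed
      finally show "(\<integral>\<^sup>+y. ennreal (?h y powr p') \<partial>lborel)
         \<le> ennreal (((R powr (e + 1) * (- 1 / (e + 1))) powr (1 / p')) powr p')" by simp
      have "(\<integral>\<^sup>+y. ennreal (\<bar>f y\<bar> powr p) \<partial>lborel) = ennreal (LINT y|lborel. \<bar>f y\<bar> powr p)"
        using f by (intro nn_integral_eq_integral) (auto simp: in_Lp_def)
      then show "(\<integral>\<^sup>+y. ennreal (\<bar>f y\<bar> powr p) \<partial>lborel) \<le> ennreal (1 powr p)"
        using f by (simp add: ennreal_leI)
      have "R powr (e + 1) * (- 1 / (e + 1)) \<noteq> 0" using R e by auto
      then show "0 < (R powr (e + 1) * (- 1 / (e + 1))) powr (1 / p')" by simp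
    qed (use p p' in auto)
    also have "\<dots> = ennreal ?T1" using M by (simp flip: ennreal_mult)
    finally have "?E \<le> ?T1" using T(1) by (simp add: ennreal_le_iff)
    then show ?thesis using 1 T(2) by (simp add: abs_le_iff)
  next
    case 2
    have "j y = indicator {- R..R} y *\<^sub>R j y" for y
    proof (cases "x < y \<and> y \<notin> {- R..R}")
      case True
      then have "\<phi> x = 0" "\<phi> y = 0" using 2 A M(3)[of x] M(3)[of y] by auto
      then show ?thesis by (simp add: j_def comm_kernel_def)
    next
      case False
      then show ?thesis using j0[of y] by (auto simp: indicator_def)
    qed
    then have "(LINT y|lborel. j y) = (LINT y:{- R..R}|lborel. j y)"
      unfolding set_lebesgue_integral_def by (intro Bochner_Integration.integral_cong) auto
    then have "?E = 0" using 2 by (simp add: j_def[abs_def])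
    then show ?thesis using T by simp
  next
    case 3
    have "j y = 0" for y
    proof (cases "x < y")
      case True
      then have "\<phi> x = 0" "\<phi> y = 0" using 3 A M(3)[of x] M(3)[of y] by auto
      then show ?thesis by (simp add: j_def comm_kernel_def)
    qed (simp add: j0)
    then have "(\<lambda>y. comm_kernel \<phi> \<alpha> x y * f y) = (\<lambda>_. 0)" unfolding j_def by blast
    then have "?E = 0" using 3 by simp
    then show ?thesis using T by simp
  next
    case 4
    have \<phi>x: "\<phi> x = 0" using 4 A by (intro M(3)) auto
    have "\<bar>j y\<bar> \<le> indicator {- A..A} y *\<^sub>R (M * (2 powr (1 - \<alpha>) * (- x) powr (\<alpha> - 1)) * \<bar>f y\<bar>)" for y
    proof (cases "x < y \<and> \<bar>y\<bar> \<le> A")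
      case True
      have "\<bar>j y\<bar> = \<bar>\<phi> y\<bar> * (y - x) powr (\<alpha> - 1) * \<bar>f y\<bar>" using kabs[of y] True \<phi>x by simp
      also have "\<dots> \<le> M * (2 powr (1 - \<alpha>) * (- x) powr (\<alpha> - 1)) * \<bar>f y\<bar>"
        using 4 True M A by (intro mult_right_mono mult_mono kpow) auto
      finally show ?thesis using True by (simp add: abs_le_iff)
    next
      case False
      then have "j y = 0" using j0[of y] \<phi>x M(3)[of y] by (auto simp: j_def comm_kernel_def not_le)
      then show ?thesis using M by (simp add: indicator_def)
    qed
    moreover have fA: "set_integrable lborel {- A..A} f" "(LINT x:{- A..A}|lborel. \<bar>f x\<bar>) \<le> 2 * A + 1"
      using integral_Lp_interval_le[OF _ f, of A] p A by auto
    moreover have "set_integrable lborel {- A..A} (\<lambda>y. M * (2 powr (1 - \<alpha>) * (- x) powr (\<alpha> - 1)) * \<bar>f y\<bar>)"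
      using fA by (intro set_integrable_mult_right set_integrable_abs) auto
    ultimately have "(LINT y|lborel. \<bar>j y\<bar>) \<le> (LINT y:{- A..A}|lborel. M * (2 powr (1 - \<alpha>) * (- x) powr (\<alpha> - 1)) * \<bar>f y\<bar>)"
      unfolding set_lebesgue_integral_def set_integrable_def using j by (intro integral_mono) auto
    also have "\<dots> = M * (2 powr (1 - \<alpha>) * (- x) powr (\<alpha> - 1)) * (LINT y:{- A..A}|lborel. \<bar>f y\<bar>)" by simp
    also have "\<dots> \<le> M * (2 powr (1 - \<alpha>) * (- x) powr (\<alpha> - 1)) * (2 * A + 1)"
      using fA M by (intro mult_left_mono) auto
    also have "\<dots> = ?T2" using 4 by (simp add: mult_ac)
    finally have "\<bar>LINT y|lborel. j y\<bar> \<le> ?T2" using integral_abs_bound[of lborel j] by linarith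
    moreover have "?E = \<bar>LINT y|lborel. j y\<bar>" using 4 by (simp add: j_def[abs_def])
    ultimately show ?thesis using T(1) by (auto simp: indicator_def)
  qed
qed

lemma nn_integral_powr_left_tail:
  fixes e a :: real
  assumes "e < - 1" "0 < a"
  shows "(\<integral>\<^sup>+x. ennreal ((- x) powr e * indicator {..< - a} x) \<partial>lborel) \<le> ennreal (- (a powr (e + 1)) / (e + 1))"
proof -
  have "(\<integral>\<^sup>+x. ennreal ((- x) powr e * indicator {..< - a} x) \<partial>lborel)
     = (\<integral>\<^sup>+x. ennreal (x powr e * indicator {..< - a} (- x)) \<partial>lborel)"
    by (subst nn_integral_real_affine[of _ "-1" 0]) auto
  also have "\<dots> \<le> (\<integral>\<^sup>+x\<in>{a..}. ennreal (x powr e) \<partial>lborel)"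
    by (intro nn_integral_mono) (auto simp: indicator_def)
  finally show ?thesis using nn_integral_powr_tail[OF assms] by simp
qed

text \<open>Both pointwise errors vanish in L^q as R grows. The first lives on a fixed interval and
  carries a shrinking L^p' norm; the second is a tail of
  \<open>\<bar>x\<bar> powr (\<alpha> - 1)\<close>, whose q-th power is integrable at infinity
  because 1/q < 1 - \<alpha> amounts to 1/p < 1. \<open>R\<close> is chosen before f.\<close>

lemma commutator_tail:
  fixes p q \<alpha> A M \<epsilon> :: real
  assumes p: "1 < p" and q: "p < q" and \<alpha>: "0 < \<alpha>" "\<alpha> < 1" "1 / q = 1 / p - \<alpha>" and A: "0 < A"
    and M: "0 \<le> M" "\<And>x. \<bar>\<phi> x\<bar> \<le> M" "\<And>x. A < \<bar>x\<bar> \<Longrightarrow> \<phi> x = 0" and \<epsilon>: "0 < \<epsilon>"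
  obtains R where "0 \<le> R" and "\<And>f. in_Lp p f \<Longrightarrow> powr_integral p f \<le> 1 \<Longrightarrow>
      (AE x in lborel. frac_integrable \<alpha> f x \<and>
        frac_integrable \<alpha> (\<lambda>y. \<phi> y * f y) x) \<Longrightarrow>
      (\<integral>\<^sup>+x. ennreal (\<bar>commutator \<phi> \<alpha> f x
        - indicator {- R..R} x * comm_integral \<phi> \<alpha> R f x\<bar> powr q) \<partial>lborel) \<le> ennreal \<epsilon>"
proof -
  define p' e e2 where "p' = p / (p - 1)" and "e = (\<alpha> - 1) * p'" and "e2 = (\<alpha> - 1) * q"
  have p': "1 < p'" "1 / p' + 1 / p = 1" using p by (auto simp: p'_def field_simps)
  have q1: "1 < q" using p q by simp
  have \<alpha>p: "\<alpha> < 1 / p" using \<alpha> q1 by (smt (verit) zero_less_divide_1_iff)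
  have e: "e < - 1"
  proof -
    have "1 / p' < 1 - \<alpha>" using p'(2) \<alpha>p by linarith
    then have "(1 - \<alpha>) * p' > 1" using p'(1) by (simp add: field_simps)
    then show ?thesis by (simp add: e_def algebra_simps)
  qed
  have e2: "e2 < - 1"
  proof -
    have "1 / p < 1" using p by simp
    then have "1 / q < 1 - \<alpha>" using \<alpha> by linarith
    then have "(1 - \<alpha>) * q > 1" using q1 by (simp add: field_simps)
    then show ?thesis by (simp add: e2_def algebra_simps)
  qed
  define X where "X R = (R powr (e + 1) * (- 1 / (e + 1))) powr (1 / p')" for R
  define c d where "c = M * 2 powr (1 - \<alpha>)" and "d = M * 2 powr (1 - \<alpha>) * (2 * A + 1)"
  have cd: "0 \<le> c" "0 \<le> d" using M A by (auto simp: c_def d_def)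
  \<comment> \<open>An explicit bound for the q-th power of the error norm: \<open>2 powr q\<close>
    comes from splitting the sum, \<open>2 * A\<close> is the length of the fixed interval, and the
    last term integrates the tail.\<close>
  define \<Phi> where "\<Phi> R = 2 powr q * ((c * X R) powr q * (2 * A) + d powr q * (- (R powr (e2 + 1)) / (e2 + 1)))" for R
  have zero_powr: "((\<lambda>R. h R powr t) \<longlongrightarrow> 0) at_top"
    if "(h \<longlongrightarrow> 0) at_top" "\<And>R. 0 \<le> h R" "0 < t" for h :: "real \<Rightarrow> real" and t
    using tendsto_powr'[OF that(1) tendsto_const[of t]] that(2,3) by simp
  have t1: "((\<lambda>R. R powr (e + 1)) \<longlongrightarrow> 0) at_top" "((\<lambda>R. R powr (e2 + 1)) \<longlongrightarrow> 0) at_top"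
    using e e2 by (auto intro!: tendsto_neg_powr filterlim_ident)
  have k: "0 \<le> - 1 / (e + 1)" using e by (intro divide_nonpos_nonpos) auto
  have t2: "(X \<longlongrightarrow> 0) at_top"
    unfolding X_def using p' k by (intro zero_powr tendsto_mult_left_zero t1 mult_nonneg_nonneg) auto
  have t3: "((\<lambda>R. (c * X R) powr q) \<longlongrightarrow> 0) at_top"
    using q1 cd by (intro zero_powr tendsto_mult_right_zero t2) (auto simp: X_def)
  have "(\<Phi> \<longlongrightarrow> 2 powr q * (0 * (2 * A) + d powr q * (- 0 / (e2 + 1)))) at_top"
    unfolding \<Phi>_def using e2 by (intro tendsto_mult tendsto_add tendsto_divide tendsto_minus tendsto_const t1 t3) auto
  then have "(\<Phi> \<longlongrightarrow> 0) at_top" by simp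
  then have "\<forall>\<^sub>F R in at_top. \<Phi> R < \<epsilon>" using \<epsilon> by (intro order_tendstoD) auto
  then have "\<forall>\<^sub>F R in at_top. \<Phi> R < \<epsilon> \<and> 2 * A \<le> R" by (intro eventually_conj eventually_ge_at_top)
  then obtain R where R: "\<Phi> R < \<epsilon>" "2 * A \<le> R" using eventually_happens[of _ at_top] by force
  have R0: "0 < R" using R A by linarith
  show thesis
  proof (rule that[of R])
    show "0 \<le> R" using R0 by simp
    fix f assume f: "in_Lp p f" "powr_integral p f \<le> 1"
      and ae: "AE x in lborel. frac_integrable \<alpha> f x \<and>
        frac_integrable \<alpha> (\<lambda>y. \<phi> y * f y) x"
    let ?E = "\<lambda>x. \<bar>commutator \<phi> \<alpha> f x - indicator {- R..R} x * comm_integral \<phi> \<alpha> R f x\<bar>"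
    have pw: "AE x in lborel. ?E x powr q \<le> 2 powr q * ((c * X R) powr q * indicator {- A..A} x
        + d powr q * ((- x) powr e2 * indicator {..< - R} x))"
      using ae
    proof eventually_elim
      case (elim x)
      note k = commutator_eq_kernel_integral[of x f \<alpha> \<phi>, OF conjunct1[OF elim] conjunct2[OF elim]]
      have "?E x \<le> c * X R * indicator {- A..A} x + d * ((- x) powr (\<alpha> - 1) * indicator {..< - R} x)"
        unfolding k(2) c_def d_def X_def e_def p'_def
        by (rule tail_pointwise[OF p \<alpha>(2) \<alpha>p A R(2) M f k(1)])
      then have "?E x powr q \<le> (c * X R * indicator {- A..A} x + d * ((- x) powr (\<alpha> - 1) * indicator {..< - R} x)) powr q"
        using q1 by (intro powr_mono2) auto
      also have "\<dots> \<le> 2 powr q * ((c * X R * indicator {- A..A} x) powr q + (d * ((- x) powr (\<alpha> - 1) * indicator {..< - R} x)) powr q)"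
        using cd q1 by (intro powr_add_le) (auto simp: X_def)
      also have "(c * X R * indicator {- A..A} x) powr q = (c * X R) powr q * indicator {- A..A} x"
        by (simp add: indicator_def)
      also have "(d * ((- x) powr (\<alpha> - 1) * indicator {..< - R} x)) powr q = d powr q * ((- x) powr e2 * indicator {..< - R} x)"
        using cd by (simp add: indicator_def powr_mult powr_powr e2_def)
      finally show ?case .
    qed
    have "(\<integral>\<^sup>+x. ennreal (?E x powr q) \<partial>lborel) \<le> (\<integral>\<^sup>+x. ennreal (2 powr q) * (ennreal ((c * X R) powr q) * indicator {- A..A} x
        + ennreal (d powr q) * ennreal ((- x) powr e2 * indicator {..< - R} x)) \<partial>lborel)"
    proof (intro nn_integral_mono_AE)
      show "AE x in lborel. ennreal (?E x powr q) \<le> ennreal (2 powr q) * (ennreal ((c * X R) powr q) * indicator {- A..A} x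
        + ennreal (d powr q) * ennreal ((- x) powr e2 * indicator {..< - R} x))"
        using pw
      proof eventually_elim
        case (elim x)
        have "ennreal (?E x powr q) \<le> ennreal (2 powr q * ((c * X R) powr q * indicator {- A..A} x
          + d powr q * ((- x) powr e2 * indicator {..< - R} x)))" by (rule ennreal_leI[OF elim])
        also have "\<dots> = ennreal (2 powr q) * (ennreal ((c * X R) powr q) * ennreal (indicator {- A..A} x)
          + ennreal (d powr q) * ennreal ((- x) powr e2 * indicator {..< - R} x))"
          by (simp add: ennreal_mult)
        finally show ?case by (simp add: ennreal_indicator)
      qed
    qed
    also have "\<dots> = ennreal (2 powr q) * (ennreal ((c * X R) powr q) * ennreal (2 * A)
        + ennreal (d powr q) * (\<integral>\<^sup>+x. ennreal ((- x) powr e2 * indicator {..< - R} x) \<partial>lborel))"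
      using A by (simp add: nn_integral_cmult nn_integral_add nn_integral_cmult_indicator)
    also have "\<dots> \<le> ennreal (2 powr q) * (ennreal ((c * X R) powr q) * ennreal (2 * A)
        + ennreal (d powr q) * ennreal (- (R powr (e2 + 1)) / (e2 + 1)))"
      by (intro mult_left_mono add_left_mono nn_integral_powr_left_tail e2 R0) auto
    also have "\<dots> = ennreal (\<Phi> R)"
    proof -
      have "0 \<le> - (R powr (e2 + 1)) / (e2 + 1)" using e2 by (intro divide_nonpos_nonpos) auto
      moreover have "ennreal x * (ennreal y * ennreal z + ennreal v * ennreal w) = ennreal (x * (y * z + v * w))"
        if "0 \<le> x" "0 \<le> y" "0 \<le> z" "0 \<le> v" "0 \<le> w" for x y z v w
        using that by (simp add: ennreal_mult)
      ultimately show ?thesis unfolding \<Phi>_def using A powr_ge_zero by force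
    qed
    also have "\<dots> \<le> ennreal \<epsilon>" using R by (intro ennreal_leI) auto
    finally show "(\<integral>\<^sup>+x. ennreal (?E x powr q) \<partial>lborel) \<le> ennreal \<epsilon>" .
  qed
qed

section \<open>Approximation by smooth symbols and extraction of a subsequence\<close>

lemma smooth_cc_facts:
  assumes "smooth_cc \<phi>"
  obtains A M where "0 < A" "0 \<le> M" "\<And>x. isCont \<phi> x" "\<And>x. \<bar>\<phi> x\<bar> \<le> M" "\<And>x. A < \<bar>x\<bar> \<Longrightarrow> \<phi> x = 0"
    "\<And>R. \<exists>L. \<forall>x\<in>{- R..R}. \<forall>y\<in>{- R..R}. \<bar>\<phi> x - \<phi> y\<bar> \<le> L * \<bar>x - y\<bar>"
proof -
  have d: "(deriv ^^ n) \<phi> differentiable (at x)" for n x using assms by (simp add: smooth_cc_def)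
  have d0: "\<phi> differentiable (at x)" for x using d[of 0] by simp
  have d1: "deriv \<phi> differentiable (at x)" for x using d[of 1] by simp
  have cont: "isCont \<phi> x" for x using d0 by (intro differentiable_imp_continuous_within)
  have "bounded (closure {x. \<phi> x \<noteq> 0})" using assms unfolding smooth_cc_def by (intro compact_imp_bounded) (rule conjunct2)
  then have "\<exists>B. \<forall>x\<in>closure {x. \<phi> x \<noteq> 0}. norm x \<le> B" by (simp only: bounded_iff)
  then obtain B where B: "\<forall>x\<in>closure {x. \<phi> x \<noteq> 0}. norm x \<le> B" by (rule exE)
  \<comment> \<open>The maximum with 1 keeps the radius positive even when the support is
    empty.\<close>
  define A where "A = max B 1"
  have supp: "\<phi> x = 0" if "A < \<bar>x\<bar>" for x
  proof (rule ccontr)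
    assume "\<phi> x \<noteq> 0"
    then have "x \<in> closure {x. \<phi> x \<noteq> 0}" by (intro subsetD[OF closure_subset]) simp
    with B have "norm x \<le> B" by (rule bspec)
    then show False using that by (simp add: A_def)
  qed
  have "compact (\<phi> ` {- A..A})"
    using cont by (intro compact_continuous_image continuous_at_imp_continuous_on) auto
  then have "bounded (\<phi> ` {- A..A})" by (rule compact_imp_bounded)
  then have "\<exists>M0. \<forall>x\<in>{- A..A}. \<bar>\<phi> x\<bar> \<le> M0" by (auto simp: bounded_iff)
  then obtain M0 where M0: "\<forall>x\<in>{- A..A}. \<bar>\<phi> x\<bar> \<le> M0" by (rule exE)
  have M: "\<bar>\<phi> x\<bar> \<le> max M0 0" for x
  proof (cases "x \<in> {- A..A}")
    case True
    with M0 have "\<bar>\<phi> x\<bar> \<le> M0" by (rule bspec)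
    then show ?thesis by simp
  next
    case False
    then have "A < \<bar>x\<bar>" by auto
    then show ?thesis by (simp add: supp)
  qed
  have Lip: "\<exists>L. \<forall>x\<in>{- R..R}. \<forall>y\<in>{- R..R}. \<bar>\<phi> x - \<phi> y\<bar> \<le> L * \<bar>x - y\<bar>" for R
  proof -
    have "isCont (deriv \<phi>) x" for x using d1 by (intro differentiable_imp_continuous_within)
    then have "compact (deriv \<phi> ` {- R..R})"
      by (intro compact_continuous_image continuous_at_imp_continuous_on) auto
    then have "bounded (deriv \<phi> ` {- R..R})" by (rule compact_imp_bounded)
    then have "\<exists>L. \<forall>x\<in>{- R..R}. norm (deriv \<phi> x) \<le> L" by (auto simp: bounded_iff)
    then obtain L where L: "\<forall>x\<in>{- R..R}. norm (deriv \<phi> x) \<le> L" by (rule exE)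
    have df: "(\<phi> has_field_derivative deriv \<phi> x) (at x within {- R..R})" for x
      by (rule has_field_derivative_at_within) (simp add: DERIV_deriv_iff_real_differentiable d0)
    show ?thesis
    proof (intro exI[of _ L] ballI)
      fix x y assume xy: "x \<in> {- R..R}" "y \<in> {- R..R}"
      have "norm (\<phi> x - \<phi> y) \<le> L * norm (x - y)"
        by (rule field_differentiable_bound[of "{- R..R}" \<phi> "deriv \<phi>"]) (use xy df bspec[OF L] in auto)
      then show "\<bar>\<phi> x - \<phi> y\<bar> \<le> L * \<bar>x - y\<bar>" by simp
    qed
  qed
  show thesis
  proof (rule that[of A "max M0 0"])
    show "0 < A" by (simp add: A_def)
    show "0 \<le> max M0 0" by simp
  qed (fact cont M supp Lip)+
qed

lemma continuous_loc_integrable: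
  assumes "\<And>x. isCont \<phi> x" shows "loc_integrable \<phi>"
proof -
  have c: "continuous_on UNIV \<phi>" using assms by (intro continuous_at_imp_continuous_on) auto
  then show ?thesis unfolding loc_integrable_def
    by (auto intro!: borel_measurable_continuous_onI borel_integrable_atLeastAtMost' continuous_on_subset[OF c])
qed

lemma Lp_norm_le_1_iff:
  assumes "0 < p" shows "Lp_norm p f \<le> 1 \<longleftrightarrow> powr_integral p f \<le> 1"
proof -
  have "0 \<le> powr_integral p f" by simp
  then show ?thesis unfolding Lp_norm_def using assms
    by (metis powr_one_eq_one powr_mono2 powr_le1 powr_less_mono2 divide_pos_pos linorder_not_le zero_less_one order.strict_implies_order)
qed

lemma commutator_diff:
  assumes "frac_integrable \<alpha> (\<lambda>y. b y * f y) x"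
    and "frac_integrable \<alpha> (\<lambda>y. \<phi> y * f y) x"
  shows "commutator (\<lambda>x. b x - \<phi> x) \<alpha> f x = commutator b \<alpha> f x - commutator \<phi> \<alpha> f x"
proof -
  have "frac_int_plus \<alpha> (\<lambda>y. (b y - \<phi> y) * f y) x = frac_int_plus \<alpha> (\<lambda>y. b y * f y) x - frac_int_plus \<alpha> (\<lambda>y. \<phi> y * f y) x"
    unfolding frac_int_plus_def set_integral_diff(2)[OF assms, symmetric]
    by (simp add: algebra_simps diff_divide_distrib)
  then show ?thesis by (simp add: commutator_def algebra_simps)
qed

text \<open>A quasi-triangle inequality in the shape of the later splitting: two parts with a symbol
  small in BMO, two tails, and one difference of truncated integrals. Three nested splittings
  produce the cube.\<close>

lemma powr_sum5_le:
  fixes a b c d e q :: real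
  assumes "0 \<le> q"
  shows "\<bar>(a - b) + (c - d) + e\<bar> powr q
    \<le> (2 powr q) ^ 3 * (\<bar>a\<bar> powr q + \<bar>b\<bar> powr q + \<bar>c\<bar> powr q + \<bar>d\<bar> powr q + \<bar>e\<bar> powr q)"
proof -
  have K: "1 \<le> 2 powr q" using assms by (simp add: ge_one_powr_ge_zero)
  have add: "\<bar>x + y\<bar> powr q \<le> 2 powr q * (\<bar>x\<bar> powr q + \<bar>y\<bar> powr q)" for x y :: real
    using powr_diff_le[OF assms, of x "- y"] by simp
  define K where "K = 2 powr q"
  have "\<bar>(a - b) + (c - d) + e\<bar> powr q \<le> K * (\<bar>(a - b) + (c - d)\<bar> powr q + \<bar>e\<bar> powr q)"
    unfolding K_def by (rule add)
  also have "\<dots> \<le> K * (K * (\<bar>a - b\<bar> powr q + \<bar>c - d\<bar> powr q) + \<bar>e\<bar> powr q)"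
    unfolding K_def by (intro mult_left_mono add_right_mono add) auto
  also have "\<dots> \<le> K * (K * (K * (\<bar>a\<bar> powr q + \<bar>b\<bar> powr q) + K * (\<bar>c\<bar> powr q + \<bar>d\<bar> powr q)) + \<bar>e\<bar> powr q)"
    unfolding K_def by (intro mult_left_mono add_right_mono add_mono powr_diff_le assms) auto
  also have "\<dots> \<le> K * (K * (K * (\<bar>a\<bar> powr q + \<bar>b\<bar> powr q) + K * (\<bar>c\<bar> powr q + \<bar>d\<bar> powr q)) + K * K * \<bar>e\<bar> powr q)"
  proof -
    have "1 * 1 \<le> K * K" using K unfolding K_def by (intro mult_mono) auto
    then have "1 * \<bar>e\<bar> powr q \<le> K * K * \<bar>e\<bar> powr q" by (intro mult_right_mono) auto
    then show ?thesis unfolding K_def by (intro mult_left_mono add_left_mono) auto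
  qed
  finally show ?thesis by (simp add: K_def[symmetric] power3_eq_cube algebra_simps)
qed

lemma commutator_in_Lq:
  fixes p q \<alpha> :: real
  assumes pq: "1 < p" "p < q" "0 < \<alpha>" "\<alpha> < 1" "1 / q = 1 / p - \<alpha>"
    and b: "in_BMO b" and f: "in_Lp p f"
  shows "in_Lp q (commutator b \<alpha> f)"
proof -
  obtain C where C: "\<And>b B f. loc_integrable b \<Longrightarrow> 0 < B \<Longrightarrow> osc_le b B \<Longrightarrow>
      in_Lp p f \<Longrightarrow> powr_integral p f \<le> 1 \<Longrightarrow>
      (powr_nn_integral q (commutator b \<alpha> f)) \<le> ennreal ((C * B) powr q)"
    by (rule commutator_bound[OF pq]) (rule that; assumption)
  have bl: "loc_integrable b" using b by (rule in_BMO_loc_integrable)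
  from b have "bdd_above {mean_osc b a c | a c. a < c}" by (simp add: in_BMO_def)
  then obtain B0 where B0: "\<And>a c. a < c \<Longrightarrow> mean_osc b a c \<le> B0" by (auto simp: bdd_above_def)
  \<comment> \<open>The operator bound asks for a positive oscillation bound, whereas
    \<open>B0\<close> may be 0, for instance for constant \<open>b\<close>.\<close>
  have B: "osc_le b (max B0 1)" using B0 by (auto simp: le_max_iff_disj)
  obtain c where c: "0 < c" "in_Lp p (\<lambda>x. c * f x)" "powr_integral p (\<lambda>x. c * f x) \<le> 1"
    using in_Lp_normalize[of p f] f pq by auto
  have [measurable]: "f \<in> borel_measurable borel" "b \<in> borel_measurable borel"
    using f bl by (auto simp: in_Lp_def loc_integrable_def)
  have [measurable]: "commutator b \<alpha> f \<in> borel_measurable borel" by (intro commutator_measurable) auto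
  have "powr_nn_integral q (\<lambda>x. commutator b \<alpha> (\<lambda>x. c * f x) x) < \<infinity>"
    using C[OF bl _ B c(2,3)] by (rule order.strict_trans1) auto
  also have "(\<lambda>x. ennreal (\<bar>commutator b \<alpha> (\<lambda>x. c * f x) x\<bar> powr q))
      = (\<lambda>x. ennreal (c powr q) * ennreal (\<bar>commutator b \<alpha> f x\<bar> powr q))"
    using c(1) by (simp add: commutator_scale abs_mult powr_mult ennreal_mult)
  finally have "ennreal (c powr q) * (powr_nn_integral q (commutator b \<alpha> f)) < \<infinity>"
    by (simp add: nn_integral_cmult)
  then have "powr_nn_integral q (commutator b \<alpha> f) < \<infinity>"
    using c(1) by (auto simp: ennreal_mult_less_top)
  then show ?thesis by (simp add: in_Lp_iff_nn_integral)
qed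

text \<open>The approximating \<phi> and the square depend on \<epsilon>, so one \<epsilon> yields
  only a subsequence whose images are eventually \<epsilon>-close. Passing to all \<epsilon> is left
  to a diagonal argument.\<close>

lemma commutator_almost_Cauchy_subseq:
  fixes p q \<alpha> \<epsilon> :: real and F :: "nat \<Rightarrow> real \<Rightarrow> real"
  assumes pq: "1 < p" "p < q" "0 < \<alpha>" "\<alpha> < 1" "1 / q = 1 / p - \<alpha>" and b: "in_CMO b" and \<epsilon>: "0 < \<epsilon>"
    and F: "\<And>n. in_Lp p (F n)" "\<And>n. powr_integral p (F n) \<le> 1"
  shows "\<exists>r :: nat \<Rightarrow> nat. strict_mono r \<and> (\<exists>N. \<forall>m\<ge>N. \<forall>n\<ge>N.
    (powr_nn_integral q (\<lambda>x. commutator b \<alpha> (F (r m)) x - commutator b \<alpha> (F (r n)) x)) \<le> ennreal \<epsilon>)"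
proof -
  have q: "1 < q" using pq by simp
  obtain C where C: "0 < C" "\<And>b B f. loc_integrable b \<Longrightarrow> 0 < B \<Longrightarrow> osc_le b B \<Longrightarrow>
      in_Lp p f \<Longrightarrow> powr_integral p f \<le> 1 \<Longrightarrow>
      (powr_nn_integral q (commutator b \<alpha> f)) \<le> ennreal ((C * B) powr q)"
     "\<And>b B f. loc_integrable b \<Longrightarrow> 0 < B \<Longrightarrow> osc_le b B \<Longrightarrow> in_Lp p f \<Longrightarrow>
      AE x in lborel. frac_integrable \<alpha> f x \<and>
        frac_integrable \<alpha> (\<lambda>y. b y * f y) x"
    by (rule commutator_bound[OF pq]) (rule that; assumption)
  define K where "K = (2 powr q) ^ 3"
  have K: "0 < K" by (simp add: K_def)
  \<comment> \<open>Five terms of size at most \<eta>, multiplied by the quasi-triangle constant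
    \<open>K\<close>, add up to \<epsilon>.\<close>
  define \<eta> where "\<eta> = \<epsilon> / (5 * K)"
  have \<eta>: "0 < \<eta>" using \<epsilon> K by (simp add: \<eta>_def)
  \<comment> \<open>The BMO distance between \<open>b\<close> and \<phi> at which the operator bound
    C B equals \<eta>^(1/q).\<close>
  define B where "B = \<eta> powr (1 / q) / C"
  have B: "0 < B" "(C * B) powr q = \<eta>" using C(1) \<eta> q by (auto simp: B_def powr_powr)
  have bB: "in_BMO b" using b by (simp add: in_CMO_def)
  have bl: "loc_integrable b" using bB by (rule in_BMO_loc_integrable)
  from bB have "bdd_above {mean_osc b a c | a c. a < c}" by (simp add: in_BMO_def)
  then obtain B0 where B0: "\<And>a c. a < c \<Longrightarrow> mean_osc b a c \<le> B0" by (auto simp: bdd_above_def)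
  have B0': "osc_le b (max B0 1)" using B0 by (auto simp: le_max_iff_disj)
  obtain \<phi> where \<phi>: "smooth_cc \<phi>" "BMO_norm (\<lambda>x. b x - \<phi> x) < B" using b B(1) unfolding in_CMO_def by blast
  obtain A M where A: "0 < A" and M: "0 \<le> M" "\<And>x. \<bar>\<phi> x\<bar> \<le> M" "\<And>x. A < \<bar>x\<bar> \<Longrightarrow> \<phi> x = 0"
    and cont: "\<And>x. isCont \<phi> x"
    and Lip: "\<And>R. \<exists>L. \<forall>x\<in>{- R..R}. \<forall>y\<in>{- R..R}. \<bar>\<phi> x - \<phi> y\<bar> \<le> L * \<bar>x - y\<bar>"
    by (rule smooth_cc_facts[OF \<phi>(1)]) (rule that; assumption)
  have \<phi>l: "loc_integrable \<phi>" using cont by (rule continuous_loc_integrable)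
  have \<phi>M: "osc_le \<phi> (2 * M + 1)"
  proof (intro allI impI)
    fix a c :: real assume "a < c"
    then show "mean_osc \<phi> a c \<le> 2 * M + 1" using mean_osc_bounded[OF \<phi>l M(2)] by fastforce
  qed
  define b' where "b' x = b x - \<phi> x" for x
  have b'l: "loc_integrable b'"
    using bl \<phi>l unfolding loc_integrable_def b'_def by auto
  have b'B: "osc_le b' B"
  proof (intro allI impI)
    fix a c :: real assume ac: "a < c"
    \<comment> \<open>A real \<open>Sup\<close> bounds its elements only if the set is bounded
      above, so the oscillations of the difference are first bounded by those of \<open>b\<close>
      and \<phi>.\<close>
    have "mean_osc b' u v \<le> B0 + (2 * M + 1)" if "u < v" for u v
      using mean_osc_diff_le[OF bl \<phi>l that] B0[OF that] \<phi>M that unfolding b'_def by fastforce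
    then have "bdd_above {mean_osc b' u v | u v. u < v}" by (auto simp: bdd_above_def)
    then have "mean_osc b' a c \<le> BMO_norm b'" unfolding BMO_norm_def using ac by (intro cSup_upper) auto
    also have "\<dots> < B" using \<phi>(2) by (simp add: b'_def[abs_def])
    finally show "mean_osc b' a c \<le> B" by simp
  qed
  have M1: "0 < 2 * M + 1" using M by simp
  have B01: "0 < max B0 1" by simp
  note ae\<phi> = C(3)[OF \<phi>l M1 \<phi>M F(1)] and aeb = C(3)[OF bl B01 B0' F(1)]
  obtain R where R: "0 \<le> R" "\<And>f. in_Lp p f \<Longrightarrow> powr_integral p f \<le> 1 \<Longrightarrow>
      (AE x in lborel. frac_integrable \<alpha> f x \<and>
        frac_integrable \<alpha> (\<lambda>y. \<phi> y * f y) x) \<Longrightarrow>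
      (\<integral>\<^sup>+x. ennreal (\<bar>commutator \<phi> \<alpha> f x
        - indicator {- R..R} x * comm_integral \<phi> \<alpha> R f x\<bar> powr q) \<partial>lborel) \<le> ennreal \<eta>"
    by (rule commutator_tail[where \<phi> = \<phi>, OF pq A M \<eta>]) (assumption | (rule that; assumption))+
  obtain L where L: "\<forall>x\<in>{- R..R}. \<forall>y\<in>{- R..R}. \<bar>\<phi> x - \<phi> y\<bar> \<le> L * \<bar>x - y\<bar>" using Lip by blast
  have kc: "continuous_on ({- R..R} \<times> {- R..R}) (\<lambda>z. comm_kernel \<phi> \<alpha> (fst z) (snd z))"
    using pq cont L by (intro comm_kernel_continuous[where L = L]) auto
  define G where "G n x = comm_integral \<phi> \<alpha> R (F n) x" for n x
  obtain r where r: "strict_mono (r :: nat \<Rightarrow> nat)" "\<And>e. 0 < e \<Longrightarrow> \<exists>N. \<forall>m\<ge>N. \<forall>n\<ge>N. \<forall>x\<in>{- R..R}. \<bar>G (r m) x - G (r n) x\<bar> < e"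
    by (rule truncated_kernel_compact[where F = F, OF less_imp_le[OF pq(1)] R(1) kc F, folded G_def]) (rule that; assumption)
  \<comment> \<open>A uniform distance that costs at most \<eta> after taking q-th powers and
    integrating over an interval of length 2 R; \<open>2 * R + 1\<close> avoids division by
    0.\<close>
  define e where "e = (\<eta> / (2 * R + 1)) powr (1 / q)"
  have e: "0 < e" "e powr q * (2 * R) \<le> \<eta>"
  proof -
    show "0 < e" using \<eta> R(1) by (simp add: e_def)
    have "e powr q = \<eta> / (2 * R + 1)" using \<eta> R(1) q by (simp add: e_def powr_powr)
    then have "e powr q * (2 * R) + e powr q = \<eta>" using R(1) by (simp add: field_simps)
    then show "e powr q * (2 * R) \<le> \<eta>" using powr_ge_zero[of e q] by linarith
  qed
  obtain N where N: "\<And>m n x. N \<le> m \<Longrightarrow> N \<le> n \<Longrightarrow> x \<in> {- R..R} \<Longrightarrow> \<bar>G (r m) x - G (r n) x\<bar> < e"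
    using r(2)[OF e(1)] by blast
  have [measurable]: "b \<in> borel_measurable borel" "\<phi> \<in> borel_measurable borel" "b' \<in> borel_measurable borel"
    "F n \<in> borel_measurable borel" for n
    using bl \<phi>l b'l F(1) by (auto simp: loc_integrable_def in_Lp_def)
  have [measurable]: "commutator b' \<alpha> (F n) \<in> borel_measurable borel" "commutator \<phi> \<alpha> (F n) \<in> borel_measurable borel" for n
    by (auto intro!: commutator_measurable)
  have [measurable]: "G n \<in> borel_measurable borel" for n
  proof -
    have "(\<lambda>x. LINT y|lborel. indicator {- R..R} y *\<^sub>R ((if x < y then (\<phi> x - \<phi> y) / (y - x) powr (1 - \<alpha>) else 0) * F n y)) \<in> borel_measurable borel"
      by (rule lborel.borel_measurable_lebesgue_integral) measurable
    then show ?thesis unfolding G_def[abs_def] set_lebesgue_integral_def comm_kernel_def .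
  qed
  define D where "D n x = commutator b' \<alpha> (F n) x" for n x
  define E where "E n x = commutator \<phi> \<alpha> (F n) x - indicator {- R..R} x * G n x" for n x
  have [measurable]: "D n \<in> borel_measurable borel" "E n \<in> borel_measurable borel" for n
    unfolding D_def E_def by measurable
  have Db: "powr_nn_integral q (D n) \<le> ennreal \<eta>" for n
    using C(2)[OF b'l B(1) b'B F] unfolding B(2) D_def .
  have Eb: "powr_nn_integral q (E n) \<le> ennreal \<eta>" for n
    using R(2)[OF F ae\<phi>] unfolding E_def G_def .
  have split: "AE x in lborel. commutator b \<alpha> (F n) x = D n x + E n x + indicator {- R..R} x * G n x" for n
    using ae\<phi>[of n] aeb[of n]
  proof eventually_elim
    case (elim x)
    then show ?case using commutator_diff[of x b "F n" \<alpha> \<phi>] by (simp add: D_def E_def b'_def[abs_def])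
  qed
  have close: "(powr_nn_integral q (\<lambda>x. commutator b \<alpha> (F (r m)) x - commutator b \<alpha> (F (r n)) x)) \<le> ennreal \<epsilon>"
    if mn: "N \<le> m" "N \<le> n" for m n
  proof -
    let ?H = "\<lambda>x. indicator {- R..R} x * (G (r m) x - G (r n) x)"
    have Hb: "powr_nn_integral q (\<lambda>x. ?H x) \<le> ennreal \<eta>"
    proof -
      have "powr_nn_integral q (\<lambda>x. ?H x) \<le> (\<integral>\<^sup>+x. ennreal (e powr q) * indicator {- R..R} x \<partial>lborel)"
      proof (intro nn_integral_mono)
        fix x
        show "ennreal (\<bar>?H x\<bar> powr q) \<le> ennreal (e powr q) * indicator {- R..R} x"
        proof (cases "x \<in> {- R..R}")
          case True
          then have "\<bar>G (r m) x - G (r n) x\<bar> powr q \<le> e powr q"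
            using N[OF mn True] q by (intro powr_mono2) auto
          then show ?thesis using True by (simp add: ennreal_leI)
        qed simp
      qed
      also have "\<dots> = ennreal (e powr q * (2 * R))"
        using R(1) by (simp add: nn_integral_cmult_indicator ennreal_mult)
      also have "\<dots> \<le> ennreal \<eta>" using e by (intro ennreal_leI)
      finally show ?thesis .
    qed
    have "(powr_nn_integral q (\<lambda>x. commutator b \<alpha> (F (r m)) x - commutator b \<alpha> (F (r n)) x))
      \<le> (\<integral>\<^sup>+x. ennreal K * (ennreal (\<bar>D (r m) x\<bar> powr q) + ennreal (\<bar>D (r n) x\<bar> powr q)
          + ennreal (\<bar>E (r m) x\<bar> powr q) + ennreal (\<bar>E (r n) x\<bar> powr q) + ennreal (\<bar>?H x\<bar> powr q)) \<partial>lborel)"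
    proof (intro nn_integral_mono_AE)
      show "AE x in lborel. ennreal (\<bar>commutator b \<alpha> (F (r m)) x - commutator b \<alpha> (F (r n)) x\<bar> powr q)
        \<le> ennreal K * (ennreal (\<bar>D (r m) x\<bar> powr q) + ennreal (\<bar>D (r n) x\<bar> powr q)
          + ennreal (\<bar>E (r m) x\<bar> powr q) + ennreal (\<bar>E (r n) x\<bar> powr q) + ennreal (\<bar>?H x\<bar> powr q))"
        using split[of "r m"] split[of "r n"]
      proof eventually_elim
        case (elim x)
        have "commutator b \<alpha> (F (r m)) x - commutator b \<alpha> (F (r n)) x
          = (D (r m) x - D (r n) x) + (E (r m) x - E (r n) x) + ?H x"
          unfolding elim by (simp add: algebra_simps)
        then have "\<bar>commutator b \<alpha> (F (r m)) x - commutator b \<alpha> (F (r n)) x\<bar> powr q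
          \<le> K * (\<bar>D (r m) x\<bar> powr q + \<bar>D (r n) x\<bar> powr q + \<bar>E (r m) x\<bar> powr q + \<bar>E (r n) x\<bar> powr q + \<bar>?H x\<bar> powr q)"
          unfolding K_def using powr_sum5_le[of q] q by simp
        then have "ennreal (\<bar>commutator b \<alpha> (F (r m)) x - commutator b \<alpha> (F (r n)) x\<bar> powr q)
          \<le> ennreal (K * (\<bar>D (r m) x\<bar> powr q + \<bar>D (r n) x\<bar> powr q + \<bar>E (r m) x\<bar> powr q + \<bar>E (r n) x\<bar> powr q + \<bar>?H x\<bar> powr q))"
          by (rule ennreal_leI)
        also have "\<dots> = ennreal K * (ennreal (\<bar>D (r m) x\<bar> powr q) + ennreal (\<bar>D (r n) x\<bar> powr q)
          + ennreal (\<bar>E (r m) x\<bar> powr q) + ennreal (\<bar>E (r n) x\<bar> powr q) + ennreal (\<bar>?H x\<bar> powr q))"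
          using K by (subst ennreal_mult) (auto intro!: add_nonneg_nonneg)
        finally show ?case .
      qed
    qed
    also have "\<dots> = ennreal K * ((powr_nn_integral q (D (r m))) + (powr_nn_integral q (D (r n)))
          + (powr_nn_integral q (E (r m))) + (powr_nn_integral q (E (r n)))
          + (powr_nn_integral q (\<lambda>x. ?H x)))"
      by (simp add: nn_integral_cmult nn_integral_add)
    also have "\<dots> \<le> ennreal K * (ennreal \<eta> + ennreal \<eta> + ennreal \<eta> + ennreal \<eta> + ennreal \<eta>)"
      by (intro mult_left_mono add_mono Db Eb Hb) auto
    also have "\<dots> = ennreal (K * (\<eta> + \<eta> + \<eta> + \<eta> + \<eta>))"
      using K \<eta> by (simp add: ennreal_mult[symmetric] ennreal_plus[symmetric] del: ennreal_plus)
    also have "K * (\<eta> + \<eta> + \<eta> + \<eta> + \<eta>) = \<epsilon>" using K by (simp add: \<eta>_def)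
    finally show ?thesis .
  qed
  show ?thesis by (intro exI[of _ r] conjI r(1) exI[of _ N] allI impI close)
qed

theorem theorem3p7:
  fixes p q \<alpha> :: real and b :: "real \<Rightarrow> real"
  assumes "1 < p" and "p < q" and "0 < \<alpha>" and "\<alpha> < 1"
    and "1 / q = 1 / p - \<alpha>"
    and "in_CMO b"
  shows "compact_op p q (commutator b \<alpha>)"
  unfolding compact_op_def
proof (intro conjI allI impI)
  note pq = assms(1-5)
  have bB: "in_BMO b" using assms(6) by (simp add: in_CMO_def)
  show "in_Lp q (commutator b \<alpha> f)" if "in_Lp p f" for f
    using commutator_in_Lq[OF pq bB that] .
  fix F :: "nat \<Rightarrow> real \<Rightarrow> real"
  assume "\<forall>n. in_Lp p (F n) \<and> Lp_norm p (F n) \<le> 1"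
  then have F: "in_Lp p (F n)" "powr_integral p (F n) \<le> 1" for n
    using assms(1) by (auto simp: Lp_norm_le_1_iff)
  define \<Delta> where "\<Delta> m n = (powr_nn_integral q (\<lambda>x. commutator b \<alpha> (F m) x - commutator b \<alpha> (F n) x))" for m n
  define P where "P j s \<longleftrightarrow> (\<exists>N. \<forall>m\<ge>N. \<forall>n\<ge>N. \<Delta> (s m) (s n) \<le> ennreal (1 / real (Suc j)))" for j and s :: "nat \<Rightarrow> nat"
  interpret subseqs P
  proof
    fix j :: nat and s :: "nat \<Rightarrow> nat" assume "strict_mono s"
    show "\<exists>r'. strict_mono r' \<and> P j (s \<circ> r')"
      using commutator_almost_Cauchy_subseq[OF pq assms(6), of "1 / real (Suc j)" "\<lambda>n. F (s n)"] F
      unfolding P_def \<Delta>_def by simp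
  qed
  \<comment> \<open>As an eventual condition on pairs of indices, \<open>P j\<close> passes to
    subsequences, which is what the diagonal construction requires.\<close>
  have "P j (s \<circ> r)" if "strict_mono r" "P j s" for j s and r :: "nat \<Rightarrow> nat"
    using that seq_suble[OF that(1)] unfolding P_def by (metis comp_apply order.trans)
  \<comment> \<open>The diagonal sequence is known to inherit the j-th property only from index
    \<open>Suc j\<close> on. The shift is undone below by starting the Cauchy condition at
    \<open>Suc j + N\<close>.\<close>
  then have P: "P j (diagseq \<circ> (+) (Suc j))" for j by (rule diagseq_holds)
  have "\<exists>g. in_Lp q g \<and> (\<lambda>n. Lp_norm q (\<lambda>x. commutator b \<alpha> (F (diagseq n)) x - g x)) \<longlonglongrightarrow> 0"
  proof (rule Lq_complete)
    show "0 < q" using assms by simp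
    show "in_Lp q (commutator b \<alpha> (F (diagseq n)))" for n by (rule commutator_in_Lq[OF pq bB F(1)])
    fix \<epsilon> :: real assume "0 < \<epsilon>"
    then obtain j where j: "1 / real (Suc j) < \<epsilon>" using nat_approx_posE by blast
    obtain N where N: "\<And>m n. N \<le> m \<Longrightarrow> N \<le> n \<Longrightarrow> \<Delta> (diagseq (Suc j + m)) (diagseq (Suc j + n)) \<le> ennreal (1 / real (Suc j))"
      using P[of j] unfolding P_def by auto
    have "\<Delta> (diagseq m) (diagseq n) \<le> ennreal \<epsilon>" if "Suc j + N \<le> m" "Suc j + N \<le> n" for m n
    proof -
      have "N \<le> m - Suc j" "N \<le> n - Suc j" "Suc j + (m - Suc j) = m" "Suc j + (n - Suc j) = n" using that by auto
      with N[of "m - Suc j" "n - Suc j"] have "\<Delta> (diagseq m) (diagseq n) \<le> ennreal (1 / real (Suc j))" by simp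
      also have "\<dots> \<le> ennreal \<epsilon>" using j by (intro ennreal_leI) simp
      finally show ?thesis .
    qed
    then show "\<exists>N. \<forall>m\<ge>N. \<forall>n\<ge>N. (\<integral>\<^sup>+x. ennreal (\<bar>commutator b \<alpha> (F (diagseq m)) x
        - commutator b \<alpha> (F (diagseq n)) x\<bar> powr q) \<partial>lborel) \<le> ennreal \<epsilon>"
      unfolding \<Delta>_def by blast
  qed
  then show "\<exists>r g. strict_mono r \<and> in_Lp q g \<and> (\<lambda>n. Lp_norm q (\<lambda>x. commutator b \<alpha> (F (r n)) x - g x)) \<longlonglongrightarrow> 0"
    using subseq_diagseq by blast
qed

end
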